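(* Let $K$ be a field with a ring topology $\tau$, and let $n\ge 1$. (1) $\tau$ is a $W_n$-topology if and only if $(K,\tau)$ is locally equivalent to a field with a topology induced by a $W_n$-ring. (2) If $\tau$ is a $W_n$-topology, then $\tau$ is a field topology (i.e. division is continuous). (3) If $\tau$ is a $W_n$-topology, then $\tau$ is a $W_m$-topology for every $m>n$. (4) $\tau$ is a $W_1$-topology if and only if $\tau$ is a V-topology.
   Context: A ring topology on a field $K$ is a Hausdorff non-discrete topology for which the ring operations are continuous. A set $S\subseteq K$ is bounded if for every neighborhood $U$ of $0$ there is $c\in K^\times$ with $cS\subseteq U$; a ring topology is locally bounded if some neighborhood of $0$ is bounded. A $W_n$-set in $K$ is a subset $S\subseteq K$ such that for all $x_1,\ldots,x_{n+1}\in K$ there is $i\le n+1$ with $x_i\in\sum_{j\ne i}x_j\cdot S$. A $W_n$-topology on $K$ is a locally bounded ring topology such that for every neighborhood $U$ of $0$ there is $c\in K^\times$ such that $cU$ is a $W_n$-set. A $W_n$-ring on $K$ is a subring $R\subseteq K$ with $\operatorname{Frac}(R)=K$ that is a $W_n$-set in $K$. If $R\ne K$ and $\operatorname{Frac}(R)=K$, the topology induced by $R$ is the ring topology on $K$ with neighborhood basis of $0$ given by $\{cR:c\in K^\times\}$. A V-topology is a ring topology such that for every neighborhood $U$ of $0$ there is a neighborhood $V$ of $0$ such that $xy\in V$ implies $x\in U$ or $y\in U$. Local equivalence: identify a ring topology $\tau$ with its set of neighborhoods of $0$, and view $(K,\tau)$ as a two-sorted structure with the ring structure on $K$ and the membership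 relation between $K$ and $\tau$. A local sentence is a first-order sentence in this language in which quantification over $\tau$ is restricted as follows: in a subformula $\forall U\in\tau\,\phi(U)$ the variable $U$ occurs only positively in $\phi$, and in a subformula $\exists U\in\tau\,\phi(U)$ it occurs only negatively. Two topological fields are locally equivalent if they satisfy the same local sentences. *)

theory Defs
  imports "HOL-Analysis.Analysis" "HOL-Algebra.Algebra"
begin

section \<open>Ring topologies\<close>

definition ring_topology :: "('a, 'm) ring_scheme \<Rightarrow> 'a topology \<Rightarrow> bool" where
  "ring_topology K T \<longleftrightarrow>
     topspace T = carrier K \<and>
     Hausdorff_space T \<and>
     T \<noteq> discrete_topology (carrier K) \<and>
     continuous_map (prod_topology T T) T (\<lambda>(x, y). x \<oplus>\<^bsub>K\<^esub> y) \<and>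
     continuous_map T T (\<lambda>x. \<ominus>\<^bsub>K\<^esub> x) \<and>
     continuous_map (prod_topology T T) T (\<lambda>(x, y). x \<otimes>\<^bsub>K\<^esub> y)"

definition field_topology :: "('a, 'm) ring_scheme \<Rightarrow> 'a topology \<Rightarrow> bool" where
  "field_topology K T \<longleftrightarrow>
     ring_topology K T \<and>
     continuous_map (prod_topology T (subtopology T (carrier K - {\<zero>\<^bsub>K\<^esub>}))) T
       (\<lambda>(x, y). x \<otimes>\<^bsub>K\<^esub> inv\<^bsub>K\<^esub> y)"

text \<open>Neighbourhoods are not required to be open.\<close>

definition zero_nbhds :: "('a, 'm) ring_scheme \<Rightarrow> 'a topology \<Rightarrow> 'a set set" where
  "zero_nbhds K T = {U. U \<subseteq> topspace T \<and> (\<exists>V. openin T V \<and> \<zero>\<^bsub>K\<^esub> \<in> V \<and> V \<subseteq> U)}"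

definition bounded_subset :: "('a, 'm) ring_scheme \<Rightarrow> 'a topology \<Rightarrow> 'a set \<Rightarrow> bool" where
  "bounded_subset K T S \<longleftrightarrow>
     S \<subseteq> carrier K \<and>
     (\<forall>U\<in>zero_nbhds K T. \<exists>c\<in>carrier K - {\<zero>\<^bsub>K\<^esub>}. c <#\<^bsub>K\<^esub> S \<subseteq> U)"

definition locally_bounded :: "('a, 'm) ring_scheme \<Rightarrow> 'a topology \<Rightarrow> bool" where
  "locally_bounded K T \<longleftrightarrow> (\<exists>U\<in>zero_nbhds K T. bounded_subset K T U)"

definition V_topology :: "('a, 'm) ring_scheme \<Rightarrow> 'a topology \<Rightarrow> bool" where
  "V_topology K T \<longleftrightarrow>
     ring_topology K T \<and>
     (\<forall>U\<in>zero_nbhds K T. \<exists>V\<in>zero_nbhds K T.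
        \<forall>x\<in>carrier K. \<forall>y\<in>carrier K. x \<otimes>\<^bsub>K\<^esub> y \<in> V \<longrightarrow> x \<in> U \<or> y \<in> U)"

section \<open>$W_n$-sets, $W_n$-topologies and $W_n$-rings\<close>

definition W_set :: "nat \<Rightarrow> ('a, 'm) ring_scheme \<Rightarrow> 'a set \<Rightarrow> bool" where
  "W_set n K S \<longleftrightarrow>
     S \<subseteq> carrier K \<and>
     (\<forall>x \<in> {1..n+1} \<rightarrow> carrier K. \<exists>i\<in>{1..n+1}. \<exists>s \<in> {1..n+1} - {i} \<rightarrow> S.
        x i = (\<Oplus>\<^bsub>K\<^esub>j\<in>{1..n+1} - {i}. x j \<otimes>\<^bsub>K\<^esub> s j))"

definition W_topology :: "nat \<Rightarrow> ('a, 'm) ring_scheme \<Rightarrow> 'a topology \<Rightarrow> bool" where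
  "W_topology n K T \<longleftrightarrow>
     ring_topology K T \<and>
     locally_bounded K T \<and>
     (\<forall>U\<in>zero_nbhds K T. \<exists>c\<in>carrier K - {\<zero>\<^bsub>K\<^esub>}. W_set n K (c <#\<^bsub>K\<^esub> U))"

definition fractions :: "('a, 'm) ring_scheme \<Rightarrow> 'a set \<Rightarrow> 'a set" where
  "fractions K R = {a \<otimes>\<^bsub>K\<^esub> inv\<^bsub>K\<^esub> b | a b. a \<in> R \<and> b \<in> R - {\<zero>\<^bsub>K\<^esub>}}"

definition W_ring :: "nat \<Rightarrow> ('a, 'm) ring_scheme \<Rightarrow> 'a set \<Rightarrow> bool" where
  "W_ring n K R \<longleftrightarrow> subring R K \<and> fractions K R = carrier K \<and> W_set n K R"

definition induced_topology :: "('a, 'm) ring_scheme \<Rightarrow> 'a set \<Rightarrow> 'a topology" where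
  "induced_topology K R = topology (\<lambda>U.
     U \<subseteq> carrier K \<and>
     (\<forall>x\<in>U. \<exists>c\<in>carrier K - {\<zero>\<^bsub>K\<^esub>}. x <+\<^bsub>K\<^esub> (c <#\<^bsub>K\<^esub> R) \<subseteq> U))"

section \<open>Local sentences\<close>

text \<open>
  Syntax of the two-sorted language. Element variables and set variables are both named
  by natural numbers, but are separate. As usual for this language, there is no equality
  between set variables; they only occur in membership atoms.
\<close>

datatype rterm =
    Var nat
  | Zero
  | One
  | Plus rterm rterm
  | Minus rterm
  | Times rterm rterm

datatype form =
    Eq rterm rterm
  | Mem rterm nat
  | Neg form
  | Conj form form
  | Disj form form
  | Impl form form
  | AllElt nat form
  | ExElt nat form
  | AllSet nat form
  | ExSet nat form

primrec term_vars :: "rterm \<Rightarrow> nat set" where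
  "term_vars (Var x) = {x}"
| "term_vars Zero = {}"
| "term_vars One = {}"
| "term_vars (Plus t u) = term_vars t \<union> term_vars u"
| "term_vars (Minus t) = term_vars t"
| "term_vars (Times t u) = term_vars t \<union> term_vars u"

primrec free_elt_vars :: "form \<Rightarrow> nat set" where
  "free_elt_vars (Eq t u) = term_vars t \<union> term_vars u"
| "free_elt_vars (Mem t V) = term_vars t"
| "free_elt_vars (Neg f) = free_elt_vars f"
| "free_elt_vars (Conj f g) = free_elt_vars f \<union> free_elt_vars g"
| "free_elt_vars (Disj f g) = free_elt_vars f \<union> free_elt_vars g"
| "free_elt_vars (Impl f g) = free_elt_vars f \<union> free_elt_vars g"
| "free_elt_vars (AllElt x f) = free_elt_vars f - {x}"
| "free_elt_vars (ExElt x f) = free_elt_vars f - {x}"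
| "free_elt_vars (AllSet V f) = free_elt_vars f"
| "free_elt_vars (ExSet V f) = free_elt_vars f"

text \<open>
  The set variables with a free positive occurrence (\<^term>\<open>signed_set_vars True f\<close>),
  respectively a free negative one (\<^term>\<open>signed_set_vars False f\<close>). An occurrence is
  negative if it lies in the scope of an odd number of negations, the premise of an
  implication counting as negated.
\<close>

primrec signed_set_vars :: "bool \<Rightarrow> form \<Rightarrow> nat set" where
  "signed_set_vars b (Eq t u) = {}"
| "signed_set_vars b (Mem t V) = (if b then {V} else {})"
| "signed_set_vars b (Neg f) = signed_set_vars (\<not> b) f"
| "signed_set_vars b (Conj f g) = signed_set_vars b f \<union> signed_set_vars b g"
| "signed_set_vars b (Disj f g) = signed_set_vars b f \<union> signed_set_vars b g"
| "signed_set_vars b (Impl f g) = signed_set_vars (\<not> b) f \<union> signed_set_vars b g"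
| "signed_set_vars b (AllElt x f) = signed_set_vars b f"
| "signed_set_vars b (ExElt x f) = signed_set_vars b f"
| "signed_set_vars b (AllSet V f) = signed_set_vars b f - {V}"
| "signed_set_vars b (ExSet V f) = signed_set_vars b f - {V}"

primrec local_form :: "form \<Rightarrow> bool" where
  "local_form (Eq t u) \<longleftrightarrow> True"
| "local_form (Mem t V) \<longleftrightarrow> True"
| "local_form (Neg f) \<longleftrightarrow> local_form f"
| "local_form (Conj f g) \<longleftrightarrow> local_form f \<and> local_form g"
| "local_form (Disj f g) \<longleftrightarrow> local_form f \<and> local_form g"
| "local_form (Impl f g) \<longleftrightarrow> local_form f \<and> local_form g"
| "local_form (AllElt x f) \<longleftrightarrow> local_form f"
| "local_form (ExElt x f) \<longleftrightarrow> local_form f"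
| "local_form (AllSet V f) \<longleftrightarrow> V \<notin> signed_set_vars False f \<and> local_form f"
| "local_form (ExSet V f) \<longleftrightarrow> V \<notin> signed_set_vars True f \<and> local_form f"

definition local_sentence :: "form \<Rightarrow> bool" where
  "local_sentence f \<longleftrightarrow>
     local_form f \<and> free_elt_vars f = {} \<and>
     signed_set_vars True f = {} \<and> signed_set_vars False f = {}"

primrec eval_term :: "('a, 'm) ring_scheme \<Rightarrow> (nat \<Rightarrow> 'a) \<Rightarrow> rterm \<Rightarrow> 'a" where
  "eval_term K e (Var x) = e x"
| "eval_term K e Zero = \<zero>\<^bsub>K\<^esub>"
| "eval_term K e One = \<one>\<^bsub>K\<^esub>"
| "eval_term K e (Plus t u) = eval_term K e t \<oplus>\<^bsub>K\<^esub> eval_term K e u"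
| "eval_term K e (Minus t) = \<ominus>\<^bsub>K\<^esub> eval_term K e t"
| "eval_term K e (Times t u) = eval_term K e t \<otimes>\<^bsub>K\<^esub> eval_term K e u"

primrec sat :: "('a, 'm) ring_scheme \<Rightarrow> 'a set set \<Rightarrow> (nat \<Rightarrow> 'a) \<Rightarrow> (nat \<Rightarrow> 'a set) \<Rightarrow> form \<Rightarrow> bool"
where
  "sat K \<tau> e s (Eq t u) \<longleftrightarrow> eval_term K e t = eval_term K e u"
| "sat K \<tau> e s (Mem t V) \<longleftrightarrow> eval_term K e t \<in> s V"
| "sat K \<tau> e s (Neg f) \<longleftrightarrow> \<not> sat K \<tau> e s f"
| "sat K \<tau> e s (Conj f g) \<longleftrightarrow> sat K \<tau> e s f \<and> sat K \<tau> e s g"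
| "sat K \<tau> e s (Disj f g) \<longleftrightarrow> sat K \<tau> e s f \<or> sat K \<tau> e s g"
| "sat K \<tau> e s (Impl f g) \<longleftrightarrow> (sat K \<tau> e s f \<longrightarrow> sat K \<tau> e s g)"
| "sat K \<tau> e s (AllElt x f) \<longleftrightarrow> (\<forall>a\<in>carrier K. sat K \<tau> (e(x := a)) s f)"
| "sat K \<tau> e s (ExElt x f) \<longleftrightarrow> (\<exists>a\<in>carrier K. sat K \<tau> (e(x := a)) s f)"
| "sat K \<tau> e s (AllSet V f) \<longleftrightarrow> (\<forall>U\<in>\<tau>. sat K \<tau> e (s(V := U)) f)"
| "sat K \<tau> e s (ExSet V f) \<longleftrightarrow> (\<exists>U\<in>\<tau>. sat K \<tau> e (s(V := U)) f)"

definition models :: "('a, 'm) ring_scheme \<Rightarrow> 'a topology \<Rightarrow> form \<Rightarrow> bool" where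
  "models K T f \<longleftrightarrow>
     (\<forall>e \<in> UNIV \<rightarrow> carrier K. \<forall>s \<in> UNIV \<rightarrow> zero_nbhds K T. sat K (zero_nbhds K T) e s f)"

definition locally_equivalent ::
  "('a, 'm) ring_scheme \<Rightarrow> 'a topology \<Rightarrow> ('b, 'k) ring_scheme \<Rightarrow> 'b topology \<Rightarrow> bool" where
  "locally_equivalent K T L T' \<longleftrightarrow>
     (\<forall>f. local_sentence f \<longrightarrow> (models K T f \<longleftrightarrow> models L T' f))"

section \<open>The topology induced by a subring is a ring topology\<close>

text \<open>
  The set system in the definition of \<^const>\<open>induced_topology\<close> is a topology only if
  \<^term>\<open>R\<close> is a subring with \<^prop>\<open>fractions K R = carrier K\<close>.
\<close>

locale frac_subring = field K for K (structure) +
  fixes R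
  assumes R_subring: "subring R K"
    and R_frac: "fractions K R = carrier K"
begin

lemma R_sub: "R \<subseteq> carrier K"
  using R_subring subringE(1) by blast

lemma R_closed:
  "\<zero> \<in> R" "\<one> \<in> R" "a \<in> R \<Longrightarrow> \<ominus> a \<in> R"
  "a \<in> R \<Longrightarrow> b \<in> R \<Longrightarrow> a \<oplus> b \<in> R" "a \<in> R \<Longrightarrow> b \<in> R \<Longrightarrow> a \<otimes> b \<in> R"
  using subringE[OF R_subring] by auto

lemma denominator:
  assumes "x \<in> carrier K"
  obtains b where "b \<in> R" "b \<noteq> \<zero>" "b \<otimes> x \<in> R"
proof -
  obtain a b where ab: "a \<in> R" "b \<in> R" "b \<noteq> \<zero>" "x = a \<otimes> inv b"
    using assms R_frac unfolding fractions_def by force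
  have c: "a \<in> carrier K" "b \<in> carrier K" "b \<in> Units K"
    using ab R_sub field_Units by auto
  have "b \<otimes> x = a \<otimes> (b \<otimes> inv b)"
    unfolding ab(4) using c by (simp add: m_lcomm)
  also have "\<dots> = a" using c by simp
  finally show ?thesis using that ab by simp
qed

lemma common_denominator:
  assumes "finite A" "A \<subseteq> carrier K"
  obtains b where "b \<in> R" "b \<noteq> \<zero>" "\<forall>x\<in>A. b \<otimes> x \<in> R"
proof -
  have "\<exists>b\<in>R. b \<noteq> \<zero> \<and> (\<forall>x\<in>A. b \<otimes> x \<in> R)"
    using assms
  proof (induction A rule: finite_induct)
    case empty
    then show ?case using R_closed(2) one_not_zero by blast
  next
    case (insert y A)
    then obtain b where b: "b \<in> R" "b \<noteq> \<zero>" "\<forall>x\<in>A. b \<otimes> x \<in> R" by auto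
    obtain d where d: "d \<in> R" "d \<noteq> \<zero>" "d \<otimes> y \<in> R"
      using insert.prems denominator by auto
    have c: "b \<in> carrier K" "d \<in> carrier K" using b d R_sub by auto
    have "(b \<otimes> d) \<otimes> y \<in> R"
      using b d c insert.prems R_closed(5)[of b "d \<otimes> y"] by (simp add: m_assoc)
    moreover have "(b \<otimes> d) \<otimes> x \<in> R" if "x \<in> A" for x
    proof -
      have "x \<in> carrier K" using that insert.prems by auto
      then have "(b \<otimes> d) \<otimes> x = d \<otimes> (b \<otimes> x)" using c by (simp add: m_ac)
      then show ?thesis using b d that R_closed(5) by auto
    qed
    moreover have "b \<otimes> d \<noteq> \<zero>" using b d c integral by blast
    ultimately show ?case using b d R_closed(5) by blast
  qed
  then show ?thesis using that by blast
qed

definition coset :: "'a \<Rightarrow> 'a \<Rightarrow> 'a set" where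
  "coset x c = x <+ (c <#\<^bsub>K\<^esub> R)"

lemma mem_coset: "y \<in> coset x c \<longleftrightarrow> (\<exists>r\<in>R. y = x \<oplus> c \<otimes> r)"
  unfolding coset_def a_l_coset_def l_coset_def by auto

lemma coset_carrier: "x \<in> carrier K \<Longrightarrow> c \<in> carrier K \<Longrightarrow> coset x c \<subseteq> carrier K"
  using R_sub by (auto simp: mem_coset subset_iff)

lemma coset_zero: "c \<in> carrier K \<Longrightarrow> coset \<zero> c = c <#\<^bsub>K\<^esub> R"
  using R_sub by (auto simp: set_eq_iff mem_coset l_coset_def subset_iff)

lemma self_mem_coset: "x \<in> carrier K \<Longrightarrow> c \<in> carrier K \<Longrightarrow> x \<in> coset x c"
  using R_closed(1) by (force simp: mem_coset)

lemma coset_mult: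
  assumes "x \<in> carrier K" "c \<in> carrier K" "r \<in> R"
  shows "coset x (c \<otimes> r) \<subseteq> coset x c"
proof
  fix y assume "y \<in> coset x (c \<otimes> r)"
  then obtain q where q: "q \<in> R" "y = x \<oplus> (c \<otimes> r) \<otimes> q" by (auto simp: mem_coset)
  then have "y = x \<oplus> c \<otimes> (r \<otimes> q)" using assms R_sub by (simp add: m_assoc subset_iff)
  then show "y \<in> coset x c" using q assms R_closed(5) by (auto simp: mem_coset)
qed

lemma coset_trans:
  assumes "x \<in> carrier K" "c \<in> carrier K" "y \<in> coset x c"
  shows "coset y c \<subseteq> coset x c"
proof
  fix z assume "z \<in> coset y c"
  then obtain r where r: "r \<in> R" "z = y \<oplus> c \<otimes> r" by (auto simp: mem_coset)
  obtain q where q: "q \<in> R" "y = x \<oplus> c \<otimes> q" using assms by (auto simp: mem_coset)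
  have "r \<in> carrier K" "q \<in> carrier K" using q r R_sub by auto
  then have "z = x \<oplus> c \<otimes> (q \<oplus> r)"
    using q r assms by (simp add: r_distr a_assoc)
  then show "z \<in> coset x c" using q r R_closed(4) by (auto simp: mem_coset)
qed

lemma istopology_induced:
  "istopology (\<lambda>U. U \<subseteq> carrier K \<and> (\<forall>x\<in>U. \<exists>c\<in>carrier K - {\<zero>}. coset x c \<subseteq> U))"
  unfolding istopology_def
proof (intro conjI allI impI ballI)
  fix S U x
  assume S: "S \<subseteq> carrier K \<and> (\<forall>x\<in>S. \<exists>c\<in>carrier K - {\<zero>}. coset x c \<subseteq> S)"
    and U: "U \<subseteq> carrier K \<and> (\<forall>x\<in>U. \<exists>c\<in>carrier K - {\<zero>}. coset x c \<subseteq> U)"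
    and x: "x \<in> S \<inter> U"
  obtain c d where c: "c \<in> carrier K" "c \<noteq> \<zero>" "coset x c \<subseteq> S"
    and d: "d \<in> carrier K" "d \<noteq> \<zero>" "coset x d \<subseteq> U"
    using S U x by blast
  obtain b where b: "b \<in> R" "b \<noteq> \<zero>" "\<forall>z\<in>{inv c \<otimes> d}. b \<otimes> z \<in> R"
    using common_denominator[of "{inv c \<otimes> d}"] c d by (auto simp: field_Units)
  have bc: "b \<in> carrier K" using b R_sub by auto
  have "d \<otimes> b = c \<otimes> (b \<otimes> (inv c \<otimes> d))"
  proof -
    have "inv c \<in> carrier K" "c \<otimes> inv c = \<one>" using c by (auto simp: field_Units)
    moreover have "c \<otimes> (b \<otimes> (inv c \<otimes> d)) = (c \<otimes> inv c) \<otimes> (d \<otimes> b)"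
      using bc c(1) d(1) calculation(1) by (metis m_assoc m_closed m_comm)
    ultimately show ?thesis using bc d by simp
  qed
  then have "coset x (d \<otimes> b) \<subseteq> coset x c"
    using coset_mult[of x c "b \<otimes> (inv c \<otimes> d)"] b c x S by auto
  moreover have "coset x (d \<otimes> b) \<subseteq> coset x d"
    using coset_mult[of x d b] b d x S by auto
  moreover have "d \<otimes> b \<noteq> \<zero>" using b d bc integral by blast
  ultimately show "\<exists>c\<in>carrier K - {\<zero>}. coset x c \<subseteq> S \<inter> U"
    using bc c d by (intro bexI[of _ "d \<otimes> b"]) auto
next
  fix S U assume "S \<subseteq> carrier K \<and> (\<forall>x\<in>S. \<exists>c\<in>carrier K - {\<zero>}. coset x c \<subseteq> S)"
  then show "S \<inter> U \<subseteq> carrier K" by blast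
next
  fix \<K> :: "'a set set"
  assume "\<forall>S\<in>\<K>. S \<subseteq> carrier K \<and> (\<forall>x\<in>S. \<exists>c\<in>carrier K - {\<zero>}. coset x c \<subseteq> S)"
  then show "\<Union>\<K> \<subseteq> carrier K" by blast
next
  fix \<K> :: "'a set set" and x
  assume *: "\<forall>S\<in>\<K>. S \<subseteq> carrier K \<and> (\<forall>x\<in>S. \<exists>c\<in>carrier K - {\<zero>}. coset x c \<subseteq> S)"
    and "x \<in> \<Union>\<K>"
  then obtain S where S: "S \<in> \<K>" "x \<in> S" by blast
  then obtain c where "c \<in> carrier K - {\<zero>}" "coset x c \<subseteq> S" using * by blast
  then show "\<exists>c\<in>carrier K - {\<zero>}. coset x c \<subseteq> \<Union>\<K>" using S by blast
qed

lemma openin_induced: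
  "openin (induced_topology K R) U \<longleftrightarrow>
     U \<subseteq> carrier K \<and> (\<forall>x\<in>U. \<exists>c\<in>carrier K - {\<zero>}. coset x c \<subseteq> U)"
  unfolding induced_topology_def coset_def[symmetric]
  by (simp only: topology_inverse'[OF istopology_induced])

lemma openin_coset:
  assumes "x \<in> carrier K" "c \<in> carrier K" "c \<noteq> \<zero>"
  shows "openin (induced_topology K R) (coset x c)"
  unfolding openin_induced using assms coset_carrier coset_trans by blast

lemma topspace_induced: "topspace (induced_topology K R) = carrier K"
proof
  show "topspace (induced_topology K R) \<subseteq> carrier K"
    using openin_topspace openin_induced by blast
  have "openin (induced_topology K R) (carrier K)"
    unfolding openin_induced using coset_carrier one_not_zero by blast
  then show "carrier K \<subseteq> topspace (induced_topology K R)" by (rule openin_subset)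
qed

theorem zero_nbhds_induced:
  "U \<in> zero_nbhds K (induced_topology K R) \<longleftrightarrow>
     U \<subseteq> carrier K \<and> (\<exists>c\<in>carrier K - {\<zero>}. c <#\<^bsub>K\<^esub> R \<subseteq> U)"
proof (intro iffI conjI)
  assume "U \<in> zero_nbhds K (induced_topology K R)"
  then show "U \<subseteq> carrier K" by (auto simp: zero_nbhds_def topspace_induced)
next
  assume "U \<in> zero_nbhds K (induced_topology K R)"
  then obtain V where "openin (induced_topology K R) V" "\<zero> \<in> V" "V \<subseteq> U"
    by (auto simp: zero_nbhds_def)
  then obtain c where "c \<in> carrier K - {\<zero>}" "coset \<zero> c \<subseteq> U" by (meson openin_induced subset_trans)
  then show "\<exists>c\<in>carrier K - {\<zero>}. c <#\<^bsub>K\<^esub> R \<subseteq> U" by (auto simp: coset_zero)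
next
  assume "U \<subseteq> carrier K \<and> (\<exists>c\<in>carrier K - {\<zero>}. c <#\<^bsub>K\<^esub> R \<subseteq> U)"
  then obtain c where "U \<subseteq> carrier K" "c \<in> carrier K" "c <#\<^bsub>K\<^esub> R \<subseteq> U" "c \<noteq> \<zero>" by blast
  then show "U \<in> zero_nbhds K (induced_topology K R)"
    unfolding zero_nbhds_def topspace_induced
    using openin_coset[of \<zero> c] self_mem_coset[of \<zero> c] by (auto simp: coset_zero)
qed

lemma continuous_induced_binary:
  assumes cl: "\<And>x y. x \<in> carrier K \<Longrightarrow> y \<in> carrier K \<Longrightarrow> f x y \<in> carrier K"
    and cont: "\<And>x y c. x \<in> carrier K \<Longrightarrow> y \<in> carrier K \<Longrightarrow> c \<in> carrier K \<Longrightarrow> c \<noteq> \<zero> \<Longrightarrow>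
      \<exists>d\<in>carrier K - {\<zero>}. \<forall>r\<in>R. \<forall>q\<in>R. f (x \<oplus> d \<otimes> r) (y \<oplus> d \<otimes> q) \<in> coset (f x y) c"
  shows "continuous_map (prod_topology (induced_topology K R) (induced_topology K R))
           (induced_topology K R) (\<lambda>(x, y). f x y)"
  unfolding continuous_map_def
proof (intro conjI allI impI)
  show "(\<lambda>(x, y). f x y) \<in> topspace (prod_topology (induced_topology K R) (induced_topology K R))
          \<rightarrow> topspace (induced_topology K R)"
    using cl by (auto simp: topspace_induced)
next
  fix U assume U: "openin (induced_topology K R) U"
  show "openin (prod_topology (induced_topology K R) (induced_topology K R))
          {p \<in> topspace (prod_topology (induced_topology K R) (induced_topology K R)).
             (case p of (x, y) \<Rightarrow> f x y) \<in> U}"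
    unfolding openin_prod_topology_alt
  proof (intro allI impI)
    fix x y
    assume "(x, y) \<in> {p \<in> topspace (prod_topology (induced_topology K R) (induced_topology K R)).
             (case p of (x, y) \<Rightarrow> f x y) \<in> U}"
    then have xy: "x \<in> carrier K" "y \<in> carrier K" "f x y \<in> U" by (auto simp: topspace_induced)
    obtain c where c: "c \<in> carrier K" "c \<noteq> \<zero>" "coset (f x y) c \<subseteq> U"
      using U xy(3) unfolding openin_induced by blast
    obtain d where d: "d \<in> carrier K" "d \<noteq> \<zero>"
      and fd: "\<And>r q. r \<in> R \<Longrightarrow> q \<in> R \<Longrightarrow> f (x \<oplus> d \<otimes> r) (y \<oplus> d \<otimes> q) \<in> coset (f x y) c"
      using cont[OF xy(1,2) c(1,2)] by blast
    have "coset x d \<times> coset y d \<subseteq> {p \<in> carrier K \<times> carrier K. (case p of (x, y) \<Rightarrow> f x y) \<in> U}"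
    proof
      fix p assume "p \<in> coset x d \<times> coset y d"
      then obtain u v where p: "p = (u, v)" "u \<in> coset x d" "v \<in> coset y d" by auto
      then have "f u v \<in> coset (f x y) c" using fd by (auto simp: mem_coset)
      then show "p \<in> {p \<in> carrier K \<times> carrier K. (case p of (x, y) \<Rightarrow> f x y) \<in> U}"
        using p c coset_carrier[OF xy(1) d(1)] coset_carrier[OF xy(2) d(1)] by auto
    qed
    then show "\<exists>A B. openin (induced_topology K R) A \<and> openin (induced_topology K R) B \<and>
        x \<in> A \<and> y \<in> B \<and>
        A \<times> B \<subseteq> {p \<in> topspace (prod_topology (induced_topology K R) (induced_topology K R)).
             (case p of (x, y) \<Rightarrow> f x y) \<in> U}"
      using openin_coset[OF xy(1) d] openin_coset[OF xy(2) d]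
        self_mem_coset[OF xy(1) d(1)] self_mem_coset[OF xy(2) d(1)]
      by (intro exI[of _ "coset x d"] exI[of _ "coset y d"]) (auto simp: topspace_induced)
  qed
qed

theorem ring_topology_induced:
  assumes "R \<noteq> carrier K"
  shows "ring_topology K (induced_topology K R)"
  unfolding ring_topology_def
proof (intro conjI)
  let ?T = "induced_topology K R"
  show "topspace ?T = carrier K" by (rule topspace_induced)
  show "Hausdorff_space ?T"
    unfolding Hausdorff_space_def topspace_induced
  proof (intro allI impI)
    fix x y assume xy: "x \<in> carrier K \<and> y \<in> carrier K \<and> x \<noteq> y"
    obtain w where w: "w \<in> carrier K" "w \<notin> R" using assms R_sub by blast
    then have w0: "w \<noteq> \<zero>" using R_closed(1) by auto
    define z where "z = y \<ominus> x"
    define c where "c = z \<otimes> inv w"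
    have z: "z \<in> carrier K" "z \<noteq> \<zero>" using xy by (auto simp: z_def)
    have iw: "inv w \<in> carrier K" "inv w \<otimes> w = \<one>" using w w0 by (auto simp: field_Units)
    have c: "c \<in> carrier K" "c \<otimes> w = z" using z w iw by (auto simp: c_def m_assoc)
    then have c0: "c \<noteq> \<zero>" using z w by auto
    have "disjnt (coset x c) (coset y c)"
    proof (rule ccontr)
      assume "\<not> disjnt (coset x c) (coset y c)"
      then obtain r q where r: "r \<in> R" "q \<in> R" "x \<oplus> c \<otimes> r = y \<oplus> c \<otimes> q"
        by (auto simp: disjnt_iff mem_coset)
      then have rc: "r \<in> carrier K" "q \<in> carrier K" using R_sub by auto
      have "z = c \<otimes> (r \<ominus> q)"
      proof -
        have "z = (x \<oplus> c \<otimes> r) \<ominus> c \<otimes> q \<ominus> x"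
          unfolding r(3) z_def using xy c rc by algebra
        also have "\<dots> = c \<otimes> (r \<ominus> q)" using xy c rc by algebra
        finally show ?thesis .
      qed
      then have "c \<otimes> w = c \<otimes> (r \<ominus> q)" using c by simp
      then have "w = r \<ominus> q" using c c0 w rc m_lcancel by auto
      then show False using w r R_closed by (auto simp: a_minus_def)
    qed
    then show "\<exists>U V. openin ?T U \<and> openin ?T V \<and> x \<in> U \<and> y \<in> V \<and> disjnt U V"
      using xy openin_coset[OF _ c(1) c0] self_mem_coset[OF _ c(1)]
      by (intro exI[of _ "coset x c"] exI[of _ "coset y c"]) auto
  qed
  show "?T \<noteq> discrete_topology (carrier K)"
  proof
    assume "?T = discrete_topology (carrier K)"
    then have "openin ?T {\<zero>}" by simp
    then obtain c where c: "c \<in> carrier K" "c \<noteq> \<zero>" "coset \<zero> c \<subseteq> {\<zero>}"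
      by (auto simp: openin_induced)
    then have "c \<in> coset \<zero> c" using R_closed(2) by (force simp: mem_coset)
    then show False using c by auto
  qed
  show "continuous_map (prod_topology ?T ?T) ?T (\<lambda>(x, y). x \<oplus> y)"
  proof (rule continuous_induced_binary)
    fix x y c assume a: "x \<in> carrier K" "y \<in> carrier K" "c \<in> carrier K" "c \<noteq> \<zero>"
    have "(x \<oplus> c \<otimes> r) \<oplus> (y \<oplus> c \<otimes> q) \<in> coset (x \<oplus> y) c" if "r \<in> R" "q \<in> R" for r q
    proof -
      have "r \<in> carrier K" "q \<in> carrier K" using that R_sub by auto
      then have "(x \<oplus> c \<otimes> r) \<oplus> (y \<oplus> c \<otimes> q) = (x \<oplus> y) \<oplus> c \<otimes> (r \<oplus> q)" using a by algebra
      then show ?thesis using that R_closed(4) by (auto simp: mem_coset)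
    qed
    then show "\<exists>d\<in>carrier K - {\<zero>}. \<forall>r\<in>R. \<forall>q\<in>R. (x \<oplus> d \<otimes> r) \<oplus> (y \<oplus> d \<otimes> q) \<in> coset (x \<oplus> y) c"
      using a by blast
  qed auto
  show "continuous_map (prod_topology ?T ?T) ?T (\<lambda>(x, y). x \<otimes> y)"
  proof (rule continuous_induced_binary)
    fix x y c assume a: "x \<in> carrier K" "y \<in> carrier K" "c \<in> carrier K" "c \<noteq> \<zero>"
    obtain b where b: "b \<in> R" "b \<noteq> \<zero>" "b \<otimes> x \<in> R" "b \<otimes> y \<in> R" "b \<otimes> c \<in> R"
      using common_denominator[of "{x, y, c}"] a by auto
    have bc: "b \<in> carrier K" using b R_sub by auto
    have "(x \<oplus> (c \<otimes> b) \<otimes> r) \<otimes> (y \<oplus> (c \<otimes> b) \<otimes> q) \<in> coset (x \<otimes> y) c"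
      if "r \<in> R" "q \<in> R" for r q
    proof -
      have rq: "r \<in> carrier K" "q \<in> carrier K" using that R_sub by auto
      have "(x \<oplus> (c \<otimes> b) \<otimes> r) \<otimes> (y \<oplus> (c \<otimes> b) \<otimes> q) =
        (x \<otimes> y) \<oplus> c \<otimes> ((b \<otimes> x) \<otimes> q \<oplus> (b \<otimes> y) \<otimes> r \<oplus> (b \<otimes> c) \<otimes> (b \<otimes> (r \<otimes> q)))"
        using a bc rq by algebra
      moreover have "(b \<otimes> x) \<otimes> q \<oplus> (b \<otimes> y) \<otimes> r \<oplus> (b \<otimes> c) \<otimes> (b \<otimes> (r \<otimes> q)) \<in> R"
        using b that by (metis R_closed(4,5))
      ultimately show ?thesis by (auto simp: mem_coset)
    qed
    moreover have "c \<otimes> b \<noteq> \<zero>" using a b bc integral by blast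
    ultimately show "\<exists>d\<in>carrier K - {\<zero>}. \<forall>r\<in>R. \<forall>q\<in>R.
        (x \<oplus> d \<otimes> r) \<otimes> (y \<oplus> d \<otimes> q) \<in> coset (x \<otimes> y) c"
      using a bc by (intro bexI[of _ "c \<otimes> b"]) blast+
  qed auto
  show "continuous_map ?T ?T (\<lambda>x. \<ominus> x)"
    unfolding continuous_map_def
  proof (intro conjI allI impI)
    show "a_inv K \<in> topspace ?T \<rightarrow> topspace ?T" by (auto simp: topspace_induced)
  next
    fix U assume U: "openin ?T U"
    show "openin ?T {x \<in> topspace ?T. \<ominus> x \<in> U}"
      unfolding topspace_induced openin_induced[of "{x \<in> carrier K. \<ominus> x \<in> U}"]
    proof (intro conjI ballI)
      fix x assume "x \<in> {x \<in> carrier K. \<ominus> x \<in> U}"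
      then have x: "x \<in> carrier K" "\<ominus> x \<in> U" by auto
      obtain c where c: "c \<in> carrier K" "c \<noteq> \<zero>" "coset (\<ominus> x) c \<subseteq> U"
        using U x(2) unfolding openin_induced by blast
      have "coset x c \<subseteq> {x \<in> carrier K. \<ominus> x \<in> U}"
      proof
        fix y assume y: "y \<in> coset x c"
        then obtain r where r: "r \<in> R" "y = x \<oplus> c \<otimes> r" by (auto simp: mem_coset)
        then have rc: "r \<in> carrier K" using R_sub by auto
        have "\<ominus> y = \<ominus> x \<oplus> c \<otimes> (\<ominus> r)" unfolding r(2) using x c rc by algebra
        then have "\<ominus> y \<in> U" using r c R_closed(3) by (auto simp: mem_coset subset_iff)
        then show "y \<in> {x \<in> carrier K. \<ominus> x \<in> U}" using y coset_carrier x c by blast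
      qed
      then show "\<exists>c\<in>carrier K - {\<zero>}. coset x c \<subseteq> {x \<in> carrier K. \<ominus> x \<in> U}" using c by blast
    qed auto
  qed
qed

end

end

theory Submission
  imports Defs
begin

text \<open>
  Being locally bounded and the \<open>W\<^sub>n\<close> condition are local sentences, and a proper
  \<open>W\<^sub>n\<close>-ring induces a \<open>W\<^sub>n\<close>-topology, so only one direction of (1) requires a
  construction. Let \<open>S\<^sub>0\<close> be a bounded neighbourhood of 0 that contains 1 and is a
  \<open>W\<^sub>n\<close>-set, and let \<open>S\<^bsub>k+1\<^esub>\<close> consist of the elements \<open>x y - z w\<close> with
  \<open>x, y, z, w \<in> S\<^sub>k\<close>. In an ultrapower of \<open>K\<close> over the natural numbers the union \<open>R\<close> of the
  internal sets \<open>S\<^sub>k\<^sup>*\<close> is a subring, and a \<open>W\<^sub>n\<close>-set since it contains \<open>S\<^sub>0\<^sup>*\<close>. It contains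
  an internal neighbourhood and is contained in the internal bounded set given by the diagonal
  sequence \<open>S\<^sub>0, S\<^sub>1, S\<^sub>2, \<dots>\<close>; hence the sets \<open>c R\<close> and the internal neighbourhoods define the
  same topology, and Los's theorem gives local equivalence.

  Continuity of inversion at 1 is a local sentence too, so (2) need only be shown for a
  topology induced by a \<open>W\<^sub>n\<close>-ring. Such a ring has no \<open>n + 1\<close> pairwise comaximal nonunits,
  which forces \<open>1 + a R\<close> to consist of units for some \<open>a \<noteq> 0\<close>.
\<close>

section \<open>Ring topologies and bounded sets\<close>

text \<open>The obstacle in (1) is that \<open>K\<close> may contain no bounded subring at all: in
  the real numbers every subring with 1 is unbounded. The closure of \<open>S0\<close> under the
  ring operations is a union of countably many bounded sets, and in an ultrapower over an
  ultrafilter that contains all tails such a union fits into one internal bounded set. The same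
  diagonal shows that \<open>R\<close> is proper, without which the induced topology would not be
  Hausdorff.

  The price is that \<open>R\<close> is not internal, so Los's theorem does not speak about the sets
  \<open>c R\<close>. It does speak about the internal neighbourhoods; these form a basis of the
  induced neighbourhoods, and the polarity restriction on set quantifiers makes truth invariant
  under passing to a basis.

  The expression \<open>x y - z w\<close> performs both closure steps at once: \<open>z = 0\<close>
  gives products, \<open>y = w = 1\<close> gives differences.

  In (2) the number \<open>n + 1\<close> is the number of elements to which the condition on a
  \<open>W_n\<close>-set applies. A linear relation among inverses of pairwise comaximal elements,
  cleared of denominators, turns one of the elements into a unit. Part (4) is shown directly in
  \<open>K\<close>.\<close>

lemma (in field) inv_nonzero:
  assumes "x \<in> carrier R" "x \<noteq> \<zero>"
  shows "inv x \<in> carrier R" "inv x \<noteq> \<zero>" "x \<otimes> inv x = \<one>" "inv x \<otimes> x = \<one>"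
proof -
  have "x \<in> Units R" using assms field_Units by auto
  then show *: "inv x \<in> carrier R" "x \<otimes> inv x = \<one>" "inv x \<otimes> x = \<one>" by auto
  then show "inv x \<noteq> \<zero>" using assms(1) by fastforce
qed

lemma (in field) mult_inv_cancel:
  assumes "x \<in> carrier R" "x \<noteq> \<zero>" "y \<in> carrier R"
  shows "x \<otimes> (inv x \<otimes> y) = y" "inv x \<otimes> (x \<otimes> y) = y"
  using assms inv_nonzero[OF assms(1,2)] by (simp_all flip: m_assoc)

text \<open>Seen as a preimage, a scaled neighbourhood is a neighbourhood by continuity of
  multiplication by \<open>inv c\<close>.\<close>

lemma (in field) l_coset_eq:
  assumes "c \<in> carrier R" "c \<noteq> \<zero>" "U \<subseteq> carrier R"
  shows "c <# U = {x \<in> carrier R. inv c \<otimes> x \<in> U}"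
proof (intro Set.set_eqI iffI)
  fix x assume "x \<in> c <# U"
  then obtain u where "u \<in> U" "x = c \<otimes> u" by (auto simp: l_coset_def)
  then show "x \<in> {x \<in> carrier R. inv c \<otimes> x \<in> U}"
    using assms mult_inv_cancel[of c u] by auto
next
  fix x assume "x \<in> {x \<in> carrier R. inv c \<otimes> x \<in> U}"
  then have "x = c \<otimes> (inv c \<otimes> x)" "inv c \<otimes> x \<in> U"
    using assms mult_inv_cancel[of c x] by auto
  then show "x \<in> c <# U" unfolding l_coset_def by blast
qed

section \<open>Neighbourhoods of zero in a ring topology\<close>

locale topological_field_ring = field K for K (structure) +
  fixes T :: "'a topology"
  assumes ring_topology: "ring_topology K T"
begin

abbreviation nbhds :: "'a set set" where
  "nbhds \<equiv> zero_nbhds K T"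

lemma topspace_eq: "topspace T = carrier K"
  using ring_topology by (simp add: ring_topology_def)

lemma continuous_map_add:
  assumes "continuous_map Z T f" "continuous_map Z T g"
  shows "continuous_map Z T (\<lambda>x. f x \<oplus> g x)"
proof -
  have "continuous_map Z T ((\<lambda>(x, y). x \<oplus> y) \<circ> (\<lambda>x. (f x, g x)))"
    using assms ring_topology
    by (intro continuous_map_compose) (auto simp: continuous_map_paired ring_topology_def)
  then show ?thesis by (simp add: o_def)
qed

lemma continuous_map_mult:
  assumes "continuous_map Z T f" "continuous_map Z T g"
  shows "continuous_map Z T (\<lambda>x. f x \<otimes> g x)"
proof -
  have "continuous_map Z T ((\<lambda>(x, y). x \<otimes> y) \<circ> (\<lambda>x. (f x, g x)))"
    using assms ring_topology
    by (intro continuous_map_compose) (auto simp: continuous_map_paired ring_topology_def)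
  then show ?thesis by (simp add: o_def)
qed

lemma continuous_map_const_carrier: "c \<in> carrier K \<Longrightarrow> continuous_map Z T (\<lambda>x. c)"
  by (simp add: topspace_eq)

lemma nbhds_iff:
  "U \<in> nbhds \<longleftrightarrow> U \<subseteq> carrier K \<and> (\<exists>V. openin T V \<and> \<zero> \<in> V \<and> V \<subseteq> U)"
  by (simp add: zero_nbhds_def topspace_eq)

lemma nbhds_sub: "U \<in> nbhds \<Longrightarrow> U \<subseteq> carrier K"
  and nbhds_zero: "U \<in> nbhds \<Longrightarrow> \<zero> \<in> U"
  and nbhds_mono: "U \<in> nbhds \<Longrightarrow> U \<subseteq> V \<Longrightarrow> V \<subseteq> carrier K \<Longrightarrow> V \<in> nbhds"
  unfolding nbhds_iff by blast+

lemma nbhds_closed: "U \<in> nbhds \<Longrightarrow> x \<in> U \<Longrightarrow> x \<in> carrier K"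
  using nbhds_sub by blast

lemma nbhds_carrier: "carrier K \<in> nbhds"
  unfolding nbhds_iff using openin_topspace[of T] topspace_eq by force

lemma nbhds_Int:
  assumes "U \<in> nbhds" "V \<in> nbhds"
  shows "U \<inter> V \<in> nbhds"
proof -
  obtain A B where "openin T A" "\<zero> \<in> A" "A \<subseteq> U" "openin T B" "\<zero> \<in> B" "B \<subseteq> V"
    using assms unfolding nbhds_iff by blast
  then have "openin T (A \<inter> B) \<and> \<zero> \<in> A \<inter> B \<and> A \<inter> B \<subseteq> U \<inter> V" by auto
  then show ?thesis using assms unfolding nbhds_iff by blast
qed

lemma nbhds_vimage:
  assumes "continuous_map T T f" "f \<zero> = \<zero>" "U \<in> nbhds"
  shows "{x \<in> carrier K. f x \<in> U} \<in> nbhds"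
proof -
  obtain A where A: "openin T A" "\<zero> \<in> A" "A \<subseteq> U" using assms unfolding nbhds_iff by blast
  then have "openin T {x \<in> topspace T. f x \<in> A}"
    using assms by (intro openin_continuous_map_preimage) auto
  then have "openin T {x \<in> carrier K. f x \<in> A}" by (simp add: topspace_eq)
  then show ?thesis using A assms(2) unfolding nbhds_iff
    by (intro conjI exI[of _ "{x \<in> carrier K. f x \<in> A}"]) auto
qed

lemma nbhds_binary:
  assumes "continuous_map (prod_topology T T) T (\<lambda>(x, y). f x y)" "f \<zero> \<zero> = \<zero>" "U \<in> nbhds"
  obtains V where "V \<in> nbhds" "\<And>x y. x \<in> V \<Longrightarrow> y \<in> V \<Longrightarrow> f x y \<in> U"
proof -
  obtain A where A: "openin T A" "\<zero> \<in> A" "A \<subseteq> U" using assms unfolding nbhds_iff by blast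
  define W where "W = {p \<in> topspace (prod_topology T T). (case p of (x, y) \<Rightarrow> f x y) \<in> A}"
  have "openin (prod_topology T T) W"
    unfolding W_def using assms(1) A(1) by (rule openin_continuous_map_preimage)
  moreover have "(\<zero>, \<zero>) \<in> W" using A assms by (simp add: W_def topspace_eq)
  ultimately
  obtain B C where B: "openin T B" "openin T C" "\<zero> \<in> B" "\<zero> \<in> C" "B \<times> C \<subseteq> W"
    by (elim openin_prod_topology_alt[THEN iffD1, rule_format, elim_format] exE conjE) blast
  have "B \<subseteq> carrier K" using B openin_subset topspace_eq by metis
  then have "B \<inter> C \<in> nbhds" unfolding nbhds_iff
    using B by (intro conjI exI[of _ "B \<inter> C"]) auto
  moreover have "f x y \<in> U" if "x \<in> B \<inter> C" "y \<in> B \<inter> C" for x y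
  proof -
    have "(x, y) \<in> W" using that B(5) by auto
    then show ?thesis using A(3) by (auto simp: W_def)
  qed
  ultimately show thesis using that by blast
qed

lemma nbhds_diff:
  assumes "U \<in> nbhds"
  obtains V where "V \<in> nbhds" "\<And>x y. x \<in> V \<Longrightarrow> y \<in> V \<Longrightarrow> x \<ominus> y \<in> U"
proof (rule nbhds_binary[of "\<lambda>x y. x \<ominus> y"])
  have "continuous_map T T (\<lambda>x. \<ominus> x)" using ring_topology by (simp add: ring_topology_def)
  then have "continuous_map (prod_topology T T) T (\<lambda>p. fst p \<oplus> \<ominus> (snd p))"
    using continuous_map_compose[OF continuous_map_snd, of T T "\<lambda>x. \<ominus> x"]
    by (intro continuous_map_add continuous_map_fst) (auto simp: o_def)
  then show "continuous_map (prod_topology T T) T (\<lambda>(x, y). x \<ominus> y)"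
    by (simp add: a_minus_def case_prod_unfold)
  show "\<zero> \<ominus> \<zero> = \<zero>" by algebra
qed (use assms that in auto)

lemma nbhds_mult:
  assumes "U \<in> nbhds"
  obtains V where "V \<in> nbhds" "\<And>x y. x \<in> V \<Longrightarrow> y \<in> V \<Longrightarrow> x \<otimes> y \<in> U"
  by (rule nbhds_binary[of "\<lambda>x y. x \<otimes> y"])
    (use ring_topology assms that in \<open>auto simp: ring_topology_def\<close>)

lemma nbhds_scale_vimage:
  assumes "U \<in> nbhds" "c \<in> carrier K"
  shows "{x \<in> carrier K. c \<otimes> x \<in> U} \<in> nbhds"
  using assms
  by (intro nbhds_vimage[of "\<lambda>x. c \<otimes> x"] continuous_map_mult continuous_map_const_carrier) auto

lemma nbhds_l_coset:
  assumes "U \<in> nbhds" "c \<in> carrier K" "c \<noteq> \<zero>"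
  shows "c <# U \<in> nbhds"
  using nbhds_scale_vimage[OF assms(1) inv_nonzero(1)[OF assms(2,3)]] assms
  by (simp add: l_coset_eq nbhds_sub)

text \<open>Non-discreteness enters here: if \<open>{\<zero>}\<close> were open, translations would
  make every singleton open.\<close>

lemma nbhds_nonzero:
  assumes "U \<in> nbhds"
  obtains x where "x \<in> U" "x \<noteq> \<zero>"
proof (rule ccontr)
  assume "\<not> thesis"
  then have "U \<subseteq> {\<zero>}" using that by blast
  then have open0: "openin T {\<zero>}" using assms unfolding nbhds_iff by (metis subset_singletonD empty_iff subset_trans)
  have "openin T {x}" if x: "x \<in> carrier K" for x
  proof -
    have "openin T {y \<in> topspace T. y \<oplus> \<ominus> x \<in> {\<zero>}}"
      using open0 x by (intro openin_continuous_map_preimage[where Y = T] continuous_map_add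
          continuous_map_const_carrier) auto
    moreover have "{y \<in> topspace T. y \<oplus> \<ominus> x \<in> {\<zero>}} = {x}"
      using x by (auto simp: topspace_eq r_neg) (metis a_minus_def r_right_minus_eq)
    ultimately show ?thesis by simp
  qed
  then have "discrete_topology (carrier K) = T"
    by (simp add: discrete_topology_unique topspace_eq)
  then show False using ring_topology by (simp add: ring_topology_def)
qed

lemma nbhds_separate:
  assumes "x \<in> carrier K" "x \<noteq> \<zero>"
  obtains U where "U \<in> nbhds" "x \<notin> U"
proof -
  have "Hausdorff_space T" using ring_topology by (simp add: ring_topology_def)
  then obtain U V where "openin T U" "openin T V" "\<zero> \<in> U" "x \<in> V" "disjnt U V"
    using assms unfolding Hausdorff_space_def topspace_eq by blast
  then have "U \<in> nbhds \<and> x \<notin> U"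
    unfolding nbhds_iff disjnt_iff using openin_subset[of T U] topspace_eq by blast
  then show thesis using that by blast
qed

section \<open>Bounded sets\<close>

abbreviation bounded where "bounded \<equiv> bounded_subset K T"

lemma bounded_sub: "bounded S \<Longrightarrow> S \<subseteq> carrier K"
  by (simp add: bounded_subset_def)

lemma boundedE:
  assumes "bounded S" "U \<in> nbhds"
  obtains c where "c \<in> carrier K" "c \<noteq> \<zero>" "\<And>x. x \<in> S \<Longrightarrow> c \<otimes> x \<in> U"
proof -
  obtain c where "c \<in> carrier K - {\<zero>}" "c <# S \<subseteq> U"
    using assms unfolding bounded_subset_def by blast
  then show thesis using that by (force simp: l_coset_def)
qed

text \<open>Unlike the definition, which asks for a single nonzero scalar, this condition is
  evidently stable under finite unions, sums and products.\<close>

lemma bounded_iff: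
  "bounded S \<longleftrightarrow> S \<subseteq> carrier K \<and> (\<forall>U\<in>nbhds. \<exists>V\<in>nbhds. \<forall>v\<in>V. \<forall>x\<in>S. v \<otimes> x \<in> U)"
proof (intro iffI conjI ballI)
  fix U assume S: "bounded S" and U: "U \<in> nbhds"
  \<comment> \<open>With \<open>W W\<close> inside \<open>U\<close> and \<open>c S\<close> inside
    \<open>W\<close>, the neighbourhood \<open>c <# W\<close> works for all of \<open>S\<close>: in
    \<open>c w x\<close> the scalar is moved from \<open>w\<close> to \<open>x\<close>.\<close>
  obtain W where W: "W \<in> nbhds" "\<And>x y. x \<in> W \<Longrightarrow> y \<in> W \<Longrightarrow> x \<otimes> y \<in> U"
    using nbhds_mult[OF U] by blast
  obtain c where c: "c \<in> carrier K" "c \<noteq> \<zero>" "\<And>x. x \<in> S \<Longrightarrow> c \<otimes> x \<in> W"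
    using boundedE[OF S W(1)] by blast
  have "v \<otimes> x \<in> U" if v: "v \<in> c <# W" and x: "x \<in> S" for v x
  proof -
    obtain w where w: "w \<in> W" "v = c \<otimes> w" using v by (auto simp: l_coset_def)
    have "x \<in> carrier K" "w \<in> carrier K" using x w bounded_sub[OF S] nbhds_sub[OF W(1)] by auto
    then have "v \<otimes> x = w \<otimes> (c \<otimes> x)" using c w by (simp add: m_ac)
    then show ?thesis using W w c x by auto
  qed
  then show "\<exists>V\<in>nbhds. \<forall>v\<in>V. \<forall>x\<in>S. v \<otimes> x \<in> U" using nbhds_l_coset[OF W(1) c(1,2)] by blast
next
  assume S: "S \<subseteq> carrier K \<and> (\<forall>U\<in>nbhds. \<exists>V\<in>nbhds. \<forall>v\<in>V. \<forall>x\<in>S. v \<otimes> x \<in> U)"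
  show "bounded S"
    unfolding bounded_subset_def
  proof (intro conjI ballI)
    fix U assume "U \<in> nbhds"
    then obtain V where V: "V \<in> nbhds" "\<forall>v\<in>V. \<forall>x\<in>S. v \<otimes> x \<in> U" using S by blast
    obtain c where "c \<in> V" "c \<noteq> \<zero>" using nbhds_nonzero[OF V(1)] by blast
    then show "\<exists>c\<in>carrier K - {\<zero>}. c <# S \<subseteq> U"
      using V nbhds_sub[OF V(1)] by (intro bexI[of _ c]) (auto simp: l_coset_def)
  qed (use S in simp)
qed (simp add: bounded_sub)

lemma boundedE_nbhd:
  assumes "bounded S" "U \<in> nbhds"
  obtains V where "V \<in> nbhds" "\<And>v x. v \<in> V \<Longrightarrow> x \<in> S \<Longrightarrow> v \<otimes> x \<in> U"
  using assms unfolding bounded_iff by meson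

lemma bounded_singleton:
  assumes "a \<in> carrier K"
  shows "bounded {a}"
  unfolding bounded_iff
proof (intro conjI ballI)
  fix U assume "U \<in> nbhds"
  then show "\<exists>V\<in>nbhds. \<forall>v\<in>V. \<forall>x\<in>{a}. v \<otimes> x \<in> U"
    using nbhds_scale_vimage[of U a] assms
    by (intro bexI[of _ "{x \<in> carrier K. a \<otimes> x \<in> U}"]) (auto simp: m_comm)
qed (use assms in simp)

lemma bounded_Un:
  assumes "bounded S" "bounded S'"
  shows "bounded (S \<union> S')"
  unfolding bounded_iff
proof (intro conjI ballI)
  fix U assume U: "U \<in> nbhds"
  obtain V where V: "V \<in> nbhds" "\<And>v x. v \<in> V \<Longrightarrow> x \<in> S \<Longrightarrow> v \<otimes> x \<in> U"
    using boundedE_nbhd[OF assms(1) U] by blast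
  obtain V' where V': "V' \<in> nbhds" "\<And>v x. v \<in> V' \<Longrightarrow> x \<in> S' \<Longrightarrow> v \<otimes> x \<in> U"
    using boundedE_nbhd[OF assms(2) U] by blast
  show "\<exists>V\<in>nbhds. \<forall>v\<in>V. \<forall>x\<in>S \<union> S'. v \<otimes> x \<in> U"
    using V V' nbhds_Int by (intro bexI[of _ "V \<inter> V'"]) auto
qed (use assms bounded_sub in auto)

lemma bounded_mult:
  assumes "bounded S" "bounded S'"
  shows "bounded {x \<otimes> y | x y. x \<in> S \<and> y \<in> S'}"
  unfolding bounded_iff
proof (intro conjI ballI)
  note sub = bounded_sub[OF assms(1)] bounded_sub[OF assms(2)]
  show "{x \<otimes> y | x y. x \<in> S \<and> y \<in> S'} \<subseteq> carrier K" using sub by auto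
  fix U assume U: "U \<in> nbhds"
  obtain W where W: "W \<in> nbhds" "\<And>v x. v \<in> W \<Longrightarrow> x \<in> S' \<Longrightarrow> v \<otimes> x \<in> U"
    using boundedE_nbhd[OF assms(2) U] by blast
  obtain V where V: "V \<in> nbhds" "\<And>v x. v \<in> V \<Longrightarrow> x \<in> S \<Longrightarrow> v \<otimes> x \<in> W"
    using boundedE_nbhd[OF assms(1) W(1)] by blast
  have "v \<otimes> (x \<otimes> y) \<in> U" if "v \<in> V" "x \<in> S" "y \<in> S'" for v x y
    using that V W sub nbhds_sub[OF V(1)] by (simp add: subset_iff flip: m_assoc)
  then show "\<exists>V\<in>nbhds. \<forall>v\<in>V. \<forall>x\<in>{x \<otimes> y | x y. x \<in> S \<and> y \<in> S'}. v \<otimes> x \<in> U"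
    using V by blast
qed

lemma bounded_diff:
  assumes "bounded S" "bounded S'"
  shows "bounded {x \<ominus> y | x y. x \<in> S \<and> y \<in> S'}"
  unfolding bounded_iff
proof (intro conjI ballI)
  note sub = bounded_sub[OF assms(1)] bounded_sub[OF assms(2)]
  show "{x \<ominus> y | x y. x \<in> S \<and> y \<in> S'} \<subseteq> carrier K" using sub by auto
  fix U assume U: "U \<in> nbhds"
  obtain W where W: "W \<in> nbhds" "\<And>x y. x \<in> W \<Longrightarrow> y \<in> W \<Longrightarrow> x \<ominus> y \<in> U"
    using nbhds_diff[OF U] by blast
  obtain V where V: "V \<in> nbhds" "\<And>v x. v \<in> V \<Longrightarrow> x \<in> S \<union> S' \<Longrightarrow> v \<otimes> x \<in> W"
    using boundedE_nbhd[OF bounded_Un[OF assms] W(1)] by blast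
  have "v \<otimes> (x \<ominus> y) \<in> U" if vxy: "v \<in> V" "x \<in> S" "y \<in> S'" for v x y
  proof -
    have "v \<in> carrier K" "x \<in> carrier K" "y \<in> carrier K"
      using vxy sub nbhds_sub[OF V(1)] by auto
    then have "v \<otimes> (x \<ominus> y) = v \<otimes> x \<ominus> v \<otimes> y" by algebra
    then show ?thesis using vxy V W by simp
  qed
  then show "\<exists>V\<in>nbhds. \<forall>v\<in>V. \<forall>x\<in>{x \<ominus> y | x y. x \<in> S \<and> y \<in> S'}. v \<otimes> x \<in> U"
    using V by blast
qed

lemma bounded_l_coset:
  assumes "bounded S" "c \<in> carrier K"
  shows "bounded (c <# S)"
proof -
  have "c <# S = {x \<otimes> y | x y. x \<in> {c} \<and> y \<in> S}" by (auto simp: l_coset_def)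
  then show ?thesis using bounded_mult[OF bounded_singleton[OF assms(2)] assms(1)] by simp
qed

text \<open>A nonzero scalar maps the field onto itself, hence not into a neighbourhood that misses
  \<open>\<one>\<close>. This later supplies elements outside every stage.\<close>

lemma not_bounded_carrier: "\<not> bounded (carrier K)"
proof
  assume b: "bounded (carrier K)"
  obtain U where U: "U \<in> nbhds" "\<one> \<notin> U" using nbhds_separate[of \<one>] by auto
  obtain c where c: "c \<in> carrier K" "c \<noteq> \<zero>" "\<And>x. x \<in> carrier K \<Longrightarrow> c \<otimes> x \<in> U"
    using boundedE[OF b U(1)] by blast
  then show False using U inv_nonzero(1,3)[OF c(1,2)] by metis
qed

end

section \<open>Local sentences\<close>

text \<open>Negations and premises exchange the roles of \<open>s\<close> and \<open>s'\<close>, so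
  the induction has to vary both valuations and to control both polarities.\<close>

lemma sat_mono:
  assumes "\<And>V. V \<in> signed_set_vars True f \<Longrightarrow> s V \<subseteq> s' V"
    and "\<And>V. V \<in> signed_set_vars False f \<Longrightarrow> s' V \<subseteq> s V"
    and "sat K \<tau> e s f"
  shows "sat K \<tau> e s' f"
  using assms
proof (induction f arbitrary: e s s')
  case (Neg f)
  have "sat K \<tau> e s f" if "sat K \<tau> e s' f"
    by (rule Neg.IH[of s']) (use Neg.prems that in auto)
  then show ?case using Neg.prems(3) by auto
next
  case (Conj f g)
  have "sat K \<tau> e s' f" by (rule Conj.IH(1)[of s]) (use Conj.prems in auto)
  moreover have "sat K \<tau> e s' g" by (rule Conj.IH(2)[of s]) (use Conj.prems in auto)
  ultimately show ?case by simp
next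
  case (Disj f g)
  have "sat K \<tau> e s' f" if "sat K \<tau> e s f"
    by (rule Disj.IH(1)[of s]) (use Disj.prems that in auto)
  moreover have "sat K \<tau> e s' g" if "sat K \<tau> e s g"
    by (rule Disj.IH(2)[of s]) (use Disj.prems that in auto)
  ultimately show ?case using Disj.prems(3) by auto
next
  case (Impl f g)
  have "sat K \<tau> e s f" if "sat K \<tau> e s' f"
    by (rule Impl.IH(1)[of s']) (use Impl.prems that in auto)
  moreover have "sat K \<tau> e s' g" if "sat K \<tau> e s g"
    by (rule Impl.IH(2)[of s]) (use Impl.prems that in auto)
  ultimately show ?case using Impl.prems(3) by auto
next
  case (AllElt x f)
  have "sat K \<tau> (e(x := a)) s' f" if "a \<in> carrier K" for a
    by (rule AllElt.IH[of s]) (use AllElt.prems that in \<open>auto simp del: fun_upd_apply\<close>)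
  then show ?case by simp
next
  case (ExElt x f)
  have "sat K \<tau> (e(x := a)) s' f" if "sat K \<tau> (e(x := a)) s f" for a
    by (rule ExElt.IH[of s]) (use ExElt.prems that in \<open>auto simp del: fun_upd_apply\<close>)
  then show ?case using ExElt.prems(3) by auto
next
  case (AllSet V f)
  have "sat K \<tau> e (s'(V := U)) f" if "U \<in> \<tau>" for U
  proof (rule AllSet.IH[of "s(V := U)"])
    show "sat K \<tau> e (s(V := U)) f" using AllSet.prems(3) that by (simp del: fun_upd_apply)
  qed (use AllSet.prems(1,2) in auto)
  then show ?case by simp
next
  case (ExSet V f)
  have "sat K \<tau> e (s'(V := U)) f" if "sat K \<tau> e (s(V := U)) f" for U
  proof (rule ExSet.IH[of "s(V := U)"])
    show "sat K \<tau> e (s(V := U)) f" using that .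
  qed (use ExSet.prems(1,2) in auto)
  then show ?case using ExSet.prems(3) by auto
qed (auto split: if_splits)

lemma eval_term_cong:
  "(\<And>x. x \<in> term_vars t \<Longrightarrow> e x = e' x) \<Longrightarrow> eval_term K e t = eval_term K e' t"
  by (induction t) auto

lemma sat_elt_cong:
  "(\<And>x. x \<in> free_elt_vars f \<Longrightarrow> e x = e' x) \<Longrightarrow> sat K \<tau> e s f \<longleftrightarrow> sat K \<tau> e' s f"
proof (induction f arbitrary: e e' s)
  case (Eq t u)
  then have "eval_term K e t = eval_term K e' t" "eval_term K e u = eval_term K e' u"
    by (auto intro!: eval_term_cong)
  then show ?case by simp
next
  case (Mem t V)
  then have "eval_term K e t = eval_term K e' t" by (auto intro!: eval_term_cong)
  then show ?case by simp
next
  case (Neg f)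
  have "sat K \<tau> e s f \<longleftrightarrow> sat K \<tau> e' s f" by (rule Neg.IH) (use Neg.prems in auto)
  then show ?case by simp
next
  case (Conj f g)
  have "sat K \<tau> e s f \<longleftrightarrow> sat K \<tau> e' s f" by (rule Conj.IH(1)) (use Conj.prems in auto)
  moreover have "sat K \<tau> e s g \<longleftrightarrow> sat K \<tau> e' s g" by (rule Conj.IH(2)) (use Conj.prems in auto)
  ultimately show ?case by simp
next
  case (Disj f g)
  have "sat K \<tau> e s f \<longleftrightarrow> sat K \<tau> e' s f" by (rule Disj.IH(1)) (use Disj.prems in auto)
  moreover have "sat K \<tau> e s g \<longleftrightarrow> sat K \<tau> e' s g" by (rule Disj.IH(2)) (use Disj.prems in auto)
  ultimately show ?case by simp
next
  case (Impl f g)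
  have "sat K \<tau> e s f \<longleftrightarrow> sat K \<tau> e' s f" by (rule Impl.IH(1)) (use Impl.prems in auto)
  moreover have "sat K \<tau> e s g \<longleftrightarrow> sat K \<tau> e' s g" by (rule Impl.IH(2)) (use Impl.prems in auto)
  ultimately show ?case by simp
next
  case (AllElt x f)
  have "sat K \<tau> (e(x := a)) s f \<longleftrightarrow> sat K \<tau> (e'(x := a)) s f" for a
    using AllElt.prems by (intro AllElt.IH) auto
  then show ?case by simp
next
  case (ExElt x f)
  have "sat K \<tau> (e(x := a)) s f \<longleftrightarrow> sat K \<tau> (e'(x := a)) s f" for a
    using ExElt.prems by (intro ExElt.IH) auto
  then show ?case by simp
next
  case (AllSet V f)
  have "sat K \<tau> e s f \<longleftrightarrow> sat K \<tau> e' s f" for s by (rule AllSet.IH) (use AllSet.prems in auto)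
  then show ?case by simp
next
  case (ExSet V f)
  have "sat K \<tau> e s f \<longleftrightarrow> sat K \<tau> e' s f" for s by (rule ExSet.IH) (use ExSet.prems in auto)
  then show ?case by simp
qed

text \<open>Without free set variables both inclusions required by \<open>sat_mono\<close> are
  vacuous, so the two set valuations may be unrelated.\<close>

lemma sat_sentence:
  assumes "local_sentence f" "sat K \<tau> e s f"
  shows "sat K \<tau> e' s' f"
proof -
  have "sat K \<tau> e s' f" using assms by (intro sat_mono[of f s s']) (auto simp: local_sentence_def)
  then show ?thesis using assms(1) sat_elt_cong[of f e e'] by (auto simp: local_sentence_def)
qed

text \<open>The point of the syntactic restriction: a local sentence cannot distinguish a
  family of sets from a basis of it.\<close>

lemma sat_local_basis:
  assumes sub: "\<tau> \<subseteq> \<tau>'" and basis: "\<And>U. U \<in> \<tau>' \<Longrightarrow> \<exists>V\<in>\<tau>. V \<subseteq> U"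
  shows "local_form f \<Longrightarrow> sat K \<tau> e s f \<longleftrightarrow> sat K \<tau>' e s f"
proof (induction f arbitrary: e s)
  case (AllSet V f)
  have "sat K \<tau>' e (s(V := U)) f" if U: "U \<in> \<tau>'" and *: "\<And>U. U \<in> \<tau> \<Longrightarrow> sat K \<tau> e (s(V := U)) f" for U
  proof -
    \<comment> \<open>\<open>V\<close> occurs only positively, so truth at the smaller set
      \<open>U0\<close> passes up to \<open>U\<close>.\<close>
    obtain U0 where U0: "U0 \<in> \<tau>" "U0 \<subseteq> U" using basis U by blast
    have "sat K \<tau>' e (s(V := U0)) f" using * U0 AllSet by (simp del: fun_upd_apply)
    then show ?thesis
      using AllSet.prems U0 by (elim sat_mono[rotated 2]) (auto split: if_splits)
  qed
  then show ?case using AllSet sub by (auto simp del: fun_upd_apply)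
next
  case (ExSet V f)
  have "\<exists>U\<in>\<tau>. sat K \<tau> e (s(V := U)) f" if U: "U \<in> \<tau>'" and *: "sat K \<tau>' e (s(V := U)) f" for U
  proof -
    \<comment> \<open>\<open>V\<close> occurs only negatively, so truth at \<open>U\<close> passes
      down to \<open>U0\<close>.\<close>
    obtain U0 where U0: "U0 \<in> \<tau>" "U0 \<subseteq> U" using basis U by blast
    have "sat K \<tau>' e (s(V := U0)) f"
      using * ExSet.prems U0 by (elim sat_mono[rotated 2]) (auto split: if_splits)
    then show ?thesis using U0 ExSet by (auto simp del: fun_upd_apply)
  qed
  then show ?case using ExSet sub by (auto simp del: fun_upd_apply)
qed auto

lemma models_iff_sat:
  assumes "local_sentence f" "e \<in> UNIV \<rightarrow> carrier K" "s \<in> UNIV \<rightarrow> zero_nbhds K T"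
  shows "models K T f \<longleftrightarrow> sat K (zero_nbhds K T) e s f"
  using assms sat_sentence unfolding models_def by blast

section \<open>Finite connectives, sums and blocks of quantifiers as formulas\<close>

definition disj_list :: "form list \<Rightarrow> form" where
  "disj_list fs = foldr Disj fs (Neg (Eq Zero Zero))"

definition conj_list :: "form list \<Rightarrow> form" where
  "conj_list fs = foldr Conj fs (Eq Zero Zero)"

definition sum_term :: "rterm list \<Rightarrow> rterm" where
  "sum_term ts = foldr Plus ts Zero"

lemma sat_disj_list: "sat K \<tau> e s (disj_list fs) \<longleftrightarrow> (\<exists>f\<in>set fs. sat K \<tau> e s f)"
  unfolding disj_list_def by (induction fs) auto

lemma sat_conj_list: "sat K \<tau> e s (conj_list fs) \<longleftrightarrow> (\<forall>f\<in>set fs. sat K \<tau> e s f)"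
  unfolding conj_list_def by (induction fs) auto

lemma free_elt_vars_disj_list: "free_elt_vars (disj_list fs) = (\<Union>f\<in>set fs. free_elt_vars f)"
  unfolding disj_list_def by (induction fs) auto

lemma free_elt_vars_conj_list: "free_elt_vars (conj_list fs) = (\<Union>f\<in>set fs. free_elt_vars f)"
  unfolding conj_list_def by (induction fs) auto

lemma signed_set_vars_disj_list:
  "signed_set_vars b (disj_list fs) = (\<Union>f\<in>set fs. signed_set_vars b f)"
  unfolding disj_list_def by (induction fs) auto

lemma signed_set_vars_conj_list:
  "signed_set_vars b (conj_list fs) = (\<Union>f\<in>set fs. signed_set_vars b f)"
  unfolding conj_list_def by (induction fs) auto

lemma local_form_disj_list: "local_form (disj_list fs) \<longleftrightarrow> (\<forall>f\<in>set fs. local_form f)"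
  unfolding disj_list_def by (induction fs) auto

lemma local_form_conj_list: "local_form (conj_list fs) \<longleftrightarrow> (\<forall>f\<in>set fs. local_form f)"
  unfolding conj_list_def by (induction fs) auto

lemma term_vars_sum_term: "term_vars (sum_term ts) = (\<Union>t\<in>set ts. term_vars t)"
  unfolding sum_term_def by (induction ts) auto

lemma (in ring) eval_sum_term:
  assumes "distinct js" "\<And>j. j \<in> set js \<Longrightarrow> eval_term R e (t j) \<in> carrier R"
  shows "eval_term R e (sum_term (map t js)) = (\<Oplus>j\<in>set js. eval_term R e (t j))"
  using assms unfolding sum_term_def by (induction js) (auto simp: Pi_def)

lemma sat_AllElt_block:
  "sat K \<tau> e s (foldr AllElt xs f) \<longleftrightarrow>
     (\<forall>a \<in> set xs \<rightarrow> carrier K. sat K \<tau> (override_on e a (set xs)) s f)"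
proof (induction xs arbitrary: e)
  case (Cons x xs)
  have "(\<forall>c\<in>carrier K. \<forall>a \<in> set xs \<rightarrow> carrier K. sat K \<tau> (override_on (e(x := c)) a (set xs)) s f)
      \<longleftrightarrow> (\<forall>a \<in> set (x # xs) \<rightarrow> carrier K. sat K \<tau> (override_on e a (set (x # xs))) s f)"
    (is "?l \<longleftrightarrow> ?r")
  proof
    assume l: ?l
    show ?r
    proof
      fix a assume a: "a \<in> set (x # xs) \<rightarrow> carrier K"
      have "override_on (e(x := a x)) a (set xs) = override_on e a (set (x # xs))"
        by (auto simp: override_on_def)
      then show "sat K \<tau> (override_on e a (set (x # xs))) s f"
        using l[rule_format, of "a x" a] a by auto
    qed
  next
    assume r: ?r
    show ?l
    proof (intro ballI)
      fix c a assume c: "c \<in> carrier K" and a: "a \<in> set xs \<rightarrow> carrier K"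
      \<comment> \<open>If \<open>x\<close> occurs again in \<open>xs\<close>, the inner quantifier
        rebinds it and \<open>c\<close> is lost; hence \<open>c\<close> is used only outside
        \<open>set xs\<close>.\<close>
      define a' where "a' = (\<lambda>y. if y \<in> set xs then a y else c)"
      have "override_on e a' (set (x # xs)) = override_on (e(x := c)) a (set xs)"
        by (auto simp: override_on_def a'_def)
      moreover have "a' \<in> set (x # xs) \<rightarrow> carrier K" using a c by (auto simp: a'_def)
      ultimately show "sat K \<tau> (override_on (e(x := c)) a (set xs)) s f" using r by metis
    qed
  qed
  then show ?case using Cons by (simp del: fun_upd_apply)
qed (simp add: override_on_def)

lemma sat_ExElt_block:
  "sat K \<tau> e s (foldr ExElt xs f) \<longleftrightarrow>
     (\<exists>a \<in> set xs \<rightarrow> carrier K. sat K \<tau> (override_on e a (set xs)) s f)"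
proof -
  have "sat K \<tau> e s (Neg (foldr ExElt xs f)) \<longleftrightarrow> sat K \<tau> e s (foldr AllElt xs (Neg f))"
    by (induction xs arbitrary: e) auto
  then show ?thesis by (auto simp: sat_AllElt_block)
qed

lemma free_elt_vars_blocks:
  "free_elt_vars (foldr AllElt xs f) = free_elt_vars f - set xs"
  "free_elt_vars (foldr ExElt xs f) = free_elt_vars f - set xs"
  by (induction xs) auto

lemma signed_set_vars_blocks:
  "signed_set_vars b (foldr AllElt xs f) = signed_set_vars b f"
  "signed_set_vars b (foldr ExElt xs f) = signed_set_vars b f"
  by (induction xs) auto

lemma local_form_blocks:
  "local_form (foldr AllElt xs f) \<longleftrightarrow> local_form f"
  "local_form (foldr ExElt xs f) \<longleftrightarrow> local_form f"
  by (induction xs) auto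

text \<open>In the matrix of the following sentence the variable 0 is the scalar \<open>c\<close>, the variables
  \<open>1, \<dots>, n + 1\<close> are the given elements \<open>x\<^sub>j\<close>, and \<open>n + 1 + j\<close> is an \<open>s\<^sub>j \<in> U\<close> such that
  \<open>c s\<^sub>j\<close> is the coefficient of \<open>x\<^sub>j\<close>. For uniformity there is also an idle \<open>s\<^sub>i\<close>.\<close>

definition combination_form :: "nat \<Rightarrow> nat \<Rightarrow> form" where
  "combination_form n i = foldr ExElt [n+2..<2*n+3]
     (Conj (conj_list (map (\<lambda>j. Mem (Var (n+1+j)) 0) [1..<n+2]))
       (Eq (Var i) (sum_term (map (\<lambda>j. Times (Var j) (Times (Var 0) (Var (n+1+j))))
         (filter (\<lambda>j. j \<noteq> i) [1..<n+2])))))"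

definition W_form :: "nat \<Rightarrow> form" where
  "W_form n = AllSet 0 (ExElt 0 (Conj (Neg (Eq (Var 0) Zero))
     (foldr AllElt [1..<n+2] (disj_list (map (combination_form n) [1..<n+2])))))"

definition locally_bounded_form :: form where
  "locally_bounded_form = ExSet 0 (AllSet 1 (ExElt 0 (Conj (Neg (Eq (Var 0) Zero))
     (AllElt 1 (Impl (Mem (Var 1) 0) (Mem (Times (Var 0) (Var 1)) 1))))))"

text \<open>Inversion is continuous at 1, with \<open>y = (1 + x)\<inverse> - 1\<close>.\<close>

definition inverse_form :: form where
  "inverse_form = AllSet 0 (ExSet 1 (AllElt 0 (Impl (Mem (Var 0) 1)
     (ExElt 1 (Conj (Mem (Var 1) 0)
       (Eq (Times (Plus One (Var 0)) (Plus One (Var 1))) One))))))"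

lemma free_elt_vars_combination_form:
  assumes "i \<in> {1..n+1}"
  shows "free_elt_vars (combination_form n i) \<subseteq> {0..n+1}"
proof -
  have *: "n + 1 + j \<in> {n+2..<2*n+3}" if "j \<in> {1..n+1}" for j using that by auto
  show ?thesis
    unfolding combination_form_def free_elt_vars_blocks free_elt_vars.simps term_vars.simps
      free_elt_vars_conj_list term_vars_sum_term set_map set_filter set_upt
    using assms * by fastforce
qed

text \<open>Membership in the set variable is only ever asserted, namely of the coefficients, so it
  occurs positively, as its universal quantifier demands.\<close>

lemma local_sentence_W_form: "local_sentence (W_form n)"
proof -
  have "free_elt_vars (W_form n) = {}"
    using free_elt_vars_combination_form[of _ n]
    unfolding W_form_def by (fastforce simp: free_elt_vars_blocks free_elt_vars_disj_list)
  moreover have sgn: "signed_set_vars b (combination_form n i) = (if b then {0} else {})" for b i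
    unfolding combination_form_def
    by (simp add: signed_set_vars_blocks signed_set_vars_conj_list)
  then have "signed_set_vars b (W_form n) = {}" for b
    unfolding W_form_def by (auto simp: signed_set_vars_blocks signed_set_vars_disj_list)
  moreover have "local_form (combination_form n i)" for i
    unfolding combination_form_def by (simp add: local_form_blocks local_form_conj_list)
  then have "local_form (W_form n)"
    using sgn unfolding W_form_def
    by (simp add: local_form_blocks local_form_disj_list signed_set_vars_blocks
        signed_set_vars_disj_list)
  ultimately show ?thesis by (simp add: local_sentence_def)
qed

text \<open>Here, as in \<open>inverse_form\<close>, the existential neighbourhood appears only in a
  premise and the universal one only in a conclusion, which is the polarity required.\<close>

lemma local_sentence_locally_bounded_form: "local_sentence locally_bounded_form"
  by (auto simp: local_sentence_def locally_bounded_form_def)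

lemma local_sentence_inverse_form: "local_sentence inverse_form"
  by (auto simp: local_sentence_def inverse_form_def)

section \<open>Meaning of the three sentences\<close>

lemma l_coset_subset_iff: "c <#\<^bsub>K\<^esub> U \<subseteq> V \<longleftrightarrow> (\<forall>x\<in>U. c \<otimes>\<^bsub>K\<^esub> x \<in> V)"
  by (auto simp: l_coset_def)

lemma sat_locally_bounded_form:
  assumes "\<And>U. U \<in> \<tau> \<Longrightarrow> U \<subseteq> carrier K"
  shows "sat K \<tau> e s locally_bounded_form \<longleftrightarrow>
     (\<exists>U\<in>\<tau>. \<forall>V\<in>\<tau>. \<exists>c\<in>carrier K - {\<zero>\<^bsub>K\<^esub>}. c <#\<^bsub>K\<^esub> U \<subseteq> V)"
proof -
  have "(\<forall>x\<in>carrier K. x \<in> U \<longrightarrow> c \<otimes>\<^bsub>K\<^esub> x \<in> V) \<longleftrightarrow> c <#\<^bsub>K\<^esub> U \<subseteq> V" if "U \<in> \<tau>" for U V c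
    using assms[OF that] by (auto simp: l_coset_subset_iff)
  then have "(\<exists>c\<in>carrier K. c \<noteq> \<zero>\<^bsub>K\<^esub> \<and> (\<forall>x\<in>carrier K. x \<in> U \<longrightarrow> c \<otimes>\<^bsub>K\<^esub> x \<in> V)) \<longleftrightarrow>
      (\<exists>c\<in>carrier K - {\<zero>\<^bsub>K\<^esub>}. c <#\<^bsub>K\<^esub> U \<subseteq> V)" if "U \<in> \<tau>" for U V
    using that by auto
  then show ?thesis by (simp add: locally_bounded_form_def)
qed

lemma sat_inverse_form:
  assumes "\<And>U. U \<in> \<tau> \<Longrightarrow> U \<subseteq> carrier K"
  shows "sat K \<tau> e s inverse_form \<longleftrightarrow>
     (\<forall>U\<in>\<tau>. \<exists>V\<in>\<tau>. \<forall>x\<in>V. \<exists>y\<in>U. (\<one>\<^bsub>K\<^esub> \<oplus>\<^bsub>K\<^esub> x) \<otimes>\<^bsub>K\<^esub> (\<one>\<^bsub>K\<^esub> \<oplus>\<^bsub>K\<^esub> y) = \<one>\<^bsub>K\<^esub>)"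
proof -
  have "(\<forall>x\<in>carrier K. x \<in> V \<longrightarrow> (\<exists>y\<in>carrier K. y \<in> U \<and> P x y)) \<longleftrightarrow> (\<forall>x\<in>V. \<exists>y\<in>U. P x y)"
    if "U \<in> \<tau>" "V \<in> \<tau>" for U V P
    using assms[OF that(1)] assms[OF that(2)] by blast
  then show ?thesis by (simp add: inverse_form_def)
qed

text \<open>The set must be nonempty because the idle variable \<open>n+1+i\<close> is also required
  to have a value in \<open>s 0\<close>.\<close>

lemma (in cring) sat_combination_form:
  assumes e: "\<And>j. j \<in> {0..n+1} \<Longrightarrow> e j \<in> carrier R" and i: "i \<in> {1..n+1}"
    and U: "s 0 \<subseteq> carrier R" "s 0 \<noteq> {}"
  shows "sat R \<tau> e s (combination_form n i) \<longleftrightarrow>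
    (\<exists>q \<in> {1..n+1} - {i} \<rightarrow> e 0 <# s 0. e i = (\<Oplus>j\<in>{1..n+1} - {i}. e j \<otimes> q j))"
proof -
  let ?X = "{n+2..<2*n+3}"
  have set1: "set [1..<n+2] = {1..n+1}" by auto
  have sat: "sat R \<tau> (override_on e a ?X) s
      (Conj (conj_list (map (\<lambda>j. Mem (Var (n+1+j)) 0) [1..<n+2]))
       (Eq (Var i) (sum_term (map (\<lambda>j. Times (Var j) (Times (Var 0) (Var (n+1+j))))
         (filter (\<lambda>j. j \<noteq> i) [1..<n+2]))))) \<longleftrightarrow>
    (\<forall>j\<in>{1..n+1}. a (n+1+j) \<in> s 0) \<and>
      e i = (\<Oplus>j\<in>{1..n+1} - {i}. e j \<otimes> (e 0 \<otimes> a (n+1+j)))" (is "?l \<longleftrightarrow> ?r")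
    if a: "a \<in> ?X \<rightarrow> carrier R" for a
  proof -
    let ?e = "override_on e a ?X"
    have e1: "?e j = e j" if "j \<in> {0..n+1}" for j using that by (auto simp: override_on_def)
    have e2: "?e (n+1+j) = a (n+1+j)" if "j \<in> {1..n+1}" for j
      using that by (auto simp: override_on_def)
    have ac: "a (n+1+j) \<in> carrier R" if "j \<in> {1..n+1}" for j
      using that a by (auto simp: Pi_def)
    let ?js = "filter (\<lambda>j. j \<noteq> i) [1..<n+2]"
    have js: "set ?js = {1..n+1} - {i}" by auto
    have "eval_term R ?e (sum_term (map (\<lambda>j. Times (Var j) (Times (Var 0) (Var (n+1+j)))) ?js))
      = (\<Oplus>j\<in>set ?js. eval_term R ?e (Times (Var j) (Times (Var 0) (Var (n+1+j)))))"
    proof (intro eval_sum_term)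
      fix j assume "j \<in> set ?js"
      then have j: "j \<in> {1..n+1}" using js by blast
      then have "?e j = e j" "?e 0 = e 0" "?e (n+1+j) = a (n+1+j)" using e1 e2 by auto
      then show "eval_term R ?e (Times (Var j) (Times (Var 0) (Var (n+1+j)))) \<in> carrier R"
        using e[of j] e[of 0] ac[OF j] j by simp
    qed simp
    also have "\<dots> = (\<Oplus>j\<in>{1..n+1} - {i}. e j \<otimes> (e 0 \<otimes> a (n+1+j)))"
      unfolding js using e ac by (intro finsum_cong') (auto simp: e1 e2)
    finally show ?thesis
      using i e1[of i] by (simp only: sat.simps sat_conj_list set_map set1 ball_simps eval_term.simps)
        (auto simp: e2)
  qed
  show ?thesis (is "?L \<longleftrightarrow> ?R")
  proof
    assume ?L
    then obtain a where a: "a \<in> ?X \<rightarrow> carrier R" "\<forall>j\<in>{1..n+1}. a (n+1+j) \<in> s 0"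
      "e i = (\<Oplus>j\<in>{1..n+1} - {i}. e j \<otimes> (e 0 \<otimes> a (n+1+j)))"
      unfolding combination_form_def sat_ExElt_block set_upt using sat by blast
    then show ?R
      by (intro bexI[of _ "\<lambda>j. e 0 \<otimes> a (n+1+j)"]) (auto simp: l_coset_def)
  next
    assume ?R
    then obtain q where q: "q \<in> {1..n+1} - {i} \<rightarrow> e 0 <# s 0"
      "e i = (\<Oplus>j\<in>{1..n+1} - {i}. e j \<otimes> q j)" by blast
    have "\<exists>u\<in>s 0. q j = e 0 \<otimes> u" if "j \<in> {1..n+1} - {i}" for j
      using q(1) that by (auto simp: l_coset_def Pi_def)
    then obtain u where u: "\<And>j. j \<in> {1..n+1} - {i} \<Longrightarrow> u j \<in> s 0 \<and> q j = e 0 \<otimes> u j" by metis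
    obtain z where z: "z \<in> s 0" using U by blast
    \<comment> \<open>\<open>y - (n+1)\<close> recovers the index of a coefficient variable.
      Truncated subtraction gives 0, which is no index, for small \<open>y\<close>; every other
      variable, the idle one included, receives \<open>z\<close>.\<close>
    define a where "a = (\<lambda>y. if y - (n+1) \<in> {1..n+1} - {i} then u (y - (n+1)) else z)"
    have au: "a (n+1+j) = u j" if "j \<in> {1..n+1} - {i}" for j using that by (simp add: a_def)
    have az: "a y \<in> s 0" for y using u z by (simp add: a_def)
    have "(\<Oplus>j\<in>{1..n+1} - {i}. e j \<otimes> q j) = (\<Oplus>j\<in>{1..n+1} - {i}. e j \<otimes> (e 0 \<otimes> a (n+1+j)))"
    proof (intro finsum_cong' refl)
      show "(\<lambda>j. e j \<otimes> (e 0 \<otimes> a (n+1+j))) \<in> {1..n+1} - {i} \<rightarrow> carrier R"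
        using e az U by (intro Pi_I m_closed) auto
    qed (use u au in simp)
    then have "(\<forall>j\<in>{1..n+1}. a (n+1+j) \<in> s 0) \<and>
      e i = (\<Oplus>j\<in>{1..n+1} - {i}. e j \<otimes> (e 0 \<otimes> a (n+1+j)))" using q az by simp
    moreover have "a \<in> ?X \<rightarrow> carrier R" using az U by auto
    ultimately show ?L
      unfolding combination_form_def sat_ExElt_block set_upt using sat by blast
  qed
qed

lemma (in cring) sat_W_form:
  assumes \<tau>: "\<And>U. U \<in> \<tau> \<Longrightarrow> U \<subseteq> carrier R \<and> U \<noteq> {}"
  shows "sat R \<tau> e s (W_form n) \<longleftrightarrow> (\<forall>U\<in>\<tau>. \<exists>c\<in>carrier R - {\<zero>}. W_set n R (c <# U))"
proof -
  have "sat R \<tau> (e(0 := c)) (s(0 := U))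
      (foldr AllElt [1..<n+2] (disj_list (map (combination_form n) [1..<n+2])))
    \<longleftrightarrow> W_set n R (c <# U)" if U: "U \<in> \<tau>" and c: "c \<in> carrier R" for U c
  proof -
    have set1: "set [1..<n+2] = {1..n+1}" by auto
    have "sat R \<tau> (override_on (e(0 := c)) x {1..n+1}) (s(0 := U)) (combination_form n i) \<longleftrightarrow>
      (\<exists>q \<in> {1..n+1} - {i} \<rightarrow> c <# U. x i = (\<Oplus>j\<in>{1..n+1} - {i}. x j \<otimes> q j))"
      if x: "x \<in> {1..n+1} \<rightarrow> carrier R" and i: "i \<in> {1..n+1}" for x i
    proof -
      let ?e = "override_on (e(0 := c)) x {1..n+1}"
      have e0: "?e 0 = c" and ej: "j \<in> {1..n+1} \<Longrightarrow> ?e j = x j" for j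
        by (auto simp: override_on_def)
      have "?e j \<in> carrier R" if "j \<in> {0..n+1}" for j
      proof (cases "j = 0")
        case False
        then have "j \<in> {1..n+1}" using that by auto
        then show ?thesis using x ej by (auto simp: Pi_def)
      qed (use c e0 in simp)
      note this[THEN sat_combination_form[of n ?e i "s(0 := U)" \<tau>]]
      moreover have cU: "c <# U \<subseteq> carrier R" using \<tau>[OF U] c by (auto simp: l_coset_def)
      have "(\<Oplus>j\<in>{1..n+1} - {i}. ?e j \<otimes> q j) = (\<Oplus>j\<in>{1..n+1} - {i}. x j \<otimes> q j)"
        if "q \<in> {1..n+1} - {i} \<rightarrow> c <# U" for q
        using that x cU by (intro finsum_cong') (auto simp: ej Pi_def subset_iff)
      ultimately show ?thesis using \<tau>[OF U] i by (simp add: e0 ej cong: bex_cong)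
    qed
    moreover have "c <# U \<subseteq> carrier R" using \<tau>[OF U] c by (auto simp: l_coset_def)
    ultimately show ?thesis
      unfolding sat_AllElt_block sat_disj_list W_set_def set1 set_map by simp
  qed
  then show ?thesis unfolding W_form_def by (simp add: Bex_def Ball_def)
qed

section \<open>$W_n$-sets, $W_n$-topologies and V-topologies\<close>

lemma W_setD:
  assumes "W_set n K S" "x \<in> {1..n+1} \<rightarrow> carrier K"
  shows "\<exists>i\<in>{1..n+1}. \<exists>s\<in>{1..n+1} - {i} \<rightarrow> S.
    x i = (\<Oplus>\<^bsub>K\<^esub>j\<in>{1..n+1} - {i}. x j \<otimes>\<^bsub>K\<^esub> s j)"
  using assms unfolding W_set_def by simp

lemma W_set_mono:
  assumes "W_set n K S" "S \<subseteq> S'" "S' \<subseteq> carrier K"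
  shows "W_set n K S'"
  unfolding W_set_def
proof (intro conjI ballI)
  fix x assume "x \<in> {1..n+1} \<rightarrow> carrier K"
  then obtain i s where "i \<in> {1..n+1}" "s \<in> {1..n+1} - {i} \<rightarrow> S"
    "x i = (\<Oplus>\<^bsub>K\<^esub>j\<in>{1..n+1} - {i}. x j \<otimes>\<^bsub>K\<^esub> s j)"
    using assms(1) unfolding W_set_def by meson
  moreover have "s \<in> {1..n+1} - {i} \<rightarrow> S'" using calculation(2) assms(2) by blast
  ultimately show "\<exists>i\<in>{1..n+1}. \<exists>s\<in>{1..n+1} - {i} \<rightarrow> S'.
      x i = (\<Oplus>\<^bsub>K\<^esub>j\<in>{1..n+1} - {i}. x j \<otimes>\<^bsub>K\<^esub> s j)" by blast
qed (rule assms(3))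

text \<open>A relation among the first \<open>n+1\<close> elements is padded with coefficients
  \<open>\<zero>\<close>, which must therefore lie in \<open>S\<close>.\<close>

lemma (in cring) W_set_le:
  assumes W: "W_set n R S" and zero: "\<zero> \<in> S" and "n \<le> m"
  shows "W_set m R S"
  unfolding W_set_def
proof (intro conjI ballI)
  show S: "S \<subseteq> carrier R" using W by (simp add: W_set_def)
  fix x assume x: "x \<in> {1..m+1} \<rightarrow> carrier R"
  then have "x \<in> {1..n+1} \<rightarrow> carrier R" using \<open>n \<le> m\<close> by auto
  then obtain i s where i: "i \<in> {1..n+1}" and s: "s \<in> {1..n+1} - {i} \<rightarrow> S"
    "x i = (\<Oplus>j\<in>{1..n+1} - {i}. x j \<otimes> s j)"
    using W unfolding W_set_def by meson
  define s' where "s' j = (if j \<in> {1..n+1} - {i} then s j else \<zero>)" for j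
  have s'S: "s' j \<in> S" for j using s zero unfolding s'_def by auto
  have "(\<Oplus>j\<in>{1..m+1} - {i}. x j \<otimes> s' j) = (\<Oplus>j\<in>{1..n+1} - {i}. x j \<otimes> s' j)"
  proof (intro add.finprod_mono_neutral_cong_right)
    show "x j \<otimes> s' j = \<zero>" if "j \<in> {1..m+1} - {i} - ({1..n+1} - {i})" for j
      using x that by (auto simp: s'_def Pi_def)
    show "(\<lambda>j. x j \<otimes> s' j) \<in> {1..m+1} - {i} \<rightarrow> carrier R"
      using x S s'S by (intro Pi_I m_closed) auto
  qed (use \<open>n \<le> m\<close> in auto)
  also have "\<dots> = (\<Oplus>j\<in>{1..n+1} - {i}. x j \<otimes> s j)"
  proof (intro finsum_cong' refl)
    show "(\<lambda>j. x j \<otimes> s j) \<in> {1..n+1} - {i} \<rightarrow> carrier R"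
    proof
      fix j assume "j \<in> {1..n+1} - {i}"
      then have "x j \<in> carrier R" "s j \<in> carrier R" using x s S \<open>n \<le> m\<close> by auto
      then show "x j \<otimes> s j \<in> carrier R" by simp
    qed
  qed (simp add: s'_def)
  finally have "x i = (\<Oplus>j\<in>{1..m+1} - {i}. x j \<otimes> s' j)" using s(2) by simp
  then show "\<exists>i\<in>{1..m+1}. \<exists>s\<in>{1..m+1} - {i} \<rightarrow> S. x i = (\<Oplus>j\<in>{1..m+1} - {i}. x j \<otimes> s j)"
    using i s'S \<open>n \<le> m\<close> by (intro bexI[of _ i] bexI[of _ s']) auto
qed

text \<open>Each of the two possible sums has a single term. When \<open>S\<close> is a subring of a
  field this is the divisibility condition that defines a valuation ring.\<close>

lemma (in cring) W_set_1_iff: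
  "W_set 1 R S \<longleftrightarrow> S \<subseteq> carrier R \<and>
     (\<forall>x\<in>carrier R. \<forall>y\<in>carrier R. (\<exists>s\<in>S. x = y \<otimes> s) \<or> (\<exists>s\<in>S. y = x \<otimes> s))"
  (is "_ \<longleftrightarrow> _ \<and> ?C")
proof -
  have I: "{1..1+1::nat} = {1, 2}" "{1, 2} - {1} = {2::nat}" "{1, 2} - {2} = {1::nat}" by auto
  have sum: "(\<Oplus>j\<in>{i}. x j \<otimes> s j) = x i \<otimes> s i"
    if "x i \<in> carrier R" "s i \<in> carrier R" for i :: nat and x s
    using that finsum_insert[of "{}" i "\<lambda>j. x j \<otimes> s j"] by simp
  show ?thesis
  proof (intro iffI conjI ballI)
    assume W: "W_set 1 R S"
    then show S: "S \<subseteq> carrier R" by (simp add: W_set_def)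
    fix x y assume xy: "x \<in> carrier R" "y \<in> carrier R"
    define z :: "nat \<Rightarrow> 'a" where "z = (\<lambda>j. if j = 1 then x else y)"
    have "z \<in> {1..1+1} \<rightarrow> carrier R" using xy by (auto simp: z_def)
    then obtain i s where i: "i \<in> {1, 2}" and s: "s \<in> {1, 2} - {i} \<rightarrow> S"
      "z i = (\<Oplus>j\<in>{1, 2} - {i}. z j \<otimes> s j)"
      using W unfolding W_set_def I(1) by blast
    consider "i = 1" | "i = 2" using i by blast
    then show "(\<exists>s\<in>S. x = y \<otimes> s) \<or> (\<exists>s\<in>S. y = x \<otimes> s)"
    proof cases
      case 1
      have sS: "s 2 \<in> S" using s(1) 1 by auto
      have "z 1 = (\<Oplus>j\<in>{2}. z j \<otimes> s j)" using s(2) unfolding 1 I(2) .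
      also have "\<dots> = z 2 \<otimes> s 2" using sS S xy by (intro sum) (auto simp: z_def)
      finally have "x = y \<otimes> s 2" by (simp add: z_def)
      then show ?thesis using sS by blast
    next
      case 2
      have sS: "s 1 \<in> S" using s(1) 2 by auto
      have "z 2 = (\<Oplus>j\<in>{1}. z j \<otimes> s j)" using s(2) unfolding 2 I(3) .
      also have "\<dots> = z 1 \<otimes> s 1" using sS S xy by (intro sum) (auto simp: z_def)
      finally have "y = x \<otimes> s 1" by (simp add: z_def)
      then show ?thesis using sS by blast
    qed
  next
    assume C: "S \<subseteq> carrier R \<and> ?C"
    show "W_set 1 R S"
      unfolding W_set_def I(1)
    proof (intro conjI ballI)
      show "S \<subseteq> carrier R" using C by blast
      fix x assume x: "x \<in> {1::nat, 2} \<rightarrow> carrier R"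
      then consider s where "s \<in> S" "x 1 = x 2 \<otimes> s" | s where "s \<in> S" "x 2 = x 1 \<otimes> s"
        using C by (metis PiE insertI1 insertI2)
      then show "\<exists>i\<in>{1, 2}. \<exists>s\<in>{1, 2} - {i} \<rightarrow> S. x i = (\<Oplus>j\<in>{1, 2} - {i}. x j \<otimes> s j)"
      proof cases
        case 1
        have "x 2 \<in> carrier R" "s \<in> carrier R" using 1 x C by auto
        then have "x 1 = (\<Oplus>j\<in>{1, 2} - {1}. x j \<otimes> s)"
          using 1(2) sum[of x 2 "\<lambda>_. s"] unfolding I by simp
        then show ?thesis
          by (rule bexI[where x = 1, OF bexI[where x = "\<lambda>_. s"]]) (use 1(1) in auto)
      next
        case 2
        have "x 1 \<in> carrier R" "s \<in> carrier R" using 2 x C by auto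
        then have "x 2 = (\<Oplus>j\<in>{1, 2} - {2}. x j \<otimes> s)"
          using 2(2) sum[of x 1 "\<lambda>_. s"] unfolding I by simp
        then show ?thesis
          by (rule bexI[where x = 2, OF bexI[where x = "\<lambda>_. s"]]) (use 2(1) in auto)
      qed
    qed
  qed
qed

section \<open>Axiomatization by local sentences and continuity of division\<close>

context topological_field_ring
begin

lemma locally_boundedE:
  assumes "locally_bounded K T"
  obtains B where "B \<in> nbhds" "bounded B"
  using assms unfolding locally_bounded_def by blast

lemma W_topology_le:
  assumes "W_topology n K T" "n \<le> m"
  shows "W_topology m K T"
  unfolding W_topology_def
proof (intro conjI ballI)
  fix U assume U: "U \<in> nbhds"
  then obtain c where c: "c \<in> carrier K - {\<zero>}" "W_set n K (c <# U)"
    using assms(1) unfolding W_topology_def by blast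
  have "\<zero> \<in> c <# U" using nbhds_zero[OF nbhds_l_coset[OF U]] c(1) by auto
  then show "\<exists>c\<in>carrier K - {\<zero>}. W_set m K (c <# U)" using W_set_le[OF c(2) _ assms(2)] c(1) by blast
qed (use assms(1) in \<open>simp_all add: W_topology_def\<close>)

lemma models_iff_sat_const:
  assumes "local_sentence f"
  shows "models K T f \<longleftrightarrow> sat K nbhds (\<lambda>_. \<zero>) (\<lambda>_. carrier K) f"
  using assms by (intro models_iff_sat) (auto simp: nbhds_carrier)

text \<open>This lets the notion travel along \<open>locally_equivalent\<close>: the ring topology
  is a standing assumption, the remaining conditions are local sentences.\<close>

lemma W_topology_iff_models:
  "W_topology n K T \<longleftrightarrow> models K T locally_bounded_form \<and> models K T (W_form n)"
proof -
  have sat: "sat K nbhds e s locally_bounded_form \<longleftrightarrow>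
      (\<exists>U\<in>nbhds. \<forall>V\<in>nbhds. \<exists>c\<in>carrier K - {\<zero>}. c <# U \<subseteq> V)" for e s
    by (intro sat_locally_bounded_form nbhds_sub)
  have "models K T locally_bounded_form \<longleftrightarrow> locally_bounded K T"
    unfolding models_iff_sat_const[OF local_sentence_locally_bounded_form] locally_bounded_def sat
      bounded_subset_def
    by (intro bex_cong refl) (simp add: nbhds_sub)
  moreover have "models K T (W_form n) \<longleftrightarrow> (\<forall>U\<in>nbhds. \<exists>c\<in>carrier K - {\<zero>}. W_set n K (c <# U))"
    unfolding models_iff_sat_const[OF local_sentence_W_form]
    using nbhds_sub nbhds_zero by (intro sat_W_form) blast
  ultimately show ?thesis by (simp add: W_topology_def ring_topology)
qed

lemma models_inverse_form:
  "models K T inverse_form \<longleftrightarrow>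
     (\<forall>U\<in>nbhds. \<exists>V\<in>nbhds. \<forall>x\<in>V. \<exists>y\<in>U. (\<one> \<oplus> x) \<otimes> (\<one> \<oplus> y) = \<one>)"
  unfolding models_iff_sat_const[OF local_sentence_inverse_form]
  by (intro sat_inverse_form nbhds_sub)

text \<open>Multiplication by \<open>inv y0\<close> moves \<open>y0\<close> to
  \<open>\<one>\<close>: if \<open>y \<otimes> inv y0 = \<one> \<oplus> x\<close> has the inverse
  \<open>\<one> \<oplus> z\<close>, then
  \<open>inv y = inv y0 \<otimes> (\<one> \<oplus> z)\<close>. The sets \<open>U\<close> and
  \<open>W\<close> are the corresponding preimages of \<open>Q\<close> and
  \<open>V'\<close>.\<close>

lemma continuous_map_inv:
  assumes "models K T inverse_form"
  shows "continuous_map (subtopology T (carrier K - {\<zero>})) T (\<lambda>y. inv y)"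
  unfolding continuous_map_def
proof (intro conjI allI impI)
  let ?S = "subtopology T (carrier K - {\<zero>})"
  have S: "topspace ?S = carrier K - {\<zero>}" by (auto simp: topspace_eq)
  show "m_inv K \<in> topspace ?S \<rightarrow> topspace T"
    unfolding S topspace_eq using inv_nonzero(1) by auto
  fix Q assume Q: "openin T Q"
  show "openin ?S {y \<in> topspace ?S. inv y \<in> Q}"
    unfolding openin_subopen[of ?S "{y \<in> topspace ?S. inv y \<in> Q}"]
  proof
    fix y0 assume "y0 \<in> {y \<in> topspace ?S. inv y \<in> Q}"
    then have y0: "y0 \<in> carrier K" "y0 \<noteq> \<zero>" "inv y0 \<in> Q" by (auto simp: S)
    note iy0 = inv_nonzero[OF y0(1,2)]
    define U where "U = {z \<in> carrier K. inv y0 \<otimes> (\<one> \<oplus> z) \<in> Q}"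
    have "openin T {z \<in> topspace T. inv y0 \<otimes> (\<one> \<oplus> z) \<in> Q}"
      using Q iy0 by (intro openin_continuous_map_preimage[where Y = T] continuous_map_mult
          continuous_map_add continuous_map_const_carrier) auto
    then have "openin T U" by (simp add: U_def topspace_eq)
    moreover have "\<zero> \<in> U" using y0 iy0 by (simp add: U_def)
    ultimately have "U \<in> nbhds" unfolding nbhds_iff using U_def by blast
    then obtain V where V: "V \<in> nbhds" "\<forall>x\<in>V. \<exists>y\<in>U. (\<one> \<oplus> x) \<otimes> (\<one> \<oplus> y) = \<one>"
      using assms unfolding models_inverse_form by blast
    obtain V' where V': "openin T V'" "\<zero> \<in> V'" "V' \<subseteq> V" using V(1) unfolding nbhds_iff by blast
    define W where "W = {y \<in> carrier K. y \<otimes> inv y0 \<oplus> \<ominus> \<one> \<in> V'}"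
    have "openin T {y \<in> topspace T. y \<otimes> inv y0 \<oplus> \<ominus> \<one> \<in> V'}"
      using V' iy0 by (intro openin_continuous_map_preimage[where Y = T] continuous_map_mult
          continuous_map_add continuous_map_const_carrier) auto
    then have "openin T W" by (simp add: W_def topspace_eq)
    then have "openin ?S (W \<inter> (carrier K - {\<zero>}))" by (auto simp: openin_subtopology)
    moreover have "y0 \<in> W \<inter> (carrier K - {\<zero>})" using y0 iy0 V' by (simp add: W_def r_neg)
    moreover have "inv y \<in> Q" if y: "y \<in> W" "y \<noteq> \<zero>" for y
    proof -
      have yc: "y \<in> carrier K" using y by (simp add: W_def)
      define x where "x = y \<otimes> inv y0 \<oplus> \<ominus> \<one>"
      have x: "x \<in> V'" using y by (simp add: W_def x_def)
      have x1: "\<one> \<oplus> x = y \<otimes> inv y0" unfolding x_def using yc iy0 by algebra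
      obtain z where z: "z \<in> U" "(\<one> \<oplus> x) \<otimes> (\<one> \<oplus> z) = \<one>" using V V' x by blast
      have zc: "z \<in> carrier K" using z by (simp add: U_def)
      have "y \<otimes> (inv y0 \<otimes> (\<one> \<oplus> z)) = \<one>" using z(2) unfolding x1 using yc iy0 zc
        by (simp add: m_assoc)
      then have "inv y = inv y0 \<otimes> (\<one> \<oplus> z)"
        using yc iy0 zc by (intro comm_inv_char) auto
      then show ?thesis using z by (simp add: U_def)
    qed
    ultimately show "\<exists>Z. openin ?S Z \<and> y0 \<in> Z \<and> Z \<subseteq> {y \<in> topspace ?S. inv y \<in> Q}"
      unfolding S by (intro exI[of _ "W \<inter> (carrier K - {\<zero>})"]) auto
  qed
qed

lemma field_topology_if_models:
  assumes "models K T inverse_form"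
  shows "field_topology K T"
proof -
  let ?P = "prod_topology T (subtopology T (carrier K - {\<zero>}))"
  have "continuous_map ?P T ((\<lambda>y. inv y) \<circ> snd)"
    by (rule continuous_map_compose[OF continuous_map_snd continuous_map_inv[OF assms]])
  then have "continuous_map ?P T (\<lambda>p. fst p \<otimes> inv (snd p))"
    by (intro continuous_map_mult continuous_map_fst) (simp add: o_def)
  then show ?thesis by (simp add: field_topology_def ring_topology case_prod_unfold)
qed

section \<open>V-topologies and \<open>W_1\<close>-topologies\<close>

lemma V_topology_locally_bounded:
  assumes V: "V_topology K T"
  shows "locally_bounded K T"
proof -
  obtain U1 where U1: "U1 \<in> nbhds" "\<one> \<notin> U1" using nbhds_separate[of \<one>] by auto
  obtain U0 where U0: "U0 \<in> nbhds" "\<And>x y. x \<in> U0 \<Longrightarrow> y \<in> U0 \<Longrightarrow> x \<otimes> y \<in> U1"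
    using nbhds_mult[OF U1(1)] by blast
  have "bounded U0"
    unfolding bounded_iff
  proof (intro conjI ballI)
    show "U0 \<subseteq> carrier K" using U0 nbhds_sub by blast
    fix U assume U: "U \<in> nbhds"
    define W where "W = U \<inter> U0"
    have W: "W \<in> nbhds" unfolding W_def using U U0 nbhds_Int by blast
    then obtain V' where V': "V' \<in> nbhds"
      "\<forall>x\<in>carrier K. \<forall>y\<in>carrier K. x \<otimes> y \<in> V' \<longrightarrow> x \<in> W \<or> y \<in> W"
      using V unfolding V_topology_def by blast
    \<comment> \<open>Products of elements of \<open>U0\<close> are never \<open>\<one>\<close>, so
      for nonzero \<open>x\<close> the inverse lies outside \<open>U0\<close>, hence outside
      \<open>W\<close>. As \<open>v = (v x) (inv x)\<close> lies in \<open>V'\<close>, the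
      V-condition forces \<open>v x\<close> into \<open>W\<close>.\<close>
    have "v \<otimes> x \<in> U" if v: "v \<in> V'" and x: "x \<in> U0" for v x
    proof (cases "x = \<zero>")
      case True
      then show ?thesis using v nbhds_sub[OF V'(1)] nbhds_zero[OF U] by auto
    next
      case False
      have c: "v \<in> carrier K" "x \<in> carrier K" using v x V' U0 nbhds_closed by blast+
      note ix = inv_nonzero[OF c(2) False]
      have "inv x \<notin> U0" using U0(2)[OF x] ix(3) U1(2) by metis
      then have "inv x \<notin> W" by (simp add: W_def)
      moreover have "(v \<otimes> x) \<otimes> inv x = v" using c ix by (simp add: m_assoc)
      ultimately have "v \<otimes> x \<in> W" using V'(2) v c ix by (metis m_closed)
      then show ?thesis by (simp add: W_def)
    qed
    then show "\<exists>V\<in>nbhds. \<forall>v\<in>V. \<forall>x\<in>U0. v \<otimes> x \<in> U" using V'(1) by blast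
  qed
  then show ?thesis using U0 by (auto simp: locally_bounded_def)
qed

text \<open>Let \<open>d d\<close> lie in \<open>V'\<close>. For nonzero \<open>x\<close> and
  \<open>y\<close> the elements \<open>d x / y\<close> and \<open>d y / x\<close> have product
  \<open>d d\<close>, so one of them lies in \<open>U\<close>; the scalar wanted is thus
  \<open>inv d\<close>.\<close>

lemma V_topology_imp_W_topology:
  assumes V: "V_topology K T"
  shows "W_topology 1 K T"
  unfolding W_topology_def
proof (intro conjI ballI)
  fix U assume U: "U \<in> nbhds"
  then obtain V' where V': "V' \<in> nbhds"
    "\<forall>x\<in>carrier K. \<forall>y\<in>carrier K. x \<otimes> y \<in> V' \<longrightarrow> x \<in> U \<or> y \<in> U"
    using V unfolding V_topology_def by blast
  obtain V'' where V'': "V'' \<in> nbhds" "\<And>x y. x \<in> V'' \<Longrightarrow> y \<in> V'' \<Longrightarrow> x \<otimes> y \<in> V'"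
    using nbhds_mult[OF V'(1)] by blast
  obtain d where d: "d \<in> V''" "d \<noteq> \<zero>" using nbhds_nonzero[OF V''(1)] by blast
  have dc: "d \<in> carrier K" using d V'' nbhds_closed by blast
  note id = inv_nonzero[OF dc d(2)]
  have "W_set 1 K (inv d <# U)"
    unfolding W_set_1_iff
  proof (intro conjI ballI)
    show "inv d <# U \<subseteq> carrier K" using nbhds_sub[OF nbhds_l_coset[OF U id(1,2)]] .
    fix x y assume xy: "x \<in> carrier K" "y \<in> carrier K"
    have divide: "\<exists>s\<in>inv d <# U. a = b \<otimes> s"
      if "a \<in> carrier K" "b \<in> carrier K" "b \<noteq> \<zero>" "d \<otimes> (a \<otimes> inv b) \<in> U" for a b
    proof
      note ib = inv_nonzero[OF that(2,3)]
      have "a \<otimes> inv b = inv d \<otimes> (d \<otimes> (a \<otimes> inv b))"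
        using mult_inv_cancel(2)[OF dc d(2)] that ib by simp
      then show "a \<otimes> inv b \<in> inv d <# U" using that(4) unfolding l_coset_def by blast
      show "a = b \<otimes> (a \<otimes> inv b)"
        using that ib by (simp add: m_lcomm)
    qed
    have zero: "\<zero> \<in> inv d <# U" using nbhds_zero[OF nbhds_l_coset[OF U id(1,2)]] .
    show "(\<exists>s\<in>inv d <# U. x = y \<otimes> s) \<or> (\<exists>s\<in>inv d <# U. y = x \<otimes> s)"
    proof (cases "x = \<zero> \<or> y = \<zero>")
      case True
      then show ?thesis using zero xy by (metis r_null)
    next
      case False
      then have "x \<noteq> \<zero>" "y \<noteq> \<zero>" by auto
      note ix = inv_nonzero[OF xy(1) this(1)] and iy = inv_nonzero[OF xy(2) this(2)]
      note inv_carrier = ix(1) iy(1)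
      have "(d \<otimes> (x \<otimes> inv y)) \<otimes> (d \<otimes> (y \<otimes> inv x)) = (d \<otimes> d) \<otimes> ((x \<otimes> inv x) \<otimes> (y \<otimes> inv y))"
        using xy inv_carrier dc by (simp add: m_ac)
      also have "\<dots> = d \<otimes> d" using ix iy dc False by simp
      finally have "(d \<otimes> (x \<otimes> inv y)) \<otimes> (d \<otimes> (y \<otimes> inv x)) \<in> V'" using V''(2) d by simp
      then have "d \<otimes> (x \<otimes> inv y) \<in> U \<or> d \<otimes> (y \<otimes> inv x) \<in> U"
        using V'(2) xy ix iy dc False by simp
      then show ?thesis using divide xy False by blast
    qed
  qed
  then show "\<exists>c\<in>carrier K - {\<zero>}. W_set 1 K (c <# U)" using id by blast
qed (use V V_topology_locally_bounded in \<open>simp_all add: V_topology_def\<close>)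

text \<open>Inverses of elements outside \<open>U\<close> stay in a bounded set \<open>D\<close>. If
  neither factor of a small product \<open>x \<otimes> y\<close> lay in \<open>U\<close>,
  multiplying by \<open>inv x \<otimes> inv y\<close> from the bounded set \<open>D D\<close> would
  put \<open>\<one>\<close> into a neighbourhood that misses it.\<close>

lemma W_topology_imp_V_topology:
  assumes W: "W_topology 1 K T"
  shows "V_topology K T"
  unfolding V_topology_def
proof (intro conjI ballI)
  show "ring_topology K T" by (rule ring_topology)
  fix U assume U: "U \<in> nbhds"
  obtain B where B: "B \<in> nbhds" "bounded B"
    using W locally_boundedE unfolding W_topology_def by blast
  have UB: "U \<inter> B \<in> nbhds" using U B nbhds_Int by blast
  then obtain c where c: "c \<in> carrier K" "c \<noteq> \<zero>" "W_set 1 K (c <# (U \<inter> B))"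
    using W unfolding W_topology_def by blast
  note ic = inv_nonzero[OF c(1,2)]
  \<comment> \<open>\<open>x\<close> is compared with \<open>inv c\<close> to cancel the scalar:
    \<open>x = inv c (c u)\<close> would put \<open>x\<close> into \<open>U \<inter> B\<close>, and
    the other alternative \<open>inv c = x (c u)\<close> yields \<open>inv x = c c u\<close>, whence
    the square.\<close>
  define D where "D = (c \<otimes> c) <# B"
  have D: "bounded D" unfolding D_def using B c by (intro bounded_l_coset) auto
  have invD: "inv x \<in> D" if x: "x \<in> carrier K" "x \<notin> U \<inter> B" "x \<noteq> \<zero>" for x
  proof -
    note ix = inv_nonzero[OF x(1,3)]
    consider s where "s \<in> c <# (U \<inter> B)" "x = inv c \<otimes> s" | s where "s \<in> c <# (U \<inter> B)" "inv c = x \<otimes> s"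
      using c(3) x ic unfolding W_set_1_iff by blast
    then show ?thesis
    proof cases
      case 1
      then obtain u where u: "u \<in> U \<inter> B" "s = c \<otimes> u" by (auto simp: l_coset_def)
      then have "x = u" using 1 mult_inv_cancel[OF c(1,2)] nbhds_closed[OF UB] by simp
      then show ?thesis using u x by blast
    next
      case 2
      then obtain u where u: "u \<in> U \<inter> B" "s = c \<otimes> u" by (auto simp: l_coset_def)
      have uc: "u \<in> carrier K" using u nbhds_closed[OF UB] by blast
      have "x \<otimes> ((c \<otimes> c) \<otimes> u) = c \<otimes> (x \<otimes> (c \<otimes> u))" using x c uc by (simp add: m_ac)
      also have "\<dots> = c \<otimes> inv c" using 2 u by simp
      finally have "x \<otimes> ((c \<otimes> c) \<otimes> u) = \<one>" using ic by simp
      then have "inv x = (c \<otimes> c) \<otimes> u" using x c uc by (intro comm_inv_char) auto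
      then show ?thesis using u unfolding D_def l_coset_def by auto
    qed
  qed
  obtain U1 where U1: "U1 \<in> nbhds" "\<one> \<notin> U1" using nbhds_separate[of \<one>] by auto
  obtain V where V: "V \<in> nbhds"
    "\<And>v x. v \<in> V \<Longrightarrow> x \<in> {x \<otimes> y | x y. x \<in> D \<and> y \<in> D} \<Longrightarrow> v \<otimes> x \<in> U1"
    using boundedE_nbhd[OF bounded_mult[OF D D] U1(1)] by blast
  have "x \<in> U \<or> y \<in> U" if xy: "x \<in> carrier K" "y \<in> carrier K" "x \<otimes> y \<in> V" for x y
  proof (rule ccontr)
    assume n: "\<not> (x \<in> U \<or> y \<in> U)"
    then have n0: "x \<noteq> \<zero>" "y \<noteq> \<zero>" using nbhds_zero[OF U] by auto
    note ix = inv_nonzero[OF xy(1) n0(1)] and iy = inv_nonzero[OF xy(2) n0(2)]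
    have "inv x \<in> D" "inv y \<in> D" using invD xy n n0 by auto
    then have "(x \<otimes> y) \<otimes> (inv x \<otimes> inv y) \<in> U1" using V(2)[OF xy(3)] by blast
    moreover have "(x \<otimes> y) \<otimes> (inv x \<otimes> inv y) = (x \<otimes> inv x) \<otimes> (y \<otimes> inv y)"
      using xy ix iy by (simp add: m_ac)
    ultimately show False using ix iy U1 by simp
  qed
  then show "\<exists>V\<in>nbhds. \<forall>x\<in>carrier K. \<forall>y\<in>carrier K. x \<otimes> y \<in> V \<longrightarrow> x \<in> U \<or> y \<in> U"
    using V(1) by blast
qed

end

section \<open>Units of a $W_n$-ring\<close>

context frac_subring
begin

lemma R_carrier: "a \<in> R \<Longrightarrow> a \<in> carrier K"
  using R_sub by blast

lemma l_coset_R_nbhd: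
  assumes "c \<in> carrier K" "c \<noteq> \<zero>"
  shows "c <# R \<in> zero_nbhds K (induced_topology K R)"
  unfolding zero_nbhds_induced using assms R_sub by (auto simp: l_coset_def)

lemma one_l_coset_R: "\<one> <# R = R"
  using R_sub by (force simp: l_coset_def)

text \<open>\<open>R\<close> is a neighbourhood, and bounded because its multiples form the basis. A
  neighbourhood that contains \<open>d R\<close> becomes, after scaling by \<open>inv d\<close>, a
  superset of the \<open>W_n\<close>-set \<open>R\<close>.\<close>

lemma W_topology_induced:
  assumes "W_set n K R" "R \<noteq> carrier K"
  shows "W_topology n K (induced_topology K R)"
  unfolding W_topology_def
proof (intro conjI ballI)
  show "ring_topology K (induced_topology K R)" using assms by (intro ring_topology_induced)
  have "bounded_subset K (induced_topology K R) R"
    using R_sub by (auto simp: bounded_subset_def zero_nbhds_induced)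
  moreover have "R \<in> zero_nbhds K (induced_topology K R)"
    using l_coset_R_nbhd[of \<one>] one_l_coset_R by simp
  ultimately show "locally_bounded K (induced_topology K R)" by (auto simp: locally_bounded_def)
next
  fix U assume "U \<in> zero_nbhds K (induced_topology K R)"
  then obtain d where U: "U \<subseteq> carrier K" and d: "d \<in> carrier K" "d \<noteq> \<zero>" "d <# R \<subseteq> U"
    by (auto simp: zero_nbhds_induced)
  note id = inv_nonzero[OF d(1,2)]
  have "R \<subseteq> inv d <# U"
  proof
    fix r assume r: "r \<in> R"
    then have "d \<otimes> r \<in> U" using d(3) by (auto simp: l_coset_def)
    moreover have "r = inv d \<otimes> (d \<otimes> r)" using mult_inv_cancel(2)[OF d(1,2) R_carrier[OF r]] by simp
    ultimately show "r \<in> inv d <# U" unfolding l_coset_def by blast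
  qed
  moreover have "inv d <# U \<subseteq> carrier K" using id U by (auto simp: l_coset_def)
  ultimately have "W_set n K (inv d <# U)" by (rule W_set_mono[OF assms(1)])
  then show "\<exists>c\<in>carrier K - {\<zero>}. W_set n K (c <# U)" using id by blast
qed

section \<open>Units and comaximal elements of \<open>R\<close>\<close>

definition runit :: "'a \<Rightarrow> bool" where
  "runit a \<longleftrightarrow> (\<exists>u\<in>R. a \<otimes> u = \<one>)"

definition comaximal :: "'a \<Rightarrow> 'a \<Rightarrow> bool" where
  "comaximal a b \<longleftrightarrow> (\<exists>u\<in>R. \<exists>v\<in>R. a \<otimes> u \<oplus> b \<otimes> v = \<one>)"

lemma comaximalI: "a \<otimes> u \<oplus> b \<otimes> v = \<one> \<Longrightarrow> u \<in> R \<Longrightarrow> v \<in> R \<Longrightarrow> comaximal a b"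
  unfolding comaximal_def by blast

lemma runit_factor:
  assumes "runit (a \<otimes> b)" "a \<in> R" "b \<in> R"
  shows "runit a"
proof -
  obtain u where "u \<in> R" "(a \<otimes> b) \<otimes> u = \<one>" using assms by (auto simp: runit_def)
  then have "b \<otimes> u \<in> R" "a \<otimes> (b \<otimes> u) = \<one>"
    using assms R_closed(5) R_carrier by (auto simp: m_assoc)
  then show ?thesis by (auto simp: runit_def)
qed

lemma comaximal_sym: "a \<in> R \<Longrightarrow> b \<in> R \<Longrightarrow> comaximal a b \<Longrightarrow> comaximal b a"
  unfolding comaximal_def by (metis R_carrier R_closed(5) a_comm)

text \<open>In the product of the two relations every term except
  \<open>(b \<otimes> c) \<otimes> (v \<otimes> z)\<close> is divisible by \<open>a\<close>.\<close>

lemma comaximal_mult: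
  assumes R: "a \<in> R" "b \<in> R" "c \<in> R" and ab: "comaximal a b" and ac: "comaximal a c"
  shows "comaximal a (b \<otimes> c)"
proof -
  obtain u v where uv: "u \<in> R" "v \<in> R" "a \<otimes> u \<oplus> b \<otimes> v = \<one>" using ab by (auto simp: comaximal_def)
  obtain w z where wz: "w \<in> R" "z \<in> R" "a \<otimes> w \<oplus> c \<otimes> z = \<one>" using ac by (auto simp: comaximal_def)
  note C = R(1-3)[THEN R_carrier] uv(1,2)[THEN R_carrier] wz(1,2)[THEN R_carrier]
  have "\<one> = (a \<otimes> u \<oplus> b \<otimes> v) \<otimes> (a \<otimes> w \<oplus> c \<otimes> z)" using uv wz by simp
  also have "\<dots> = a \<otimes> (u \<otimes> (a \<otimes> w \<oplus> c \<otimes> z) \<oplus> (b \<otimes> v) \<otimes> w) \<oplus> (b \<otimes> c) \<otimes> (v \<otimes> z)"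
    using C by algebra
  finally have "a \<otimes> (u \<otimes> (a \<otimes> w \<oplus> c \<otimes> z) \<oplus> (b \<otimes> v) \<otimes> w) \<oplus> (b \<otimes> c) \<otimes> (v \<otimes> z) = \<one>" by simp
  moreover have "u \<otimes> (a \<otimes> w \<oplus> c \<otimes> z) \<oplus> (b \<otimes> v) \<otimes> w \<in> R" "v \<otimes> z \<in> R"
    using R uv(1,2) wz(1,2) R_closed(4,5) by simp_all
  ultimately show ?thesis by (rule comaximalI)
qed

lemma finsum_R_closed:
  assumes "finite A" "f \<in> A \<rightarrow> R"
  shows "(\<Oplus>j\<in>A. f j) \<in> R"
  using assms
proof (induction A rule: finite_induct)
  case (insert x A)
  then have "(\<Oplus>j\<in>insert x A. f j) = f x \<oplus> (\<Oplus>j\<in>A. f j)"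
    by (intro finsum_insert) (auto simp: R_carrier Pi_def)
  then show ?case using insert by (auto intro: R_closed(4))
qed (simp add: R_closed(1))

text \<open>The product of the \<open>x j\<close> serves as \<open>q\<close>; by
  \<open>comaximal_mult\<close> it stays comaximal to \<open>y\<close>.\<close>

lemma comaximal_clear_denominators:
  assumes "finite J" "y \<in> R" and J: "\<And>j. j \<in> J \<Longrightarrow> x j \<in> R \<and> x j \<noteq> \<zero> \<and> comaximal y (x j)"
  shows "\<exists>q\<in>R. comaximal y q \<and> (\<forall>j\<in>J. q \<otimes> inv (x j) \<in> R)"
  using assms(1) J
proof (induction J rule: finite_induct)
  case empty
  have "y \<otimes> \<zero> \<oplus> \<one> \<otimes> \<one> = \<one>" using assms(2) R_carrier by simp
  then show ?case using R_closed(1,2) unfolding comaximal_def by blast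
next
  case (insert i J)
  then obtain q where q: "q \<in> R" "comaximal y q" "\<forall>j\<in>J. q \<otimes> inv (x j) \<in> R" by blast
  have i: "x i \<in> R" "x i \<noteq> \<zero>" "comaximal y (x i)" using insert.prems by auto
  have "(q \<otimes> x i) \<otimes> inv (x j) \<in> R" if j: "j \<in> insert i J" for j
  proof -
    have xj: "x j \<in> R" "x j \<noteq> \<zero>" using j insert.prems by auto
    note ij = inv_nonzero(1,3)[OF R_carrier[OF xj(1)] xj(2)]
    show ?thesis
    proof (cases "j = i")
      case True
      then show ?thesis using ij q(1) R_carrier[OF q(1)] R_carrier[OF i(1)] by (simp add: m_assoc)
    next
      case False
      then have "x i \<otimes> (q \<otimes> inv (x j)) \<in> R" using j q i R_closed(5) by blast
      then show ?thesis using ij R_carrier[OF q(1)] R_carrier[OF i(1)] by (simp add: m_ac)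
    qed
  qed
  moreover have "comaximal y (q \<otimes> x i)" using comaximal_mult assms(2) q i by blast
  ultimately show ?case using R_closed(5) q(1) i(1) by blast
qed

text \<open>The defining property of a \<open>W\<^sub>n\<close>-set is applied to the inverses of the \<open>y i\<close>.\<close>

lemma W_set_comaximal:
  assumes W: "W_set n K R"
    and y: "\<And>i. i \<in> {1..n+1} \<Longrightarrow> y i \<in> R \<and> y i \<noteq> \<zero>"
    and comax: "\<And>i j. i \<in> {1..n+1} \<Longrightarrow> j \<in> {1..n+1} \<Longrightarrow> i \<noteq> j \<Longrightarrow> comaximal (y i) (y j)"
  shows "\<exists>i\<in>{1..n+1}. runit (y i)"
proof -
  have iy: "inv (y i) \<in> carrier K" "y i \<otimes> inv (y i) = \<one>" if "i \<in> {1..n+1}" for i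
    using inv_nonzero y[OF that] R_carrier by auto
  then have "(\<lambda>i. inv (y i)) \<in> {1..n+1} \<rightarrow> carrier K" by auto
  from W_setD[OF W this] obtain i s where i: "i \<in> {1..n+1}"
    and s: "s \<in> {1..n+1} - {i} \<rightarrow> R" "inv (y i) = (\<Oplus>j\<in>{1..n+1} - {i}. inv (y j) \<otimes> s j)"
    by blast
  \<comment> \<open>Multiplied by \<open>q\<close>, the right-hand side of the relation for
    \<open>inv (y i)\<close> lands in \<open>R\<close>, while \<open>q\<close> remains comaximal to
    \<open>y i\<close>.\<close>
  obtain q where q: "q \<in> R" "comaximal (y i) q" "\<forall>j\<in>{1..n+1} - {i}. q \<otimes> inv (y j) \<in> R"
    using comaximal_clear_denominators[of "{1..n+1} - {i}" "y i" y] y comax i by auto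
  have qs: "q \<otimes> (inv (y j) \<otimes> s j) \<in> R" if j: "j \<in> {1..n+1} - {i}" for j
  proof -
    have "s j \<in> R" using s j by auto
    then have "(q \<otimes> inv (y j)) \<otimes> s j \<in> R" using q(3) j R_closed(5) by blast
    then show ?thesis using \<open>s j \<in> R\<close> iy j R_carrier q(1) by (simp add: m_assoc)
  qed
  have "q \<otimes> inv (y i) = (\<Oplus>j\<in>{1..n+1} - {i}. q \<otimes> (inv (y j) \<otimes> s j))"
    unfolding s(2)
  proof (intro finsum_rdistr)
    show "(\<lambda>j. inv (y j) \<otimes> s j) \<in> {1..n+1} - {i} \<rightarrow> carrier K"
      using iy(1) s(1) R_carrier by (intro Pi_I m_closed) blast+
  qed (use R_carrier[OF q(1)] in auto)
  also have "\<dots> \<in> R" using qs by (intro finsum_R_closed) auto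
  finally have qR: "q \<otimes> inv (y i) \<in> R" .
  \<comment> \<open>Now \<open>y i\<close> divides \<open>q\<close> in \<open>R\<close> and is
    comaximal to it, hence is a unit: replace \<open>q\<close> by
    \<open>y i \<otimes> (q \<otimes> inv (y i))\<close> in the relation.\<close>
  obtain u v where uv: "u \<in> R" "v \<in> R" "y i \<otimes> u \<oplus> q \<otimes> v = \<one>"
    using q(2) by (auto simp: comaximal_def)
  have C: "y i \<in> carrier K" "q \<in> carrier K" "u \<in> carrier K" "v \<in> carrier K" "inv (y i) \<in> carrier K"
    using y[OF i] q uv R_carrier iy(1)[OF i] by auto
  have "y i \<otimes> (u \<oplus> (q \<otimes> inv (y i)) \<otimes> v) = y i \<otimes> u \<oplus> (y i \<otimes> inv (y i)) \<otimes> (q \<otimes> v)"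
    using C by algebra
  also have "\<dots> = \<one>" using uv iy(2)[OF i] C by simp
  finally have "y i \<otimes> (u \<oplus> (q \<otimes> inv (y i)) \<otimes> v) = \<one>" .
  moreover have "u \<oplus> (q \<otimes> inv (y i)) \<otimes> v \<in> R" using uv qR R_closed(4,5) by blast
  ultimately show ?thesis using i unfolding runit_def by blast
qed

text \<open>If every coset \<open>1 + a R\<close> with \<open>a \<noteq> 0\<close> contained a nonunit, one could choose nonunits
  \<open>y\<^sub>1, y\<^sub>2, \<dots>\<close> with \<open>y\<^sub>k \<equiv> 1\<close> modulo \<open>y\<^sub>1 \<cdots> y\<^bsub>k-1\<^esub>\<close>.\<close>

lemma exists_ideal_of_units:
  assumes W: "W_set n K R" and ne: "R \<noteq> carrier K"
  shows "\<exists>a\<in>R - {\<zero>}. \<forall>r\<in>R. runit (\<one> \<oplus> a \<otimes> r)"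
proof (rule ccontr)
  assume "\<not> ?thesis"
  then have nonunit: "\<exists>r\<in>R. \<not> runit (\<one> \<oplus> a \<otimes> r)" if "a \<in> R" "a \<noteq> \<zero>" for a using that by blast
  \<comment> \<open>Instead of the product only some common multiple \<open>a\<close> of the
    \<open>y i\<close> is remembered. It is kept a nonunit so that the next element
    \<open>\<one> \<oplus> a \<otimes> r\<close> cannot vanish.\<close>
  have "\<exists>y a. a \<in> R \<and> a \<noteq> \<zero> \<and> \<not> runit a \<and>
      (\<forall>i\<in>{1..k}. y i \<in> R \<and> y i \<noteq> \<zero> \<and> \<not> runit (y i) \<and> (\<exists>q\<in>R. a = y i \<otimes> q)) \<and>
      (\<forall>i\<in>{1..k}. \<forall>j\<in>{1..k}. i \<noteq> j \<longrightarrow> comaximal (y i) (y j))" for k :: nat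
  proof (induction k)
    case 0
    \<comment> \<open>A denominator of an element outside \<open>R\<close> is a nonzero
      nonunit.\<close>
    obtain w where w: "w \<in> carrier K" "w \<notin> R" using ne R_sub by blast
    obtain b where b: "b \<in> R" "b \<noteq> \<zero>" "b \<otimes> w \<in> R" using denominator[OF w(1)] by blast
    have "\<not> runit b"
    proof
      assume "runit b"
      then obtain u where u: "u \<in> R" "b \<otimes> u = \<one>" by (auto simp: runit_def)
      have "u \<otimes> (b \<otimes> w) = (b \<otimes> u) \<otimes> w"
        using R_carrier[OF b(1)] R_carrier[OF u(1)] w(1) by (simp add: m_ac)
      then have "w = u \<otimes> (b \<otimes> w)" using u w by simp
      then show False using w u b R_closed(5) by metis
    qed
    then show ?case using b by auto
  next
    case (Suc k)
    then obtain y a where a: "a \<in> R" "a \<noteq> \<zero>" "\<not> runit a"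
      and y: "\<And>i. i \<in> {1..k} \<Longrightarrow> y i \<in> R \<and> y i \<noteq> \<zero> \<and> \<not> runit (y i) \<and> (\<exists>q\<in>R. a = y i \<otimes> q)"
      and comax: "\<And>i j. i \<in> {1..k} \<Longrightarrow> j \<in> {1..k} \<Longrightarrow> i \<noteq> j \<Longrightarrow> comaximal (y i) (y j)"
      by blast
    obtain r where r: "r \<in> R" "\<not> runit (\<one> \<oplus> a \<otimes> r)" using nonunit a by blast
    define z where "z = \<one> \<oplus> a \<otimes> r"
    have zR: "z \<in> R" unfolding z_def using a r R_closed by blast
    have C: "a \<in> carrier K" "r \<in> carrier K" "z \<in> carrier K" using a r zR R_carrier by auto
    have z0: "z \<noteq> \<zero>"
    proof
      assume "z = \<zero>"
      have "a \<otimes> (\<ominus> r) = \<one> \<ominus> z" unfolding z_def using C by algebra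
      then have "a \<otimes> (\<ominus> r) = \<one>" unfolding \<open>z = \<zero>\<close> by (simp add: a_minus_def)
      then show False using a r R_closed(3) unfolding runit_def by blast
    qed
    have comax_z: "comaximal (y i) z" if i: "i \<in> {1..k}" for i
    proof -
      obtain q where q: "q \<in> R" "a = y i \<otimes> q" using y[OF i] by blast
      have C': "y i \<in> carrier K" "q \<in> carrier K" using y[OF i] q R_carrier by auto
      have "y i \<otimes> (\<ominus> (q \<otimes> r)) \<oplus> z \<otimes> \<one> = \<one>"
        unfolding z_def q(2) using C C' by algebra
      moreover have "\<ominus> (q \<otimes> r) \<in> R" using q r R_closed by blast
      ultimately show ?thesis using R_closed(2) by (rule comaximalI)
    qed
    define y' where "y' = y(Suc k := z)"
    have y'_old: "y' i = y i" if "i \<in> {1..k}" for i using that by (simp add: y'_def)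
    have y'_new: "y' (Suc k) = z" by (simp add: y'_def)
    have split: "{1..Suc k} = insert (Suc k) {1..k}" by auto
    show ?case
    proof (intro exI[of _ y'] exI[of _ "a \<otimes> z"] conjI ballI impI)
      show "a \<otimes> z \<in> R" using a zR R_closed(5) by blast
      show "a \<otimes> z \<noteq> \<zero>" using a z0 C integral by blast
      show "\<not> runit (a \<otimes> z)" using a zR runit_factor by blast
    next
      fix i assume i: "i \<in> {1..Suc k}"
      show "y' i \<in> R" "y' i \<noteq> \<zero>" "\<not> runit (y' i)"
        using i y zR z0 r(2) unfolding split by (auto simp: y'_old y'_new z_def)
      show "\<exists>q\<in>R. a \<otimes> z = y' i \<otimes> q"
      proof (cases "i = Suc k")
        case True
        then show ?thesis using a C y'_new m_comm by auto
      next
        case False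
        then have i: "i \<in> {1..k}" using i by auto
        then obtain q where q: "q \<in> R" "a = y i \<otimes> q" using y by blast
        then have "a \<otimes> z = y' i \<otimes> (q \<otimes> z)"
          using y[OF i] R_carrier C by (simp add: y'_old[OF i] m_assoc)
        then show ?thesis using q zR R_closed(5) by blast
      qed
    next
      fix i j assume ij: "i \<in> {1..Suc k}" "j \<in> {1..Suc k}" "i \<noteq> j"
      then consider "i \<in> {1..k}" "j \<in> {1..k}" | "i \<in> {1..k}" "j = Suc k" | "i = Suc k" "j \<in> {1..k}"
        unfolding split by blast
      then show "comaximal (y' i) (y' j)"
      proof cases
        case 1
        then show ?thesis using comax[OF 1 ij(3)] by (simp add: y'_old)
      next
        case 2
        then show ?thesis using comax_z[OF 2(1)] y'_old[OF 2(1)] y'_new by simp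
      next
        case 3
        have "comaximal z (y j)" using comaximal_sym[OF _ zR comax_z[OF 3(2)]] y[OF 3(2)] by blast
        then show ?thesis using 3(1) y'_old[OF 3(2)] y'_new by simp
      qed
    qed
  qed
  from this[of "n + 1"] obtain y where
    "\<And>i. i \<in> {1..n+1} \<Longrightarrow> y i \<in> R \<and> y i \<noteq> \<zero> \<and> \<not> runit (y i)"
    "\<And>i j. i \<in> {1..n+1} \<Longrightarrow> j \<in> {1..n+1} \<Longrightarrow> i \<noteq> j \<Longrightarrow> comaximal (y i) (y j)" by blast
  then show False using W_set_comaximal[OF W, of y] by blast
qed

text \<open>From \<open>(\<one> \<oplus> x) \<otimes> u = \<one>\<close> follows
  \<open>u = \<one> \<ominus> x \<otimes> u\<close>: the deviation of the inverse from
  \<open>\<one>\<close> is an \<open>R\<close>-multiple of \<open>x\<close>, hence small with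
  \<open>x\<close>.\<close>

lemma models_inverse_form_induced:
  assumes W: "W_set n K R" and ne: "R \<noteq> carrier K"
  shows "models K (induced_topology K R) inverse_form"
proof -
  interpret top: topological_field_ring K "induced_topology K R"
    using ring_topology_induced[OF ne] by unfold_locales
  obtain a where a: "a \<in> R" "a \<noteq> \<zero>" "\<And>r. r \<in> R \<Longrightarrow> runit (\<one> \<oplus> a \<otimes> r)"
    using exists_ideal_of_units[OF W ne] by blast
  show ?thesis
    unfolding top.models_inverse_form
  proof
    fix U assume "U \<in> top.nbhds"
    then obtain c where c: "c \<in> carrier K" "c \<noteq> \<zero>" "c <# R \<subseteq> U" by (auto simp: zero_nbhds_induced)
    note ic = inv_nonzero(1,3)[OF c(1,2)]
    have ac: "a \<in> carrier K" using a R_carrier by blast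
    \<comment> \<open>This makes \<open>a b R\<close> a subset of \<open>c R\<close>; the factor
      \<open>a\<close> keeps \<open>\<one> \<oplus> x\<close> a unit.\<close>
    obtain b where b: "b \<in> R" "b \<noteq> \<zero>" "b \<otimes> (inv c \<otimes> a) \<in> R"
      using denominator[of "inv c \<otimes> a"] ic ac by auto
    have bc: "b \<in> carrier K" using b R_carrier by blast
    have "\<exists>y\<in>U. (\<one> \<oplus> x) \<otimes> (\<one> \<oplus> y) = \<one>" if x: "x \<in> (a \<otimes> b) <# R" for x
    proof -
      obtain r where r: "r \<in> R" "x = (a \<otimes> b) \<otimes> r" using x by (auto simp: l_coset_def)
      have rc: "r \<in> carrier K" using r R_carrier by blast
      have xc: "x \<in> carrier K" using r ac bc rc by simp
      have "x = a \<otimes> (b \<otimes> r)" using r ac bc rc by (simp add: m_assoc)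
      then obtain u where u: "u \<in> R" "(\<one> \<oplus> x) \<otimes> u = \<one>"
        using a(3)[of "b \<otimes> r"] b r R_closed(5) by (auto simp: runit_def)
      have uc: "u \<in> carrier K" using u R_carrier by blast
      have "(\<one> \<oplus> x) \<otimes> (\<one> \<oplus> \<ominus> (x \<otimes> u)) = \<one> \<oplus> x \<ominus> x \<otimes> ((\<one> \<oplus> x) \<otimes> u)"
        using xc uc by algebra
      also have "\<dots> = \<one>" unfolding u(2) using xc by algebra
      finally have "(\<one> \<oplus> x) \<otimes> (\<one> \<oplus> \<ominus> (x \<otimes> u)) = \<one>" .
      moreover have "\<ominus> (x \<otimes> u) = c \<otimes> ((b \<otimes> (inv c \<otimes> a)) \<otimes> \<ominus> (r \<otimes> u))"
      proof -
        have "c \<otimes> ((b \<otimes> (inv c \<otimes> a)) \<otimes> \<ominus> (r \<otimes> u)) = (c \<otimes> inv c) \<otimes> \<ominus> (((a \<otimes> b) \<otimes> r) \<otimes> u)"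
          using c(1) ic(1) ac bc rc uc by algebra
        then show ?thesis using ic r xc uc by simp
      qed
      moreover have "(b \<otimes> (inv c \<otimes> a)) \<otimes> \<ominus> (r \<otimes> u) \<in> R" using b r u R_closed(3,5) by blast
      ultimately have "\<ominus> (x \<otimes> u) \<in> c <# R" unfolding l_coset_def by blast
      then show ?thesis using c(3) \<open>(\<one> \<oplus> x) \<otimes> (\<one> \<oplus> \<ominus> (x \<otimes> u)) = \<one>\<close> by blast
    qed
    moreover have "(a \<otimes> b) <# R \<in> top.nbhds"
      using a b ac bc integral by (intro l_coset_R_nbhd) auto
    ultimately show "\<exists>V\<in>top.nbhds. \<forall>x\<in>V. \<exists>y\<in>U. (\<one> \<oplus> x) \<otimes> (\<one> \<oplus> y) = \<one>" by blast
  qed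
qed

end

section \<open>Ultrapowers\<close>

text \<open>A minimal proper filter decides every \<open>P\<close>, since otherwise adjoining
  \<open>P\<close> would give a strictly smaller proper one. Zorn's lemma is applied to the reversed
  order.\<close>

lemma exists_ultrafilter_le:
  assumes "F0 \<noteq> bot"
  obtains F where "F \<le> F0" "F \<noteq> bot" "\<And>P. eventually P F \<or> eventually (\<lambda>t. \<not> P t) F"
proof -
  define A where "A = {F. F \<noteq> bot \<and> F \<le> F0}"
  have "\<exists>m\<in>A. \<forall>a\<in>A. a \<le> m \<longrightarrow> a = m"
  proof (rule predicate_Zorn[where P = "\<lambda>F G. G \<le> F"])
    show "partial_order_on A (relation_of (\<lambda>F G. G \<le> F) A)"
      by (rule partial_order_on_relation_ofI) auto
  next
    fix C assume C: "C \<in> Chains (relation_of (\<lambda>F G. G \<le> F) A)"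
    then have CA: "C \<subseteq> A" and lin: "\<And>F G. F \<in> C \<Longrightarrow> G \<in> C \<Longrightarrow> F \<le> G \<or> G \<le> F"
      by (auto simp: Chains_def relation_of_def)
    show "\<exists>u\<in>A. \<forall>a\<in>C. u \<le> a"
    proof (cases "C = {}")
      case True
      then show ?thesis using assms by (auto simp: A_def)
    next
      case False
      \<comment> \<open>A chain is directed downwards, so whatever holds eventually for
        \<open>Inf C\<close> already does so for a member of \<open>C\<close>.\<close>
      have "Inf C \<noteq> bot"
      proof
        assume "Inf C = bot"
        then have "eventually (\<lambda>_. False) (Inf C)" by simp
        moreover have "\<And>F G. F \<in> C \<Longrightarrow> G \<in> C \<Longrightarrow> \<exists>x\<in>C. x \<le> inf F G"
          using lin by (metis inf.absorb1 inf.absorb2 order_refl)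
        ultimately obtain F where "F \<in> C" "eventually (\<lambda>_. False) F"
          using eventually_Inf_base[OF False] by blast
        then show False using CA by (auto simp: A_def eventually_False)
      qed
      moreover have "Inf C \<le> F0" using False CA by (auto simp: A_def intro: Inf_lower2)
      ultimately show ?thesis using Inf_lower by (intro bexI[of _ "Inf C"]) (auto simp: A_def)
    qed
  qed
  then obtain F where F: "F \<noteq> bot" "F \<le> F0" and min: "\<And>G. G \<noteq> bot \<Longrightarrow> G \<le> F \<Longrightarrow> G = F"
    by (auto simp: A_def)
  have "eventually P F \<or> eventually (\<lambda>t. \<not> P t) F" for P
  proof (rule ccontr)
    assume *: "\<not> ?thesis"
    then have "inf F (principal {t. P t}) \<noteq> bot"
      by (auto simp: eventually_inf_principal simp flip: eventually_False)
    then have "inf F (principal {t. P t}) = F" using min by simp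
    moreover have "eventually P (inf F (principal {t. P t}))"
      by (simp add: eventually_inf_principal)
    ultimately show False using * by simp
  qed
  then show thesis using that F by blast
qed

section \<open>Ultrafilters on the natural numbers and connectives under
  \<open>eventually\<close>\<close>

locale ultrafilter =
  fixes F :: "nat filter"
  assumes not_bot: "F \<noteq> bot"
    and ultra: "eventually P F \<or> eventually (\<lambda>t. \<not> P t) F"
begin

lemma eventually_not_iff: "eventually (\<lambda>t. \<not> P t) F \<longleftrightarrow> \<not> eventually P F"
proof
  assume "eventually (\<lambda>t. \<not> P t) F"
  then show "\<not> eventually P F" using not_bot eventually_conj[of P F "\<lambda>t. \<not> P t"] by auto
qed (use ultra in blast)

lemma eventually_imp_iff:
  "eventually (\<lambda>t. P t \<longrightarrow> Q t) F \<longleftrightarrow> (eventually P F \<longrightarrow> eventually Q F)"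
proof
  assume r: "eventually P F \<longrightarrow> eventually Q F"
  show "eventually (\<lambda>t. P t \<longrightarrow> Q t) F"
  proof (cases "eventually P F")
    case True
    then show ?thesis using r by (auto elim: eventually_mono)
  next
    case False
    then have "eventually (\<lambda>t. \<not> P t) F" by (simp add: eventually_not_iff)
    then show ?thesis by (auto elim: eventually_mono)
  qed
qed (auto elim: eventually_elim2)

lemma eventually_disj_iff: "eventually (\<lambda>t. P t \<or> Q t) F \<longleftrightarrow> eventually P F \<or> eventually Q F"
  using eventually_imp_iff[of "\<lambda>t. \<not> P t" Q] by (simp add: eventually_not_iff disj_imp)

text \<open>Choose a counterexample in every coordinate that has one. This is the quantifier step of
  Los's theorem, for elements and for sets.\<close>

lemma eventually_ball_iff:
  assumes "A \<noteq> {}"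
  shows "eventually (\<lambda>t. \<forall>a\<in>A. P t a) F \<longleftrightarrow> (\<forall>f\<in>UNIV \<rightarrow> A. eventually (\<lambda>t. P t (f t)) F)"
proof
  assume r: "\<forall>f\<in>UNIV \<rightarrow> A. eventually (\<lambda>t. P t (f t)) F"
  have "\<exists>a\<in>A. (\<exists>b\<in>A. \<not> P t b) \<longrightarrow> \<not> P t a" for t using assms by blast
  then obtain f where f: "\<And>t. f t \<in> A" "\<And>t. (\<exists>b\<in>A. \<not> P t b) \<Longrightarrow> \<not> P t (f t)" by metis
  then have "eventually (\<lambda>t. P t (f t)) F" using r by blast
  then show "eventually (\<lambda>t. \<forall>a\<in>A. P t a) F" 
    by (rule eventually_mono) (use f(2) in blast)
next
  assume l: "eventually (\<lambda>t. \<forall>a\<in>A. P t a) F"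
  show "\<forall>f\<in>UNIV \<rightarrow> A. eventually (\<lambda>t. P t (f t)) F"
    by (intro ballI eventually_mono[OF l]) auto
qed

lemma eventually_bex_iff:
  assumes "A \<noteq> {}"
  shows "eventually (\<lambda>t. \<exists>a\<in>A. P t a) F \<longleftrightarrow> (\<exists>f\<in>UNIV \<rightarrow> A. eventually (\<lambda>t. P t (f t)) F)"
  using eventually_ball_iff[OF assms, of "\<lambda>t a. \<not> P t a"] eventually_not_iff[of "\<lambda>t. \<exists>a\<in>A. P t a"]
  by (simp add: eventually_not_iff) blast

text \<open>An ultrafilter selects one of finitely many alternatives. It later makes the index in
  the \<open>W_n\<close>-condition independent of the coordinate.\<close>

lemma eventually_finite_bex:
  assumes "finite A"
  shows "eventually (\<lambda>t. \<exists>a\<in>A. P t a) F \<longleftrightarrow> (\<exists>a\<in>A. eventually (\<lambda>t. P t a) F)"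
  using assms by (induction A) (auto simp: eventually_disj_iff not_bot)

end

section \<open>The ultrapower field\<close>

locale ultrapower = field K + ultrafilter F
  for K :: "('a, 'm) ring_scheme" (structure) and F
begin

definition germ :: "(nat \<Rightarrow> 'a) \<Rightarrow> (nat \<Rightarrow> 'a) set" where
  "germ f = {g \<in> UNIV \<rightarrow> carrier K. eventually (\<lambda>t. g t = f t) F}"

definition rep :: "(nat \<Rightarrow> 'a) set \<Rightarrow> nat \<Rightarrow> 'a" where
  "rep A = (SOME f. f \<in> A)"

text \<open>The elements are equivalence classes, so the operations go through chosen
  representatives; \<open>upower_mult\<close> and \<open>upower_add\<close> remove the
  choice.\<close>

definition upower :: "(nat \<Rightarrow> 'a) set ring" where
  "upower = \<lparr>carrier = germ ` (UNIV \<rightarrow> carrier K),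
     mult = (\<lambda>A B. germ (\<lambda>t. rep A t \<otimes> rep B t)), one = germ (\<lambda>t. \<one>),
     ring.zero = germ (\<lambda>t. \<zero>), add = (\<lambda>A B. germ (\<lambda>t. rep A t \<oplus> rep B t))\<rparr>"

lemma germ_eq_iff:
  assumes "f \<in> UNIV \<rightarrow> carrier K"
  shows "germ f = germ g \<longleftrightarrow> eventually (\<lambda>t. f t = g t) F"
proof
  assume "germ f = germ g"
  moreover have "f \<in> germ f" using assms by (simp add: germ_def)
  ultimately show "eventually (\<lambda>t. f t = g t) F" by (simp add: germ_def)
next
  assume "eventually (\<lambda>t. f t = g t) F"
  then show "germ f = germ g" unfolding germ_def by (auto elim: eventually_elim2)
qed

lemma rep_germ:
  assumes "f \<in> UNIV \<rightarrow> carrier K"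
  shows "eventually (\<lambda>t. rep (germ f) t = f t) F"
proof -
  have "f \<in> germ f" using assms by (simp add: germ_def)
  then have "rep (germ f) \<in> germ f" unfolding rep_def by (rule someI[of "\<lambda>g. g \<in> germ f"])
  then show ?thesis by (simp add: germ_def)
qed

lemma germ_cong: "eventually (\<lambda>t. f t = g t) F \<Longrightarrow> germ f = germ g"
  unfolding germ_def by (auto elim: eventually_elim2)

lemma upower_mult:
  assumes "f \<in> UNIV \<rightarrow> carrier K" "g \<in> UNIV \<rightarrow> carrier K"
  shows "germ f \<otimes>\<^bsub>upower\<^esub> germ g = germ (\<lambda>t. f t \<otimes> g t)"
proof -
  have "eventually (\<lambda>t. rep (germ f) t \<otimes> rep (germ g) t = f t \<otimes> g t) F"
    using rep_germ[OF assms(1)] rep_germ[OF assms(2)] by eventually_elim simp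
  then show ?thesis by (simp add: upower_def germ_cong)
qed

lemma upower_add:
  assumes "f \<in> UNIV \<rightarrow> carrier K" "g \<in> UNIV \<rightarrow> carrier K"
  shows "germ f \<oplus>\<^bsub>upower\<^esub> germ g = germ (\<lambda>t. f t \<oplus> g t)"
proof -
  have "eventually (\<lambda>t. rep (germ f) t \<oplus> rep (germ g) t = f t \<oplus> g t) F"
    using rep_germ[OF assms(1)] rep_germ[OF assms(2)] by eventually_elim simp
  then show ?thesis by (simp add: upower_def germ_cong)
qed

lemma upower_zero: "\<zero>\<^bsub>upower\<^esub> = germ (\<lambda>t. \<zero>)"
  and upower_one: "\<one>\<^bsub>upower\<^esub> = germ (\<lambda>t. \<one>)"
  and upower_carrier: "carrier upower = germ ` (UNIV \<rightarrow> carrier K)"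
  by (simp_all add: upower_def)

lemma germ_carrier: "f \<in> UNIV \<rightarrow> carrier K \<Longrightarrow> germ f \<in> carrier upower"
  by (simp add: upower_carrier)

lemma carrierE:
  assumes "x \<in> carrier upower"
  obtains f where "f \<in> UNIV \<rightarrow> carrier K" "x = germ f"
  using assms by (auto simp: upower_carrier)

lemma upower_field: "field upower"
proof -
  have "cring upower"
  proof (intro cringI abelian_groupI comm_monoidI)
    show "\<zero>\<^bsub>upower\<^esub> \<in> carrier upower" "\<one>\<^bsub>upower\<^esub> \<in> carrier upower"
      by (auto simp: upower_zero upower_one intro!: germ_carrier)
  next
    fix x y assume "x \<in> carrier upower" "y \<in> carrier upower"
    then obtain f g where *: "f \<in> UNIV \<rightarrow> carrier K" "x = germ f" "g \<in> UNIV \<rightarrow> carrier K" "y = germ g"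
      by (metis carrierE)
    then show "x \<oplus>\<^bsub>upower\<^esub> y \<in> carrier upower" "x \<otimes>\<^bsub>upower\<^esub> y \<in> carrier upower"
      by (auto simp: upower_add upower_mult Pi_def intro!: germ_carrier)
    show "x \<oplus>\<^bsub>upower\<^esub> y = y \<oplus>\<^bsub>upower\<^esub> x" "x \<otimes>\<^bsub>upower\<^esub> y = y \<otimes>\<^bsub>upower\<^esub> x"
      using * by (auto simp: upower_add upower_mult Pi_def a_comm m_comm)
  next
    fix x y z assume "x \<in> carrier upower" "y \<in> carrier upower" "z \<in> carrier upower"
    then obtain f g h where *: "f \<in> UNIV \<rightarrow> carrier K" "x = germ f" "g \<in> UNIV \<rightarrow> carrier K" "y = germ g"
      "h \<in> UNIV \<rightarrow> carrier K" "z = germ h"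
      by (metis carrierE)
    then show "(x \<oplus>\<^bsub>upower\<^esub> y) \<oplus>\<^bsub>upower\<^esub> z = x \<oplus>\<^bsub>upower\<^esub> (y \<oplus>\<^bsub>upower\<^esub> z)"
      "(x \<otimes>\<^bsub>upower\<^esub> y) \<otimes>\<^bsub>upower\<^esub> z = x \<otimes>\<^bsub>upower\<^esub> (y \<otimes>\<^bsub>upower\<^esub> z)"
      "(x \<oplus>\<^bsub>upower\<^esub> y) \<otimes>\<^bsub>upower\<^esub> z = x \<otimes>\<^bsub>upower\<^esub> z \<oplus>\<^bsub>upower\<^esub> y \<otimes>\<^bsub>upower\<^esub> z"
      by (auto simp: upower_add upower_mult Pi_def a_assoc m_assoc l_distr)
  next
    fix x assume "x \<in> carrier upower"
    then obtain f where *: "f \<in> UNIV \<rightarrow> carrier K" "x = germ f" by (metis carrierE)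
    then show "\<zero>\<^bsub>upower\<^esub> \<oplus>\<^bsub>upower\<^esub> x = x" "\<one>\<^bsub>upower\<^esub> \<otimes>\<^bsub>upower\<^esub> x = x"
      by (auto simp: upower_zero upower_one upower_add upower_mult Pi_def)
    show "\<exists>y\<in>carrier upower. y \<oplus>\<^bsub>upower\<^esub> x = \<zero>\<^bsub>upower\<^esub>"
      using * by (intro bexI[of _ "germ (\<lambda>t. \<ominus> f t)"])
        (auto simp: upower_zero upower_add Pi_def l_neg intro!: germ_carrier)
  qed
  then show ?thesis
  proof (rule cring.cring_fieldI2)
    show "\<zero>\<^bsub>upower\<^esub> \<noteq> \<one>\<^bsub>upower\<^esub>"
      by (simp add: upower_zero upower_one germ_eq_iff not_bot)
  next
    fix x assume x: "x \<in> carrier upower" "x \<noteq> \<zero>\<^bsub>upower\<^esub>"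
    then obtain f where f: "f \<in> UNIV \<rightarrow> carrier K" "x = germ f" by (metis carrierE)
    \<comment> \<open>The inverse is taken coordinatewise; the value where \<open>f\<close> vanishes
      is irrelevant, since this happens in a negligible set of coordinates.\<close>
    define g where "g = (\<lambda>t. if f t = \<zero> then \<zero> else inv (f t))"
    have g: "g \<in> UNIV \<rightarrow> carrier K" using f by (auto simp: g_def field_Units Pi_def)
    have "eventually (\<lambda>t. f t \<noteq> \<zero>) F"
      using x f germ_eq_iff[OF f(1), of "\<lambda>t. \<zero>"] by (simp add: upower_zero eventually_not_iff)
    then have "eventually (\<lambda>t. f t \<otimes> g t = \<one>) F"
      using f by (auto simp: g_def field_Units Pi_def elim!: eventually_mono)
    then have "x \<otimes>\<^bsub>upower\<^esub> germ g = \<one>\<^bsub>upower\<^esub>"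
      using f g by (simp add: upower_mult upower_one germ_cong)
    then show "\<exists>y\<in>carrier upower. x \<otimes>\<^bsub>upower\<^esub> y = \<one>\<^bsub>upower\<^esub>" using g germ_carrier by blast
  qed
qed

sublocale UP: field upower
  by (rule upower_field)

lemma upower_neg:
  assumes "f \<in> UNIV \<rightarrow> carrier K"
  shows "\<ominus>\<^bsub>upower\<^esub> germ f = germ (\<lambda>t. \<ominus> f t)"
proof (rule UP.minus_equality)
  show "germ (\<lambda>t. \<ominus> f t) \<oplus>\<^bsub>upower\<^esub> germ f = \<zero>\<^bsub>upower\<^esub>"
    using assms by (simp add: upower_add upower_zero Pi_def l_neg)
qed (use assms in \<open>auto intro!: germ_carrier\<close>)

lemma upower_minus:
  assumes "f \<in> UNIV \<rightarrow> carrier K" "g \<in> UNIV \<rightarrow> carrier K"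
  shows "germ f \<ominus>\<^bsub>upower\<^esub> germ g = germ (\<lambda>t. f t \<ominus> g t)"
  unfolding a_minus_def upower_neg[OF assms(2)] using assms by (subst upower_add) auto

lemma upower_finsum:
  assumes "finite A" "\<And>j. j \<in> A \<Longrightarrow> f j \<in> UNIV \<rightarrow> carrier K"
  shows "(\<Oplus>\<^bsub>upower\<^esub>j\<in>A. germ (f j)) = germ (\<lambda>t. \<Oplus>j\<in>A. f j t)"
  using assms
proof (induction A rule: finite_induct)
  case (insert a A)
  have 1: "f a \<in> UNIV \<rightarrow> carrier K" "(\<lambda>t. \<Oplus>j\<in>A. f j t) \<in> UNIV \<rightarrow> carrier K"
    using insert.prems by (auto intro!: finsum_closed simp: Pi_def)
  have "(\<Oplus>\<^bsub>upower\<^esub>j\<in>insert a A. germ (f j)) = germ (f a) \<oplus>\<^bsub>upower\<^esub> (\<Oplus>\<^bsub>upower\<^esub>j\<in>A. germ (f j))"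
    using insert.hyps insert.prems by (intro UP.finsum_insert) (auto intro!: germ_carrier)
  also have "\<dots> = germ (\<lambda>t. f a t \<oplus> (\<Oplus>j\<in>A. f j t))"
    using insert upower_add[OF 1] by simp
  also have "(\<lambda>t. f a t \<oplus> (\<Oplus>j\<in>A. f j t)) = (\<lambda>t. \<Oplus>j\<in>insert a A. f j t)"
  proof
    fix t
    show "f a t \<oplus> (\<Oplus>j\<in>A. f j t) = (\<Oplus>j\<in>insert a A. f j t)"
      using insert.hyps insert.prems by (intro finsum_insert[symmetric]) (auto simp: Pi_def)
  qed
  finally show ?case .
qed (simp add: upower_zero)

section \<open>Internal sets, that is, ultraproducts of sequences of sets, and Los's theorem\<close>

definition star :: "(nat \<Rightarrow> 'a set) \<Rightarrow> (nat \<Rightarrow> 'a) set set" where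
  "star S = germ ` {f \<in> UNIV \<rightarrow> carrier K. eventually (\<lambda>t. f t \<in> S t) F}"

lemma germ_mem_star:
  assumes "f \<in> UNIV \<rightarrow> carrier K"
  shows "germ f \<in> star S \<longleftrightarrow> eventually (\<lambda>t. f t \<in> S t) F"
proof
  assume "germ f \<in> star S"
  then obtain g where g: "eventually (\<lambda>t. g t \<in> S t) F" "germ f = germ g"
    by (auto simp: star_def)
  have "eventually (\<lambda>t. f t = g t) F" using g(2) germ_eq_iff[OF assms] by simp
  then show "eventually (\<lambda>t. f t \<in> S t) F" using g(1) by eventually_elim simp
qed (use assms in \<open>auto simp: star_def\<close>)

lemma star_carrier: "star S \<subseteq> carrier upower"
  by (auto simp: star_def intro: germ_carrier)

lemma eval_term_upower:
  assumes "\<And>x. e x \<in> UNIV \<rightarrow> carrier K"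
  shows "(\<lambda>t. eval_term K (\<lambda>x. e x t) u) \<in> UNIV \<rightarrow> carrier K \<and>
    eval_term upower (\<lambda>x. germ (e x)) u = germ (\<lambda>t. eval_term K (\<lambda>x. e x t) u)"
proof (induction u)
  case (Var x)
  then show ?case using assms[of x] by auto
qed (auto simp: upower_zero upower_one upower_add upower_mult upower_neg Pi_def)

lemma germ_fun_upd: "(\<lambda>y. germ (e y))(x := germ f) = (\<lambda>y. germ ((e(x := f)) y))"
  by (rule ext) simp

text \<open>Los's theorem for all formulas, local or not, with internal sets as the second sort.
  Sets occur only in membership atoms, so it does not matter that \<open>star\<close> is not
  injective.\<close>

lemma sat_upower:
  assumes "\<tau> \<noteq> {}" "\<And>x. e x \<in> UNIV \<rightarrow> carrier K"
  shows "sat upower (star ` (UNIV \<rightarrow> \<tau>)) (\<lambda>x. germ (e x)) (\<lambda>V. star (s V)) f \<longleftrightarrow>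
    eventually (\<lambda>t. sat K \<tau> (\<lambda>x. e x t) (\<lambda>V. s V t) f) F"
  using assms(2)
proof (induction f arbitrary: e s)
  case (Eq t u)
  then show ?case using eval_term_upower[OF Eq] by (simp add: germ_eq_iff)
next
  case (Mem t V)
  then show ?case using eval_term_upower[OF Mem] by (simp add: germ_mem_star)
next
  case (AllElt x f)
  have "sat upower (star ` (UNIV \<rightarrow> \<tau>)) (\<lambda>x. germ (e x)) (\<lambda>V. star (s V)) (AllElt x f) \<longleftrightarrow>
    (\<forall>h\<in>UNIV \<rightarrow> carrier K. sat upower (star ` (UNIV \<rightarrow> \<tau>)) (\<lambda>y. germ ((e(x := h)) y)) (\<lambda>V. star (s V)) f)"
    unfolding sat.simps upower_carrier germ_fun_upd[symmetric] by blast
  also have "\<dots> \<longleftrightarrow> (\<forall>h\<in>UNIV \<rightarrow> carrier K.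
      eventually (\<lambda>t. sat K \<tau> (\<lambda>y. (e(x := h)) y t) (\<lambda>V. s V t) f) F)"
    by (intro ball_cong refl AllElt.IH) (use AllElt.prems in auto)
  also have "\<dots> \<longleftrightarrow> (\<forall>h\<in>UNIV \<rightarrow> carrier K.
      eventually (\<lambda>t. sat K \<tau> ((\<lambda>y. e y t)(x := h t)) (\<lambda>V. s V t) f) F)"
    by (simp add: fun_upd_def if_distrib[of "\<lambda>h. h _"])
  also have "\<dots> \<longleftrightarrow> eventually (\<lambda>t. \<forall>a\<in>carrier K. sat K \<tau> ((\<lambda>y. e y t)(x := a)) (\<lambda>V. s V t) f) F"
    by (rule eventually_ball_iff[symmetric]) auto
  finally show ?case by simp
next
  case (ExElt x f)
  have "sat upower (star ` (UNIV \<rightarrow> \<tau>)) (\<lambda>x. germ (e x)) (\<lambda>V. star (s V)) (ExElt x f) \<longleftrightarrow>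
    (\<exists>h\<in>UNIV \<rightarrow> carrier K. sat upower (star ` (UNIV \<rightarrow> \<tau>)) (\<lambda>y. germ ((e(x := h)) y)) (\<lambda>V. star (s V)) f)"
    unfolding sat.simps upower_carrier germ_fun_upd[symmetric] by blast
  also have "\<dots> \<longleftrightarrow> (\<exists>h\<in>UNIV \<rightarrow> carrier K.
      eventually (\<lambda>t. sat K \<tau> (\<lambda>y. (e(x := h)) y t) (\<lambda>V. s V t) f) F)"
    by (intro bex_cong refl ExElt.IH) (use ExElt.prems in auto)
  also have "\<dots> \<longleftrightarrow> (\<exists>h\<in>UNIV \<rightarrow> carrier K.
      eventually (\<lambda>t. sat K \<tau> ((\<lambda>y. e y t)(x := h t)) (\<lambda>V. s V t) f) F)"
    by (simp add: fun_upd_def if_distrib[of "\<lambda>h. h _"])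
  also have "\<dots> \<longleftrightarrow> eventually (\<lambda>t. \<exists>a\<in>carrier K. sat K \<tau> ((\<lambda>y. e y t)(x := a)) (\<lambda>V. s V t) f) F"
    by (rule eventually_bex_iff[symmetric]) auto
  finally show ?case by simp
next
  case (AllSet V f)
  have star_upd: "(\<lambda>W. star (s W))(V := star h) = (\<lambda>W. star ((s(V := h)) W))" for h
    by (rule ext) simp
  have "sat upower (star ` (UNIV \<rightarrow> \<tau>)) (\<lambda>x. germ (e x)) (\<lambda>V. star (s V)) (AllSet V f) \<longleftrightarrow>
    (\<forall>h\<in>UNIV \<rightarrow> \<tau>. sat upower (star ` (UNIV \<rightarrow> \<tau>)) (\<lambda>y. germ (e y)) (\<lambda>W. star ((s(V := h)) W)) f)"
    unfolding sat.simps star_upd[symmetric] by blast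
  also have "\<dots> \<longleftrightarrow> (\<forall>h\<in>UNIV \<rightarrow> \<tau>.
      eventually (\<lambda>t. sat K \<tau> (\<lambda>y. e y t) (\<lambda>W. (s(V := h)) W t) f) F)"
    by (intro ball_cong refl AllSet.IH) (use AllSet.prems in auto)
  also have "\<dots> \<longleftrightarrow> (\<forall>h\<in>UNIV \<rightarrow> \<tau>.
      eventually (\<lambda>t. sat K \<tau> (\<lambda>y. e y t) ((\<lambda>W. s W t)(V := h t)) f) F)"
    by (simp add: fun_upd_def if_distrib[of "\<lambda>h. h _"])
  also have "\<dots> \<longleftrightarrow> eventually (\<lambda>t. \<forall>U\<in>\<tau>. sat K \<tau> (\<lambda>y. e y t) ((\<lambda>W. s W t)(V := U)) f) F"
    using assms(1) by (rule eventually_ball_iff[symmetric])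
  finally show ?case by simp
next
  case (ExSet V f)
  have star_upd: "(\<lambda>W. star (s W))(V := star h) = (\<lambda>W. star ((s(V := h)) W))" for h
    by (rule ext) simp
  have "sat upower (star ` (UNIV \<rightarrow> \<tau>)) (\<lambda>x. germ (e x)) (\<lambda>V. star (s V)) (ExSet V f) \<longleftrightarrow>
    (\<exists>h\<in>UNIV \<rightarrow> \<tau>. sat upower (star ` (UNIV \<rightarrow> \<tau>)) (\<lambda>y. germ (e y)) (\<lambda>W. star ((s(V := h)) W)) f)"
    unfolding sat.simps star_upd[symmetric] by blast
  also have "\<dots> \<longleftrightarrow> (\<exists>h\<in>UNIV \<rightarrow> \<tau>.
      eventually (\<lambda>t. sat K \<tau> (\<lambda>y. e y t) (\<lambda>W. (s(V := h)) W t) f) F)"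
    by (intro bex_cong refl ExSet.IH) (use ExSet.prems in auto)
  also have "\<dots> \<longleftrightarrow> (\<exists>h\<in>UNIV \<rightarrow> \<tau>.
      eventually (\<lambda>t. sat K \<tau> (\<lambda>y. e y t) ((\<lambda>W. s W t)(V := h t)) f) F)"
    by (simp add: fun_upd_def if_distrib[of "\<lambda>h. h _"])
  also have "\<dots> \<longleftrightarrow> eventually (\<lambda>t. \<exists>U\<in>\<tau>. sat K \<tau> (\<lambda>y. e y t) ((\<lambda>W. s W t)(V := U)) f) F"
    using assms(1) by (rule eventually_bex_iff[symmetric])
  finally show ?case by simp
qed (simp_all add: eventually_not_iff eventually_conj_iff eventually_disj_iff eventually_imp_iff)

end

section \<open>The $W_n$-ring of an ultrapower\<close>

text \<open>\<open>F \<le> sequentially\<close> makes the ultrafilter nonprincipal: for fixed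
  \<open>k\<close> almost all coordinates \<open>t\<close> satisfy \<open>k \<le> t\<close>.\<close>

locale topological_ultrapower = topological_field_ring K T + ultrapower K F
  for K :: "('a, 'm) ring_scheme" (structure) and T F +
  fixes n :: nat and S0 :: "'a set"
  assumes F_le: "F \<le> sequentially"
    and S0_nbhd: "S0 \<in> nbhds" and S0_bounded: "bounded S0"
    and S0_one: "\<one> \<in> S0" and S0_W_set: "W_set n K S0"
begin

text \<open>The step is written as a difference of two product sets so that
  \<open>bounded_mult\<close> and \<open>bounded_diff\<close> apply literally.\<close>

primrec stage :: "nat \<Rightarrow> 'a set" where
  "stage 0 = S0"
| "stage (Suc k) = {u \<ominus> v | u v. u \<in> {x \<otimes> y | x y. x \<in> stage k \<and> y \<in> stage k} \<and>
     v \<in> {x \<otimes> y | x y. x \<in> stage k \<and> y \<in> stage k}}"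

declare stage.simps(2) [simp del]

lemma stage_bounded: "bounded (stage k)"
  by (induction k) (simp_all only: stage.simps S0_bounded bounded_mult bounded_diff)

lemma stage_carrier: "x \<in> stage k \<Longrightarrow> x \<in> carrier K"
  using bounded_sub[OF stage_bounded] by blast

lemma stage_SucI:
  assumes "x \<in> stage k" "y \<in> stage k" "z \<in> stage k" "w \<in> stage k"
  shows "x \<otimes> y \<ominus> z \<otimes> w \<in> stage (Suc k)"
  using assms unfolding stage.simps by blast

lemma stage_zero_one: "\<zero> \<in> stage k \<and> \<one> \<in> stage k"
proof (induction k)
  case 0
  then show ?case using S0_one nbhds_zero[OF S0_nbhd] by simp
next
  case (Suc k)
  have eq: "\<zero> \<otimes> \<zero> \<ominus> \<zero> \<otimes> \<zero> = \<zero>" "\<one> \<otimes> \<one> \<ominus> \<zero> \<otimes> \<zero> = \<one>" by (simp_all add: a_minus_def)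
  have "\<zero> \<in> stage k" "\<one> \<in> stage k" using Suc by auto
  then show ?case
    using stage_SucI[of \<zero> k \<zero> \<zero> \<zero>] stage_SucI[of \<one> k \<one> \<zero> \<zero>] unfolding eq by simp
qed

lemma stage_mult:
  assumes "x \<in> stage k" "y \<in> stage k"
  shows "x \<otimes> y \<in> stage (Suc k)"
proof -
  have eq: "x \<otimes> y \<ominus> \<zero> \<otimes> \<zero> = x \<otimes> y" using assms[THEN stage_carrier] by algebra
  show ?thesis using stage_SucI[OF assms, of \<zero> \<zero>] stage_zero_one unfolding eq by blast
qed

lemma stage_diff:
  assumes "x \<in> stage k" "y \<in> stage k"
  shows "x \<ominus> y \<in> stage (Suc k)"
proof -
  have eq: "x \<otimes> \<one> \<ominus> y \<otimes> \<one> = x \<ominus> y" using assms[THEN stage_carrier] by simp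
  show ?thesis using stage_SucI[of x k \<one> y \<one>] assms stage_zero_one unfolding eq by blast
qed

lemma stage_mono: "k \<le> l \<Longrightarrow> stage k \<subseteq> stage l"
proof (rule lift_Suc_mono_le[of stage])
  show "stage m \<subseteq> stage (Suc m)" for m
  proof
    fix x assume x: "x \<in> stage m"
    then have "x \<otimes> \<one> \<in> stage (Suc m)" using stage_mult stage_zero_one by blast
    then show "x \<in> stage (Suc m)" using stage_carrier[OF x] by simp
  qed
qed

section \<open>The limit ring is a proper \<open>W_n\<close>-ring of the ultrapower\<close>

definition limit_ring :: "(nat \<Rightarrow> 'a) set set" where
  "limit_ring = (\<Union>k. star (\<lambda>t. stage k))"

lemma limit_ringE:
  assumes "x \<in> limit_ring"
  obtains f k where "f \<in> UNIV \<rightarrow> carrier K" "x = germ f" "eventually (\<lambda>t. f t \<in> stage k) F"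
  using assms by (auto simp: limit_ring_def star_def)

lemma germ_limit_ringI:
  assumes "f \<in> UNIV \<rightarrow> carrier K" "eventually (\<lambda>t. f t \<in> stage k) F"
  shows "germ f \<in> limit_ring"
  using assms germ_mem_star[OF assms(1), of "\<lambda>t. stage k"] by (auto simp: limit_ring_def)

lemma limit_ringE2:
  assumes "x \<in> limit_ring" "y \<in> limit_ring"
  obtains f g k where "f \<in> UNIV \<rightarrow> carrier K" "x = germ f" "g \<in> UNIV \<rightarrow> carrier K" "y = germ g"
    "eventually (\<lambda>t. f t \<in> stage k \<and> g t \<in> stage k) F"
proof -
  obtain f k where f: "f \<in> UNIV \<rightarrow> carrier K" "x = germ f" "eventually (\<lambda>t. f t \<in> stage k) F"
    using limit_ringE[OF assms(1)] by blast
  obtain g l where g: "g \<in> UNIV \<rightarrow> carrier K" "y = germ g" "eventually (\<lambda>t. g t \<in> stage l) F"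
    using limit_ringE[OF assms(2)] by blast
  have sub: "stage k \<subseteq> stage (max k l)" "stage l \<subseteq> stage (max k l)" by (simp_all add: stage_mono)
  have "eventually (\<lambda>t. f t \<in> stage (max k l) \<and> g t \<in> stage (max k l)) F"
    using f(3) g(3) by eventually_elim (use sub in blast)
  then show thesis using that f g by blast
qed

lemma limit_ring_carrier: "limit_ring \<subseteq> carrier upower"
  using star_carrier by (auto simp: limit_ring_def)

lemma limit_ring_mult:
  assumes "x \<in> limit_ring" "y \<in> limit_ring"
  shows "x \<otimes>\<^bsub>upower\<^esub> y \<in> limit_ring"
proof -
  obtain f g k where fg: "f \<in> UNIV \<rightarrow> carrier K" "x = germ f" "g \<in> UNIV \<rightarrow> carrier K" "y = germ g"
    and k: "eventually (\<lambda>t. f t \<in> stage k \<and> g t \<in> stage k) F"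
    by (rule limit_ringE2[OF assms])
  have "eventually (\<lambda>t. f t \<otimes> g t \<in> stage (Suc k)) F"
    using k by (rule eventually_mono) (elim conjE, rule stage_mult)
  moreover have "(\<lambda>t. f t \<otimes> g t) \<in> UNIV \<rightarrow> carrier K" using fg by auto
  ultimately have "germ (\<lambda>t. f t \<otimes> g t) \<in> limit_ring" by (intro germ_limit_ringI)
  then show ?thesis using fg by (simp add: upower_mult)
qed

lemma limit_ring_diff:
  assumes "x \<in> limit_ring" "y \<in> limit_ring"
  shows "x \<ominus>\<^bsub>upower\<^esub> y \<in> limit_ring"
proof -
  obtain f g k where fg: "f \<in> UNIV \<rightarrow> carrier K" "x = germ f" "g \<in> UNIV \<rightarrow> carrier K" "y = germ g"
    and k: "eventually (\<lambda>t. f t \<in> stage k \<and> g t \<in> stage k) F"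
    by (rule limit_ringE2[OF assms])
  have "eventually (\<lambda>t. f t \<ominus> g t \<in> stage (Suc k)) F"
    using k by (rule eventually_mono) (elim conjE, rule stage_diff)
  moreover have "(\<lambda>t. f t \<ominus> g t) \<in> UNIV \<rightarrow> carrier K" using fg by auto
  ultimately have "germ (\<lambda>t. f t \<ominus> g t) \<in> limit_ring" by (intro germ_limit_ringI)
  then show ?thesis using fg by (simp add: upower_minus)
qed

lemma limit_ring_one: "\<one>\<^bsub>upower\<^esub> \<in> limit_ring"
  and limit_ring_zero: "\<zero>\<^bsub>upower\<^esub> \<in> limit_ring"
  unfolding upower_one upower_zero using stage_zero_one
  by (auto intro!: germ_limit_ringI[where k = 0] always_eventually)

text \<open>Products and differences lie one stage higher, which the union absorbs; negatives and
  sums are expressed through differences.\<close>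

lemma limit_ring_subring: "subring limit_ring upower"
proof (rule UP.subringI)
  have neg: "\<ominus>\<^bsub>upower\<^esub> x \<in> limit_ring" if "x \<in> limit_ring" for x
  proof -
    have "\<ominus>\<^bsub>upower\<^esub> x = \<zero>\<^bsub>upower\<^esub> \<ominus>\<^bsub>upower\<^esub> x"
      using that limit_ring_carrier by (simp add: a_minus_def subset_iff)
    then show ?thesis using limit_ring_diff[OF limit_ring_zero that] by simp
  qed
  then show "\<ominus>\<^bsub>upower\<^esub> x \<in> limit_ring" if "x \<in> limit_ring" for x using that .
  show "x \<oplus>\<^bsub>upower\<^esub> y \<in> limit_ring" if "x \<in> limit_ring" "y \<in> limit_ring" for x y
  proof -
    have "x \<oplus>\<^bsub>upower\<^esub> y = x \<ominus>\<^bsub>upower\<^esub> (\<ominus>\<^bsub>upower\<^esub> y)"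
      using that limit_ring_carrier by (simp add: a_minus_def subset_iff)
    then show ?thesis using limit_ring_diff[OF that(1) neg[OF that(2)]] by simp
  qed
qed (use limit_ring_carrier limit_ring_one limit_ring_mult in auto)

text \<open>In each coordinate the elements \<open>b\<close> of \<open>S0\<close> with
  \<open>f t \<otimes> b \<in> S0\<close> form a neighbourhood, which contains a nonzero
  denominator. Numerator and denominator then already lie in stage 0.\<close>

lemma limit_ring_fractions: "fractions upower limit_ring = carrier upower"
proof
  have "inv\<^bsub>upower\<^esub> b \<in> carrier upower" if "b \<in> limit_ring - {\<zero>\<^bsub>upower\<^esub>}" for b
    using that limit_ring_carrier by (intro UP.Units_inv_closed) (auto simp: UP.field_Units)
  then show "fractions upower limit_ring \<subseteq> carrier upower"
    using limit_ring_carrier by (auto simp: fractions_def subset_iff)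
  show "carrier upower \<subseteq> fractions upower limit_ring"
  proof
    fix x assume x: "x \<in> carrier upower"
    then obtain f where f: "f \<in> UNIV \<rightarrow> carrier K" "x = germ f" using carrierE by blast
    have "\<exists>b\<in>S0 - {\<zero>}. f t \<otimes> b \<in> S0" for t
    proof -
      have ft: "f t \<in> carrier K" using f by auto
      have "S0 \<inter> {b \<in> carrier K. f t \<otimes> b \<in> S0} \<in> nbhds"
        using nbhds_Int[OF S0_nbhd nbhds_scale_vimage[OF S0_nbhd ft]] .
      then obtain b where "b \<in> S0 \<inter> {b \<in> carrier K. f t \<otimes> b \<in> S0}" "b \<noteq> \<zero>"
        using nbhds_nonzero by blast
      then show ?thesis by blast
    qed
    then obtain b where b: "\<And>t. b t \<in> S0" "\<And>t. b t \<noteq> \<zero>" "\<And>t. f t \<otimes> b t \<in> S0" by (metis DiffE singletonI)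
    have bc: "b \<in> UNIV \<rightarrow> carrier K" using b(1) nbhds_closed[OF S0_nbhd] by auto
    have bR: "germ b \<in> limit_ring" using b bc by (intro germ_limit_ringI[where k = 0]) auto
    have xbR: "x \<otimes>\<^bsub>upower\<^esub> germ b \<in> limit_ring"
      unfolding f(2) upower_mult[OF f(1) bc] using b nbhds_closed[OF S0_nbhd]
      by (intro germ_limit_ringI[where k = 0]) auto
    have b0: "germ b \<noteq> \<zero>\<^bsub>upower\<^esub>"
      using b(2) by (simp add: upower_zero germ_eq_iff[OF bc] not_bot)
    then have "germ b \<in> Units upower" using bR limit_ring_carrier UP.field_Units by auto
    then have "x = (x \<otimes>\<^bsub>upower\<^esub> germ b) \<otimes>\<^bsub>upower\<^esub> inv\<^bsub>upower\<^esub> germ b"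
      using x by (simp add: UP.m_assoc UP.Units_closed)
    then show "x \<in> fractions upower limit_ring" using bR b0 xbR unfolding fractions_def by blast
  qed
qed

text \<open>The condition on \<open>S0\<close> is applied in every coordinate. The index it yields
  varies with \<open>t\<close>, but ranges over a finite set and is therefore constant on a set of
  the ultrafilter.\<close>

lemma limit_ring_W_set: "W_set n upower limit_ring"
  unfolding W_set_def
proof (intro conjI ballI)
  let ?I = "{1..n+1}"
  fix x assume x: "x \<in> ?I \<rightarrow> carrier upower"
  have "\<exists>g. g \<in> UNIV \<rightarrow> carrier K \<and> x j = germ g" if "j \<in> ?I" for j
  proof -
    have "x j \<in> carrier upower" using x that by auto
    then show ?thesis by (metis carrierE)
  qed
  then obtain g where g: "\<And>j. j \<in> ?I \<Longrightarrow> g j \<in> UNIV \<rightarrow> carrier K" "\<And>j. j \<in> ?I \<Longrightarrow> x j = germ (g j)"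
    by metis
  define P where "P t i s \<longleftrightarrow> s \<in> ?I - {i} \<rightarrow> S0 \<and> g i t = (\<Oplus>j\<in>?I - {i}. g j t \<otimes> s j)" for t i s
  have "\<exists>i\<in>?I. \<exists>s. P t i s" for t
  proof -
    have "(\<lambda>j. g j t) \<in> ?I \<rightarrow> carrier K"
    proof
      fix j assume "j \<in> ?I"
      then have "g j \<in> UNIV \<rightarrow> carrier K" by (rule g(1))
      then show "g j t \<in> carrier K" by auto
    qed
    from W_setD[OF S0_W_set this] show ?thesis unfolding P_def by blast
  qed
  then have "eventually (\<lambda>t. \<exists>i\<in>?I. \<exists>s. P t i s) F" by simp
  then obtain i where i: "i \<in> ?I" "eventually (\<lambda>t. \<exists>s. P t i s) F"
    using eventually_finite_bex[of ?I "\<lambda>t i. \<exists>s. P t i s"] by blast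
  \<comment> \<open>The default \<open>\<one>\<close> lies in \<open>S0\<close>, so the coefficients
    belong to \<open>S0\<close> in every coordinate.\<close>
  define s where "s t = (if \<exists>s. P t i s then SOME s. P t i s else (\<lambda>j. \<one>))" for t
  have sP: "P t i (s t)" if "\<exists>s. P t i s" for t using someI_ex[OF that] that by (simp add: s_def)
  have sS: "s t j \<in> S0" if "j \<in> ?I - {i}" for t j
  proof (cases "\<exists>s. P t i s")
    case True
    then show ?thesis using sP[OF True] that unfolding P_def by blast
  next
    case False
    then show ?thesis using S0_one by (simp add: s_def)
  qed
  have sc: "(\<lambda>t. s t j) \<in> UNIV \<rightarrow> carrier K" if "j \<in> ?I - {i}" for j
    using sS[OF that] nbhds_closed[OF S0_nbhd] by blast
  define \<sigma> where "\<sigma> j = germ (\<lambda>t. s t j)" for j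
  have \<sigma>R: "\<sigma> \<in> ?I - {i} \<rightarrow> limit_ring"
    unfolding \<sigma>_def using sc sS by (intro Pi_I germ_limit_ringI[where k = 0]) auto
  have gs: "(\<lambda>t. g j t \<otimes> s t j) \<in> UNIV \<rightarrow> carrier K" if "j \<in> ?I - {i}" for j
    using g(1)[of j] sc[OF that] that by (auto simp: Pi_def)
  have "x i = germ (\<lambda>t. \<Oplus>j\<in>?I - {i}. g j t \<otimes> s t j)"
    unfolding g(2)[OF i(1)]
  proof (rule germ_cong, rule eventually_mono[OF i(2)])
    fix t assume "\<exists>s. P t i s"
    then have "P t i (s t)" by (rule sP)
    then show "g i t = (\<Oplus>j\<in>?I - {i}. g j t \<otimes> s t j)" by (simp only: P_def)
  qed
  also have "\<dots> = (\<Oplus>\<^bsub>upower\<^esub>j\<in>?I - {i}. germ (\<lambda>t. g j t \<otimes> s t j))"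
    using gs by (intro upower_finsum[symmetric]) auto
  also have "\<dots> = (\<Oplus>\<^bsub>upower\<^esub>j\<in>?I - {i}. x j \<otimes>\<^bsub>upower\<^esub> \<sigma> j)"
  proof (intro UP.finsum_cong' refl)
    show "germ (\<lambda>t. g j t \<otimes> s t j) = x j \<otimes>\<^bsub>upower\<^esub> \<sigma> j" if "j \<in> ?I - {i}" for j
      using that g sc by (simp add: \<sigma>_def upower_mult)
    show "(\<lambda>j. x j \<otimes>\<^bsub>upower\<^esub> \<sigma> j) \<in> ?I - {i} \<rightarrow> carrier upower"
      using x \<sigma>R limit_ring_carrier by (intro Pi_I UP.m_closed) blast+
  qed
  finally show "\<exists>i\<in>?I. \<exists>s\<in>?I - {i} \<rightarrow> limit_ring. x i = (\<Oplus>\<^bsub>upower\<^esub>j\<in>?I - {i}. x j \<otimes>\<^bsub>upower\<^esub> s j)"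
    using i(1) \<sigma>R by blast
qed (rule limit_ring_carrier)

text \<open>The stages increase and almost all \<open>t\<close> are at least \<open>k\<close>. Hence
  the limit ring lies in the internal set of the diagonal sequence.\<close>

lemma eventually_stage:
  assumes "eventually (\<lambda>t. f t \<in> stage k) F"
  shows "eventually (\<lambda>t. f t \<in> stage t) F"
proof -
  have "eventually (\<lambda>t. k \<le> t) F" using F_le eventually_ge_at_top filter_leD by blast
  then show ?thesis using assms by eventually_elim (use stage_mono in blast)
qed

text \<open>Bounded sets are not the whole field, so some \<open>f\<close> avoids
  \<open>stage t\<close> in every coordinate \<open>t\<close>; its germ lies in no fixed
  stage.\<close>

lemma limit_ring_proper: "limit_ring \<noteq> carrier upower"
proof
  assume eq: "limit_ring = carrier upower"
  have "\<exists>x\<in>carrier K. x \<notin> stage t" for t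
    using stage_bounded[of t] not_bounded_carrier stage_carrier[of _ t] by (metis subsetI subset_antisym)
  then obtain f where f: "\<And>t. f t \<in> carrier K" "\<And>t. f t \<notin> stage t" by metis
  then have fc: "f \<in> UNIV \<rightarrow> carrier K" by auto
  then have "germ f \<in> limit_ring" using eq germ_carrier by blast
  then obtain k where "germ f \<in> star (\<lambda>t. stage k)" by (auto simp: limit_ring_def)
  then have "eventually (\<lambda>t. f t \<in> stage k) F" by (rule germ_mem_star[OF fc, THEN iffD1])
  then have "eventually (\<lambda>t. f t \<in> stage t) F" by (rule eventually_stage)
  then show False using f(2) not_bot by simp
qed

section \<open>Internal neighbourhoods and the topology induced by the limit ring\<close>

sublocale LR: frac_subring upower limit_ring
  by (intro frac_subring.intro frac_subring_axioms.intro upower_field limit_ring_subring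
      limit_ring_fractions)

abbreviation limit_nbhds :: "(nat \<Rightarrow> 'a) set set set" where
  "limit_nbhds \<equiv> zero_nbhds upower (induced_topology upower limit_ring)"

text \<open>Choose \<open>c t\<close> to scale the bounded set \<open>stage t\<close> into
  \<open>U t\<close>. By \<open>eventually_stage\<close> the single scalar \<open>germ c\<close>
  then scales the whole limit ring into \<open>star U\<close>.\<close>

lemma star_nbhd:
  assumes "U \<in> UNIV \<rightarrow> nbhds"
  shows "star U \<in> limit_nbhds"
proof -
  have "\<exists>c\<in>carrier K - {\<zero>}. \<forall>x\<in>stage t. c \<otimes> x \<in> U t" for t
    using boundedE[OF stage_bounded, of "U t" t] assms by (metis Diff_iff PiE UNIV_I singletonD)
  then obtain c where c: "\<And>t. c t \<in> carrier K" "\<And>t. c t \<noteq> \<zero>" "\<And>t x. x \<in> stage t \<Longrightarrow> c t \<otimes> x \<in> U t"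
    by (metis Diff_iff singletonI)
  have cc: "c \<in> UNIV \<rightarrow> carrier K" using c by auto
  have "germ c <#\<^bsub>upower\<^esub> limit_ring \<subseteq> star U"
  proof
    fix y assume "y \<in> germ c <#\<^bsub>upower\<^esub> limit_ring"
    then obtain x where x: "x \<in> limit_ring" "y = germ c \<otimes>\<^bsub>upower\<^esub> x" by (auto simp: l_coset_def)
    obtain f k where f: "f \<in> UNIV \<rightarrow> carrier K" "x = germ f" "eventually (\<lambda>t. f t \<in> stage k) F"
      using limit_ringE[OF x(1)] by blast
    have "eventually (\<lambda>t. c t \<otimes> f t \<in> U t) F"
      using eventually_stage[OF f(3)] by eventually_elim (rule c(3))
    then show "y \<in> star U"
      unfolding x(2) f(2) upower_mult[OF cc f(1)] using f(1) c(1) by (subst germ_mem_star) auto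
  qed
  moreover have "germ c \<noteq> \<zero>\<^bsub>upower\<^esub>" using c(2) by (simp add: upower_zero germ_eq_iff[OF cc] not_bot)
  ultimately show ?thesis
    unfolding LR.zero_nbhds_induced using star_carrier germ_carrier[OF cc] by blast
qed

text \<open>The limit ring contains the internal neighbourhood of the constant sequence
  \<open>S0\<close>, so \<open>c R\<close> contains its multiple by \<open>c\<close>.\<close>

lemma star_nbhds_basis:
  assumes "U \<in> limit_nbhds"
  shows "\<exists>V\<in>star ` (UNIV \<rightarrow> nbhds). V \<subseteq> U"
proof -
  obtain c where c: "c \<in> carrier upower" "c \<noteq> \<zero>\<^bsub>upower\<^esub>" "c <#\<^bsub>upower\<^esub> limit_ring \<subseteq> U"
    using assms by (auto simp: LR.zero_nbhds_induced)
  obtain g where g: "g \<in> UNIV \<rightarrow> carrier K" "c = germ g" using carrierE[OF c(1)] by blast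
  have g0: "eventually (\<lambda>t. g t \<noteq> \<zero>) F"
    using c(2) g germ_eq_iff[OF g(1), of "\<lambda>t. \<zero>"] by (simp add: upower_zero eventually_not_iff)
  \<comment> \<open>In the negligible coordinates where \<open>g\<close> vanishes,
    \<open>g t <# S0\<close> would not be a neighbourhood; any neighbourhood will do there.\<close>
  define V where "V t = (if g t = \<zero> then carrier K else g t <# S0)" for t
  have "V t \<in> nbhds" for t
    using nbhds_carrier nbhds_l_coset[OF S0_nbhd, of "g t"] g(1) by (auto simp: V_def)
  then have "star V \<in> star ` (UNIV \<rightarrow> nbhds)" by blast
  moreover have "star V \<subseteq> c <#\<^bsub>upower\<^esub> limit_ring"
  proof
    fix y assume y: "y \<in> star V"
    then obtain f where f: "f \<in> UNIV \<rightarrow> carrier K" "y = germ f" "eventually (\<lambda>t. f t \<in> V t) F"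
      by (auto simp: star_def)
    have "\<exists>h\<in>S0. f t \<in> g t <# S0 \<longrightarrow> f t = g t \<otimes> h" for t
      using S0_one by (cases "f t \<in> g t <# S0") (auto simp: l_coset_def)
    then obtain h where h: "\<And>t. h t \<in> S0" "\<And>t. f t \<in> g t <# S0 \<Longrightarrow> f t = g t \<otimes> h t" by metis
    have hc: "h \<in> UNIV \<rightarrow> carrier K" using h(1) nbhds_closed[OF S0_nbhd] by blast
    have "eventually (\<lambda>t. f t = g t \<otimes> h t) F"
      using g0 f(3) by eventually_elim (rule h(2), simp add: V_def)
    then have "y = c \<otimes>\<^bsub>upower\<^esub> germ h"
      unfolding f(2) g(2) upower_mult[OF g(1) hc] by (rule germ_cong)
    moreover have "germ h \<in> limit_ring" using h hc by (intro germ_limit_ringI[where k = 0]) auto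
    ultimately show "y \<in> c <#\<^bsub>upower\<^esub> limit_ring" unfolding l_coset_def by blast
  qed
  ultimately show ?thesis using c(3) by blast
qed

text \<open>The induced neighbourhoods are exchanged for their internal basis, which is where
  locality of the sentence enters. Los's theorem then gives an eventual statement that no longer
  depends on the coordinate.\<close>

lemma locally_equivalent_limit_ring:
  "locally_equivalent K T upower (induced_topology upower limit_ring)"
  unfolding locally_equivalent_def
proof (intro allI impI)
  fix f assume f: "local_sentence f"
  interpret LT: topological_field_ring upower "induced_topology upower limit_ring"
    using LR.ring_topology_induced[OF limit_ring_proper] by unfold_locales
  have sub: "star ` (UNIV \<rightarrow> nbhds) \<subseteq> limit_nbhds" using star_nbhd by blast
  let ?s = "\<lambda>V::nat. star (\<lambda>t. carrier K)"
  have s: "?s \<in> UNIV \<rightarrow> limit_nbhds" using nbhds_carrier by (auto intro!: star_nbhd)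
  have "models upower (induced_topology upower limit_ring) f \<longleftrightarrow>
      sat upower limit_nbhds (\<lambda>x. germ (\<lambda>t. \<zero>)) ?s f"
    using s by (intro models_iff_sat f) (auto intro!: germ_carrier)
  also have "\<dots> \<longleftrightarrow> sat upower (star ` (UNIV \<rightarrow> nbhds)) (\<lambda>x. germ (\<lambda>t. \<zero>)) ?s f"
    by (rule sat_local_basis[OF sub star_nbhds_basis, symmetric])
      (use f in \<open>simp_all add: local_sentence_def\<close>)
  also have "\<dots> \<longleftrightarrow> eventually (\<lambda>t. sat K nbhds (\<lambda>x. \<zero>) (\<lambda>V. carrier K) f) F"
    using nbhds_carrier by (intro sat_upower) auto
  also have "\<dots> \<longleftrightarrow> models K T f" using models_iff_sat_const[OF f] not_bot by simp
  finally show "models K T f \<longleftrightarrow> models upower (induced_topology upower limit_ring) f" by simp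
qed

end

section \<open>Transfer in both directions\<close>

context topological_field_ring
begin

lemma W_topology_imp_locally_equivalent:
  assumes W: "W_topology n K T"
  shows "\<exists>(L :: (nat \<Rightarrow> 'a) set ring) R. field L \<and> W_ring n L R \<and> R \<noteq> carrier L \<and>
    locally_equivalent K T L (induced_topology L R)"
proof -
  obtain F :: "nat filter" where F: "F \<le> sequentially" "F \<noteq> bot"
    "\<And>P. eventually P F \<or> eventually (\<lambda>t. \<not> P t) F"
    using exists_ultrafilter_le[of sequentially] sequentially_bot by metis
  obtain B where B: "B \<in> nbhds" "bounded B"
    using W locally_boundedE unfolding W_topology_def by blast
  obtain c where c: "c \<in> carrier K" "c \<noteq> \<zero>" "W_set n K (c <# B)"
    using W B unfolding W_topology_def by blast
  \<comment> \<open>\<open>\<one>\<close> is adjoined so that the stages increase and the limit is a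
    ring with one; the properties of \<open>c <# B\<close> survive this enlargement.\<close>
  define S0 where "S0 = (c <# B) \<union> {\<one>}"
  have cB: "c <# B \<in> nbhds" using nbhds_l_coset[OF B(1) c(1,2)] .
  have S0c: "S0 \<subseteq> carrier K" using nbhds_sub[OF cB] by (simp add: S0_def)
  have "S0 \<in> nbhds" by (rule nbhds_mono[OF cB _ S0c]) (auto simp: S0_def)
  moreover have "bounded S0" unfolding S0_def
    using bounded_Un[OF bounded_l_coset[OF B(2) c(1)] bounded_singleton[of \<one>]] by simp
  moreover have "W_set n K S0" by (rule W_set_mono[OF c(3) _ S0c]) (auto simp: S0_def)
  moreover have "\<one> \<in> S0" by (simp add: S0_def)
  ultimately interpret topological_ultrapower K T F n S0
    using F by unfold_locales
  have "W_ring n upower limit_ring"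
    using limit_ring_subring limit_ring_fractions limit_ring_W_set by (simp add: W_ring_def)
  then show ?thesis
    using upower_field limit_ring_proper locally_equivalent_limit_ring by blast
qed

lemma
  assumes "field L" "W_ring n L R" "R \<noteq> carrier L"
    and eq: "locally_equivalent K T L (induced_topology L R)"
  shows locally_equivalent_imp_W_topology: "W_topology n K T"
    and locally_equivalent_imp_field_topology: "field_topology K T"
proof -
  interpret L: frac_subring L R
    using assms by (simp add: frac_subring_def frac_subring_axioms_def W_ring_def)
  interpret LT: topological_field_ring L "induced_topology L R"
    using L.ring_topology_induced[OF assms(3)] by unfold_locales
  have W: "W_set n L R" using assms(2) by (simp add: W_ring_def)
  show "W_topology n K T"
    using L.W_topology_induced[OF W assms(3)] eq local_sentence_W_form
      local_sentence_locally_bounded_form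
    unfolding W_topology_iff_models LT.W_topology_iff_models locally_equivalent_def by blast
  show "field_topology K T"
    using L.models_inverse_form_induced[OF W assms(3)] eq local_sentence_inverse_form
    by (intro field_topology_if_models) (auto simp: locally_equivalent_def)
qed

end

text \<open>HOL cannot quantify over types, so the equivalence names the type of the ultrapower, and
  its converse direction is stated once more for fields of an arbitrary type.\<close>

theorem corollary3p8:
  fixes K :: "('a, 'm) ring_scheme" and T :: "'a topology" and n :: nat
  assumes "field K" and "ring_topology K T" and "n \<ge> 1"
  shows "(W_topology n K T \<longleftrightarrow>
            (\<exists>(L :: (nat \<Rightarrow> 'a) set ring) R.
               field L \<and> W_ring n L R \<and> R \<noteq> carrier L \<and>
               locally_equivalent K T L (induced_topology L R)))
       \<and> (\<forall>(L :: ('b, 'k) ring_scheme) R.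
            field L \<and> W_ring n L R \<and> R \<noteq> carrier L \<and>
            locally_equivalent K T L (induced_topology L R) \<longrightarrow> W_topology n K T)
       \<and> (W_topology n K T \<longrightarrow> field_topology K T)
       \<and> (W_topology n K T \<longrightarrow> (\<forall>m>n. W_topology m K T))
       \<and> (W_topology 1 K T \<longleftrightarrow> V_topology K T)"
proof -
  interpret topological_field_ring K T
    using assms by (simp add: topological_field_ring_def topological_field_ring_axioms_def)
  show ?thesis
  proof (intro conjI iffI allI impI)
    assume "W_topology n K T"
    then show "\<exists>(L :: (nat \<Rightarrow> 'a) set ring) R. field L \<and> W_ring n L R \<and> R \<noteq> carrier L \<and>
      locally_equivalent K T L (induced_topology L R)"
      by (rule W_topology_imp_locally_equivalent)
    \<comment> \<open>Continuity of inversion is first known for the induced topology on the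
      ultrapower and comes back to \<open>K\<close> as a local sentence.\<close>
    then show "field_topology K T"
      by (elim exE conjE) (rule locally_equivalent_imp_field_topology)
  next
    assume "\<exists>(L :: (nat \<Rightarrow> 'a) set ring) R. field L \<and> W_ring n L R \<and> R \<noteq> carrier L \<and>
      locally_equivalent K T L (induced_topology L R)"
    then show "W_topology n K T"
      by (elim exE conjE) (rule locally_equivalent_imp_W_topology)
  next
    fix L :: "('b, 'k) ring_scheme" and R
    assume "field L \<and> W_ring n L R \<and> R \<noteq> carrier L \<and>
      locally_equivalent K T L (induced_topology L R)"
    then show "W_topology n K T"
      by (elim conjE) (rule locally_equivalent_imp_W_topology)
  next
    fix m assume "W_topology n K T" "n < m"
    then show "W_topology m K T" by (intro W_topology_le[of n m]) simp_all
  qed (fact W_topology_imp_V_topology, fact V_topology_imp_W_topology)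
qed

end
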